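(* Let $(\mathcal{B},\mathbb{E},\mathfrak{s})$ be an extriangulated category with enough projectives and enough injectives, and let $((\mathcal{S},\mathcal{T}),(\mathcal{U},\mathcal{V}))$ be a twin cotorsion pair on $\mathcal{B}$ with heart $\overline{\mathcal{H}}=\mathcal{H}/[\mathcal{W}]$, where $\mathcal{W}=\mathcal{T}\cap\mathcal{U}$. If $\mathcal{T}\subseteq\mathcal{U}$ or $\mathcal{U}\subseteq\mathcal{T}$, then $\overline{\mathcal{H}}$ is integral and quasi-abelian.
   Context: **Extriangulated categories (Nakaoka--Palu).** Let $\mathcal{B}$ be an additive category and $\mathbb{E}\colon\mathcal{B}^{\mathrm{op}}\times\mathcal{B}\to\mathsf{Ab}$ a biadditive functor. An element $\delta\in\mathbb{E}(C,A)$ is an extension. For $f\colon A\to X$ and $g\colon Y\to C$ put $f_*\delta=\mathbb{E}(C,f)(\delta)\in\mathbb{E}(C,X)$ and $g^*\delta=\mathbb{E}(g,A)(\delta)\in\mathbb{E}(Y,A)$. A morphism of extensions from $\delta\in\mathbb{E}(C,A)$ to $\delta'\in\mathbb{E}(D,B)$ is a pair $(f\colon A\to B,\,h\colon C\to D)$ with $f_*\delta=h^*\delta'$. Two sequences $A\xrightarrow{a}B\xrightarrow{b}C$ and $A\xrightarrow{a'}B'\xrightarrow{b'}C$ are equivalent if there is an isomorphism $g\colon B\to B'$ with $ga=a'$ and $b'g=b$; $[A\xrightarrow{a}B\xrightarrow{b}C]$ denotes the equivalence class. Let $\mathfrak{s}$ assign to each extension $\delta\in\mathbb{E}(C,A)$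 an equivalence class $\mathfrak{s}(\delta)=[A\xrightarrow{a}B\xrightarrow{b}C]$; one says that $\delta$ is realised by $A\xrightarrow{a}B\xrightarrow{b}C$. $\mathfrak{s}$ is a realisation of $\mathbb{E}$ if, whenever $\mathfrak{s}(\delta)=[A\xrightarrow{a}B\xrightarrow{b}C]$, $\mathfrak{s}(\delta')=[A'\xrightarrow{a'}B'\xrightarrow{b'}C']$ and $(f,h)\colon\delta\to\delta'$ is a morphism of extensions, there is $g\colon B\to B'$ with $ga=a'f$ and $b'g=hb$ (then $(f,g,h)$ realises $(f,h)$). It is additive if (i) $0\in\mathbb{E}(C,A)$ is realised by the split sequence $A\to A\oplus C\to C$ for all $A,C$, and (ii) if $\delta\in\mathbb{E}(C,A)$ and $\delta'\in\mathbb{E}(C',A')$ are realised by $A\xrightarrow{a}B\xrightarrow{b}C$ and $A'\xrightarrow{a'}B'\xrightarrow{b'}C'$ respectively, then $\delta\oplus\delta'=(i_A)_*(p_C)^*\delta+(i_{A'})_*(p_{C'})^*\delta'\in\mathbb{E}(C\oplus C',A\oplus A')$ is realised by $A\oplus A'\xrightarrow{a\oplus a'}B\oplus B'\xrightarrow{b\oplus b'}C\oplus C'$, where $i$ and $p$ denote the canonical inclusions and projections. $(\mathcal{B},\mathbb{E},\mathfrak{s})$ is an extriangulated category if: (ET1) $\mathbb{E}$ is biadditive; (ET2) $\mathfrak{s}$ is an additive realisation of $\mathbb{E}$; (ET3) if $\mathfrak{s}(\delta)=[A\xrightarrow{a}B\xrightarrow{b}C]$, $\mathfrak{s}(\delta')=[A'\xrightarrow{a'}B'\xrightarrow{b'}C']$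 and $f\colon A\to A'$, $g\colon B\to B'$ satisfy $ga=a'f$, then there is $h\colon C\to C'$ with $f_*\delta=h^*\delta'$ and $hb=b'g$; (ET3$^{\mathrm{op}}$) dually, if $g\colon B\to B'$, $h\colon C\to C'$ satisfy $hb=b'g$, then there is $f\colon A\to A'$ with $f_*\delta=h^*\delta'$ and $ga=a'f$; (ET4) if $\delta\in\mathbb{E}(D,A)$ and $\delta'\in\mathbb{E}(F,B)$ are realised by $A\xrightarrow{a}B\xrightarrow{a'}D$ and $B\xrightarrow{b}C\xrightarrow{b'}F$, then there are an object $E$, an extension $\delta''\in\mathbb{E}(E,A)$ realised by $A\xrightarrow{c}C\xrightarrow{c'}E$, and morphisms $d\colon D\to E$, $e\colon E\to F$ with $c=ba$, $c'b=da'$, $ec'=b'$, $\mathfrak{s}((a')_*\delta')=[D\xrightarrow{d}E\xrightarrow{e}F]$, $d^*\delta''=\delta$ and $a_*\delta''=e^*\delta'$; (ET4$^{\mathrm{op}}$) the dual of (ET4). A conflation is a sequence $A\to B\to C$ that realises some extension in $\mathbb{E}(C,A)$. **Projectives and injectives.** An object $P\in\mathcal{B}$ is projective if for every conflation $A\to B\xrightarrow{b}C$ and every $c\colon P\to C$ there is $d\colon P\to B$ with $bd=c$. $\mathcal{B}$ has enough projectives if for every $C\in\mathcal{B}$ there is a conflation $A\to P\to C$ with $P$ projective. Injective objects and having enough injectives are defined dually. **Twin cotorsion pairs.** For full subcategories $\mathcal{X},\mathcal{Y}$ of $\mathcal{B}$ closed under isomorphisms: $\operatorname{Cone}(\mathcal{Y},\mathcal{X})$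 is the full subcategory of objects $Z$ admitting a conflation $Y\to X\to Z$ with $X\in\mathcal{X}$, $Y\in\mathcal{Y}$; $\operatorname{CoCone}(\mathcal{Y},\mathcal{X})$ is the full subcategory of objects $Z$ admitting a conflation $Z\to Y\to X$ with $X\in\mathcal{X}$, $Y\in\mathcal{Y}$. A pair $(\mathcal{U},\mathcal{V})$ of full additive subcategories closed under direct summands is a cotorsion pair on $\mathcal{B}$ if $\mathbb{E}(\mathcal{U},\mathcal{V})=0$ (i.e. $\mathbb{E}(U,V)=0$ for all $U\in\mathcal{U}$, $V\in\mathcal{V}$) and $\mathcal{B}=\operatorname{Cone}(\mathcal{V},\mathcal{U})=\operatorname{CoCone}(\mathcal{V},\mathcal{U})$. If $(\mathcal{S},\mathcal{T})$ and $(\mathcal{U},\mathcal{V})$ are cotorsion pairs on $\mathcal{B}$, then $((\mathcal{S},\mathcal{T}),(\mathcal{U},\mathcal{V}))$ is a twin cotorsion pair on $\mathcal{B}$ if $\mathbb{E}(\mathcal{S},\mathcal{V})=0$ (equivalently $\mathcal{S}\subseteq\mathcal{U}$, equivalently $\mathcal{V}\subseteq\mathcal{T}$). **Heart.** For a twin cotorsion pair $((\mathcal{S},\mathcal{T}),(\mathcal{U},\mathcal{V}))$ define full subcategories $\mathcal{W}=\mathcal{T}\cap\mathcal{U}$, $\mathcal{B}^-=\operatorname{CoCone}(\mathcal{W},\mathcal{S})$, $\mathcal{B}^+=\operatorname{Cone}(\mathcal{V},\mathcal{W})$, $\mathcal{H}=\mathcal{B}^-\cap\mathcal{B}^+$.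 $[\mathcal{W}]$ is the ideal of morphisms factoring through an object of $\mathcal{W}$. The heart is the additive quotient $\overline{\mathcal{H}}=\mathcal{H}/[\mathcal{W}]$ (objects of $\mathcal{H}$, morphism groups $\mathcal{B}(X,Y)/[\mathcal{W}](X,Y)$). It is known (Liu--Nakaoka) that $\overline{\mathcal{H}}$ is semi-abelian, in particular preabelian (additive, with all kernels and cokernels); here a preabelian category is semi-abelian if every morphism $f$ can be written as $f=ip$ with $i$ a monomorphism and $p$ a cokernel, and also as $f=i'p'$ with $i'$ a kernel and $p'$ an epimorphism. **Integral and quasi-abelian.** A preabelian category is integral if epimorphisms are stable under pullback and monomorphisms are stable under pushout. It is quasi-abelian if cokernels (morphisms that are a cokernel of some morphism) are stable under pullback and kernels are stable under pushout. *)

theory Defs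
  imports "HOL-Algebra.Coset"
begin

section \<open>Preadditive and additive categories\<close>

text \<open>
  The morphism sets are abelian groups, written multiplicatively because they are records of
  HOL-Algebra: the sum of two morphisms \<open>f, g : X \<rightarrow> Y\<close> is \<open>f \<otimes>\<^bsub>Hom C X Y\<^esub> g\<close>, and the zero morphism
  is \<open>\<one>\<^bsub>Hom C X Y\<^esub>\<close>.
\<close>

record ('o, 'm) preadd_cat =
  Obj :: "'o set"
  Hom :: "'o \<Rightarrow> 'o \<Rightarrow> 'm monoid"
  Ident :: "'o \<Rightarrow> 'm"
  Comp :: "'m \<Rightarrow> 'm \<Rightarrow> 'm"  (infixr "\<cdot>\<index>" 75)

definition mor :: "('o, 'm, 'x) preadd_cat_scheme \<Rightarrow> 'o \<Rightarrow> 'o \<Rightarrow> 'm set" where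
  "mor C X Y = {f. X \<in> Obj C \<and> Y \<in> Obj C \<and> f \<in> carrier (Hom C X Y)}"

text \<open>Distinct morphism sets are disjoint, so that a morphism determines its source and target.\<close>

locale preadditive_category =
  fixes C :: "('o, 'm, 'x) preadd_cat_scheme" (structure)
  assumes Hom_disjoint:
      "f \<in> mor C X Y \<Longrightarrow> f \<in> mor C X' Y' \<Longrightarrow> X = X' \<and> Y = Y'"
    and Ident_mor: "X \<in> Obj C \<Longrightarrow> Ident C X \<in> mor C X X"
    and Comp_mor: "f \<in> mor C X Y \<Longrightarrow> g \<in> mor C Y Z \<Longrightarrow> g \<cdot> f \<in> mor C X Z"
    and Comp_Ident: "f \<in> mor C X Y \<Longrightarrow> f \<cdot> Ident C X = f"
    and Ident_Comp: "f \<in> mor C X Y \<Longrightarrow> Ident C Y \<cdot> f = f"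
    and Comp_assoc:
      "f \<in> mor C W X \<Longrightarrow> g \<in> mor C X Y \<Longrightarrow> h \<in> mor C Y Z \<Longrightarrow> (h \<cdot> g) \<cdot> f = h \<cdot> (g \<cdot> f)"
    and Hom_comm_group: "X \<in> Obj C \<Longrightarrow> Y \<in> Obj C \<Longrightarrow> comm_group (Hom C X Y)"
    and Comp_add_right:
      "f \<in> mor C X Y \<Longrightarrow> f' \<in> mor C X Y \<Longrightarrow> g \<in> mor C Y Z \<Longrightarrow>
        g \<cdot> (f \<otimes>\<^bsub>Hom C X Y\<^esub> f') = (g \<cdot> f) \<otimes>\<^bsub>Hom C X Z\<^esub> (g \<cdot> f')"
    and Comp_add_left:
      "f \<in> mor C X Y \<Longrightarrow> g \<in> mor C Y Z \<Longrightarrow> g' \<in> mor C Y Z \<Longrightarrow>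
        (g \<otimes>\<^bsub>Hom C Y Z\<^esub> g') \<cdot> f = (g \<cdot> f) \<otimes>\<^bsub>Hom C X Z\<^esub> (g' \<cdot> f)"

definition zero_object :: "('o, 'm, 'x) preadd_cat_scheme \<Rightarrow> 'o \<Rightarrow> bool" where
  "zero_object C Z \<longleftrightarrow> Z \<in> Obj C \<and>
    (\<forall>X\<in>Obj C. (\<exists>!f. f \<in> mor C Z X) \<and> (\<exists>!f. f \<in> mor C X Z))"

definition biproduct ::
  "('o, 'm, 'x) preadd_cat_scheme \<Rightarrow> 'o \<Rightarrow> 'o \<Rightarrow> 'o \<Rightarrow> 'm \<Rightarrow> 'm \<Rightarrow> 'm \<Rightarrow> 'm \<Rightarrow> bool" where
  "biproduct C X Y P i\<^sub>X i\<^sub>Y p\<^sub>X p\<^sub>Y \<longleftrightarrow>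
    i\<^sub>X \<in> mor C X P \<and> i\<^sub>Y \<in> mor C Y P \<and> p\<^sub>X \<in> mor C P X \<and> p\<^sub>Y \<in> mor C P Y \<and>
    p\<^sub>X \<cdot>\<^bsub>C\<^esub> i\<^sub>X = Ident C X \<and> p\<^sub>Y \<cdot>\<^bsub>C\<^esub> i\<^sub>Y = Ident C Y \<and>
    p\<^sub>Y \<cdot>\<^bsub>C\<^esub> i\<^sub>X = \<one>\<^bsub>Hom C X Y\<^esub> \<and> p\<^sub>X \<cdot>\<^bsub>C\<^esub> i\<^sub>Y = \<one>\<^bsub>Hom C Y X\<^esub> \<and>
    (i\<^sub>X \<cdot>\<^bsub>C\<^esub> p\<^sub>X) \<otimes>\<^bsub>Hom C P P\<^esub> (i\<^sub>Y \<cdot>\<^bsub>C\<^esub> p\<^sub>Y) = Ident C P"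

locale additive_category = preadditive_category +
  assumes ex_zero_object: "\<exists>Z. zero_object C Z"
    and ex_biproduct: "X \<in> Obj C \<Longrightarrow> Y \<in> Obj C \<Longrightarrow>
      \<exists>P i\<^sub>X i\<^sub>Y p\<^sub>X p\<^sub>Y. biproduct C X Y P i\<^sub>X i\<^sub>Y p\<^sub>X p\<^sub>Y"

definition iso_mor :: "('o, 'm, 'x) preadd_cat_scheme \<Rightarrow> 'o \<Rightarrow> 'o \<Rightarrow> 'm \<Rightarrow> bool" where
  "iso_mor C X Y f \<longleftrightarrow> f \<in> mor C X Y \<and>
    (\<exists>g\<in>mor C Y X. g \<cdot>\<^bsub>C\<^esub> f = Ident C X \<and> f \<cdot>\<^bsub>C\<^esub> g = Ident C Y)"


section \<open>Preabelian, integral and quasi-abelian categories\<close>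

definition monomorphism :: "('o, 'm, 'x) preadd_cat_scheme \<Rightarrow> 'o \<Rightarrow> 'o \<Rightarrow> 'm \<Rightarrow> bool" where
  "monomorphism C X Y f \<longleftrightarrow> f \<in> mor C X Y \<and>
    (\<forall>W. \<forall>g\<in>mor C W X. \<forall>h\<in>mor C W X. f \<cdot>\<^bsub>C\<^esub> g = f \<cdot>\<^bsub>C\<^esub> h \<longrightarrow> g = h)"

definition epimorphism :: "('o, 'm, 'x) preadd_cat_scheme \<Rightarrow> 'o \<Rightarrow> 'o \<Rightarrow> 'm \<Rightarrow> bool" where
  "epimorphism C X Y f \<longleftrightarrow> f \<in> mor C X Y \<and>
    (\<forall>Z. \<forall>g\<in>mor C Y Z. \<forall>h\<in>mor C Y Z. g \<cdot>\<^bsub>C\<^esub> f = h \<cdot>\<^bsub>C\<^esub> f \<longrightarrow> g = h)"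

definition kernel_of ::
  "('o, 'm, 'x) preadd_cat_scheme \<Rightarrow> 'o \<Rightarrow> 'o \<Rightarrow> 'm \<Rightarrow> 'o \<Rightarrow> 'm \<Rightarrow> bool" where
  "kernel_of C X Y f K k \<longleftrightarrow>
    f \<in> mor C X Y \<and> k \<in> mor C K X \<and> f \<cdot>\<^bsub>C\<^esub> k = \<one>\<^bsub>Hom C K Y\<^esub> \<and>
    (\<forall>W. \<forall>g\<in>mor C W X. f \<cdot>\<^bsub>C\<^esub> g = \<one>\<^bsub>Hom C W Y\<^esub> \<longrightarrow>
      (\<exists>!u. u \<in> mor C W K \<and> k \<cdot>\<^bsub>C\<^esub> u = g))"

definition cokernel_of ::
  "('o, 'm, 'x) preadd_cat_scheme \<Rightarrow> 'o \<Rightarrow> 'o \<Rightarrow> 'm \<Rightarrow> 'o \<Rightarrow> 'm \<Rightarrow> bool" where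
  "cokernel_of C X Y f Q q \<longleftrightarrow>
    f \<in> mor C X Y \<and> q \<in> mor C Y Q \<and> q \<cdot>\<^bsub>C\<^esub> f = \<one>\<^bsub>Hom C X Q\<^esub> \<and>
    (\<forall>Z. \<forall>g\<in>mor C Y Z. g \<cdot>\<^bsub>C\<^esub> f = \<one>\<^bsub>Hom C X Z\<^esub> \<longrightarrow>
      (\<exists>!u. u \<in> mor C Q Z \<and> u \<cdot>\<^bsub>C\<^esub> q = g))"

definition is_kernel :: "('o, 'm, 'x) preadd_cat_scheme \<Rightarrow> 'o \<Rightarrow> 'o \<Rightarrow> 'm \<Rightarrow> bool" where
  "is_kernel C K X k \<longleftrightarrow> (\<exists>Y f. kernel_of C X Y f K k)"

definition is_cokernel :: "('o, 'm, 'x) preadd_cat_scheme \<Rightarrow> 'o \<Rightarrow> 'o \<Rightarrow> 'm \<Rightarrow> bool" where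
  "is_cokernel C Y Q q \<longleftrightarrow> (\<exists>X f. cokernel_of C X Y f Q q)"

locale preabelian_category = additive_category +
  assumes ex_kernel: "f \<in> mor C X Y \<Longrightarrow> \<exists>K k. kernel_of C X Y f K k"
    and ex_cokernel: "f \<in> mor C X Y \<Longrightarrow> \<exists>Q q. cokernel_of C X Y f Q q"

definition pullback_square ::
  "('o, 'm, 'x) preadd_cat_scheme \<Rightarrow> 'o \<Rightarrow> 'o \<Rightarrow> 'o \<Rightarrow> 'o \<Rightarrow> 'm \<Rightarrow> 'm \<Rightarrow> 'm \<Rightarrow> 'm \<Rightarrow> bool" where
  "pullback_square C P X Y Z p q f g \<longleftrightarrow>
    p \<in> mor C P X \<and> q \<in> mor C P Y \<and> f \<in> mor C X Z \<and> g \<in> mor C Y Z \<and>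
    f \<cdot>\<^bsub>C\<^esub> p = g \<cdot>\<^bsub>C\<^esub> q \<and>
    (\<forall>W. \<forall>x\<in>mor C W X. \<forall>y\<in>mor C W Y. f \<cdot>\<^bsub>C\<^esub> x = g \<cdot>\<^bsub>C\<^esub> y \<longrightarrow>
      (\<exists>!u. u \<in> mor C W P \<and> p \<cdot>\<^bsub>C\<^esub> u = x \<and> q \<cdot>\<^bsub>C\<^esub> u = y))"

definition pushout_square ::
  "('o, 'm, 'x) preadd_cat_scheme \<Rightarrow> 'o \<Rightarrow> 'o \<Rightarrow> 'o \<Rightarrow> 'o \<Rightarrow> 'm \<Rightarrow> 'm \<Rightarrow> 'm \<Rightarrow> 'm \<Rightarrow> bool" where
  "pushout_square C Z X Y P f g p q \<longleftrightarrow>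
    f \<in> mor C Z X \<and> g \<in> mor C Z Y \<and> p \<in> mor C X P \<and> q \<in> mor C Y P \<and>
    p \<cdot>\<^bsub>C\<^esub> f = q \<cdot>\<^bsub>C\<^esub> g \<and>
    (\<forall>W. \<forall>x\<in>mor C X W. \<forall>y\<in>mor C Y W. x \<cdot>\<^bsub>C\<^esub> f = y \<cdot>\<^bsub>C\<^esub> g \<longrightarrow>
      (\<exists>!u. u \<in> mor C P W \<and> u \<cdot>\<^bsub>C\<^esub> p = x \<and> u \<cdot>\<^bsub>C\<^esub> q = y))"

locale integral_category = preabelian_category +
  assumes epi_stable: "pullback_square C P X Y Z p q f g \<Longrightarrow> epimorphism C X Z f \<Longrightarrow> epimorphism C P Y q"
    and mono_stable: "pushout_square C Z X Y P f g p q \<Longrightarrow> monomorphism C Z X f \<Longrightarrow> monomorphism C Y P q"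

locale quasi_abelian_category = preabelian_category +
  assumes cokernel_stable:
      "pullback_square C P X Y Z p q f g \<Longrightarrow> is_cokernel C X Z f \<Longrightarrow> is_cokernel C P Y q"
    and kernel_stable:
      "pushout_square C Z X Y P f g p q \<Longrightarrow> is_kernel C Z X f \<Longrightarrow> is_kernel C Y P q"


section \<open>Extriangulated categories\<close>

text \<open>
  \<open>Ext B C A\<close> is the group \<open>\<E>(C, A)\<close>, and \<open>ExtMap B g f\<close> is \<open>\<E>(g, f) : \<E>(C, A) \<rightarrow> \<E>(C', A')\<close> for
  \<open>g : C' \<rightarrow> C\<close> and \<open>f : A \<rightarrow> A'\<close>. \<open>RealClass B C A \<delta>\<close> is the class \<open>\<s>(\<delta>)\<close> for \<open>\<delta> \<in> \<E>(C, A)\<close>.  A sequence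
  \<open>A \<rightarrow> M \<rightarrow> C\<close> is represented by its pair of morphisms, which determines \<open>M\<close>.
\<close>

record ('o, 'm, 'e) extri_cat = "('o, 'm) preadd_cat" +
  Ext :: "'o \<Rightarrow> 'o \<Rightarrow> 'e monoid"
  ExtMap :: "'m \<Rightarrow> 'm \<Rightarrow> 'e \<Rightarrow> 'e"
  RealClass :: "'o \<Rightarrow> 'o \<Rightarrow> 'e \<Rightarrow> ('m \<times> 'm) set"

definition push :: "('o, 'm, 'e, 'x) extri_cat_scheme \<Rightarrow> 'o \<Rightarrow> 'm \<Rightarrow> 'e \<Rightarrow> 'e" where
  "push B C f \<delta> = ExtMap B (Ident B C) f \<delta>"

definition pull :: "('o, 'm, 'e, 'x) extri_cat_scheme \<Rightarrow> 'o \<Rightarrow> 'm \<Rightarrow> 'e \<Rightarrow> 'e" where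
  "pull B A g \<delta> = ExtMap B g (Ident B A) \<delta>"

locale biadditive_extension = additive_category B
  for B :: "('o, 'm, 'e, 'x) extri_cat_scheme" (structure) +
  assumes Ext_comm_group: "C \<in> Obj B \<Longrightarrow> A \<in> Obj B \<Longrightarrow> comm_group (Ext B C A)"
    and ExtMap_hom: "g \<in> mor B C' C \<Longrightarrow> f \<in> mor B A A' \<Longrightarrow>
      ExtMap B g f \<in> hom (Ext B C A) (Ext B C' A')"
    and ExtMap_Ident: "C \<in> Obj B \<Longrightarrow> A \<in> Obj B \<Longrightarrow> \<delta> \<in> carrier (Ext B C A) \<Longrightarrow>
      ExtMap B (Ident B C) (Ident B A) \<delta> = \<delta>"
    and ExtMap_Comp:
      "g \<in> mor B C' C \<Longrightarrow> g' \<in> mor B C'' C' \<Longrightarrow> f \<in> mor B A A' \<Longrightarrow> f' \<in> mor B A' A'' \<Longrightarrow>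
       \<delta> \<in> carrier (Ext B C A) \<Longrightarrow>
       ExtMap B (g \<cdot> g') (f' \<cdot> f) \<delta> = ExtMap B g' f' (ExtMap B g f \<delta>)"
    and push_add: "C \<in> Obj B \<Longrightarrow> f \<in> mor B A A' \<Longrightarrow> f' \<in> mor B A A' \<Longrightarrow> \<delta> \<in> carrier (Ext B C A) \<Longrightarrow>
      push B C (f \<otimes>\<^bsub>Hom B A A'\<^esub> f') \<delta> = push B C f \<delta> \<otimes>\<^bsub>Ext B C A'\<^esub> push B C f' \<delta>"
    and pull_add: "A \<in> Obj B \<Longrightarrow> g \<in> mor B C' C \<Longrightarrow> g' \<in> mor B C' C \<Longrightarrow> \<delta> \<in> carrier (Ext B C A) \<Longrightarrow>
      pull B A (g \<otimes>\<^bsub>Hom B C' C\<^esub> g') \<delta> = pull B A g \<delta> \<otimes>\<^bsub>Ext B C' A\<^esub> pull B A g' \<delta>"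

definition sequences :: "('o, 'm, 'x) preadd_cat_scheme \<Rightarrow> 'o \<Rightarrow> 'o \<Rightarrow> ('m \<times> 'm) set" where
  "sequences B A C = {(a, b). \<exists>M. a \<in> mor B A M \<and> b \<in> mor B M C}"

definition seq_equiv ::
  "('o, 'm, 'x) preadd_cat_scheme \<Rightarrow> 'o \<Rightarrow> 'o \<Rightarrow> (('m \<times> 'm) \<times> ('m \<times> 'm)) set" where
  "seq_equiv B A C = {((a, b), (a', b')). \<exists>M M' g.
     a \<in> mor B A M \<and> b \<in> mor B M C \<and> a' \<in> mor B A M' \<and> b' \<in> mor B M' C \<and>
     iso_mor B M M' g \<and> g \<cdot>\<^bsub>B\<^esub> a = a' \<and> b' \<cdot>\<^bsub>B\<^esub> g = b}"

definition realised ::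
  "('o, 'm, 'e, 'x) extri_cat_scheme \<Rightarrow> 'e \<Rightarrow> 'o \<Rightarrow> 'o \<Rightarrow> 'o \<Rightarrow> 'm \<Rightarrow> 'm \<Rightarrow> bool" where
  "realised B \<delta> A M C a b \<longleftrightarrow>
     \<delta> \<in> carrier (Ext B C A) \<and> a \<in> mor B A M \<and> b \<in> mor B M C \<and>
     RealClass B C A \<delta> = seq_equiv B A C `` {(a, b)}"

locale extriangulated_category = biadditive_extension +
  assumes RealClass_quotient: "C \<in> Obj B \<Longrightarrow> A \<in> Obj B \<Longrightarrow> \<delta> \<in> carrier (Ext B C A) \<Longrightarrow>
      RealClass B C A \<delta> \<in> sequences B A C // seq_equiv B A C"
    and realisation:
      "realised B \<delta> A M C a b \<Longrightarrow> realised B \<delta>' A' M' C' a' b' \<Longrightarrow>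
       f \<in> mor B A A' \<Longrightarrow> h \<in> mor B C C' \<Longrightarrow> push B C f \<delta> = pull B A' h \<delta>' \<Longrightarrow>
       \<exists>g\<in>mor B M M'. g \<cdot> a = a' \<cdot> f \<and> b' \<cdot> g = h \<cdot> b"
    and realisation_split:
      "biproduct B A C P i\<^sub>A i\<^sub>C p\<^sub>A p\<^sub>C \<Longrightarrow> realised B \<one>\<^bsub>Ext B C A\<^esub> A P C i\<^sub>A p\<^sub>C"
    and realisation_sum:
      "realised B \<delta> A M C a b \<Longrightarrow> realised B \<delta>' A' M' C' a' b' \<Longrightarrow>
       biproduct B A A' SA i\<^sub>A i\<^sub>A' p\<^sub>A p\<^sub>A' \<Longrightarrow>
       biproduct B M M' SM i\<^sub>M i\<^sub>M' p\<^sub>M p\<^sub>M' \<Longrightarrow>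
       biproduct B C C' SC i\<^sub>C i\<^sub>C' p\<^sub>C p\<^sub>C' \<Longrightarrow>
       realised B
         (push B SC i\<^sub>A (pull B A p\<^sub>C \<delta>) \<otimes>\<^bsub>Ext B SC SA\<^esub> push B SC i\<^sub>A' (pull B A' p\<^sub>C' \<delta>'))
         SA SM SC
         ((i\<^sub>M \<cdot> a \<cdot> p\<^sub>A) \<otimes>\<^bsub>Hom B SA SM\<^esub> (i\<^sub>M' \<cdot> a' \<cdot> p\<^sub>A'))
         ((i\<^sub>C \<cdot> b \<cdot> p\<^sub>M) \<otimes>\<^bsub>Hom B SM SC\<^esub> (i\<^sub>C' \<cdot> b' \<cdot> p\<^sub>M'))"
    and ET3:
      "realised B \<delta> A M C a b \<Longrightarrow> realised B \<delta>' A' M' C' a' b' \<Longrightarrow>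
       f \<in> mor B A A' \<Longrightarrow> g \<in> mor B M M' \<Longrightarrow> g \<cdot> a = a' \<cdot> f \<Longrightarrow>
       \<exists>h\<in>mor B C C'. push B C f \<delta> = pull B A' h \<delta>' \<and> h \<cdot> b = b' \<cdot> g"
    and ET3_op:
      "realised B \<delta> A M C a b \<Longrightarrow> realised B \<delta>' A' M' C' a' b' \<Longrightarrow>
       g \<in> mor B M M' \<Longrightarrow> h \<in> mor B C C' \<Longrightarrow> h \<cdot> b = b' \<cdot> g \<Longrightarrow>
       \<exists>f\<in>mor B A A'. push B C f \<delta> = pull B A' h \<delta>' \<and> g \<cdot> a = a' \<cdot> f"
    and ET4:
      "realised B \<delta> A M D a a' \<Longrightarrow> realised B \<delta>' M N F b b' \<Longrightarrow>
       \<exists>E \<delta>'' c c'. \<exists>d\<in>mor B D E. \<exists>e\<in>mor B E F.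
         realised B \<delta>'' A N E c c' \<and>
         c = b \<cdot> a \<and> c' \<cdot> b = d \<cdot> a' \<and> e \<cdot> c' = b' \<and>
         realised B (push B F a' \<delta>') D E F d e \<and>
         pull B A d \<delta>'' = \<delta> \<and> push B E a \<delta>'' = pull B M e \<delta>'"
    and ET4_op:
      "realised B \<delta> D M A a' a \<Longrightarrow> realised B \<delta>' F N M b' b \<Longrightarrow>
       \<exists>E \<delta>'' c c'. \<exists>d\<in>mor B E D. \<exists>e\<in>mor B F E.
         realised B \<delta>'' E N A c' c \<and>
         c = a \<cdot> b \<and> b \<cdot> c' = a' \<cdot> d \<and> c' \<cdot> e = b' \<and>
         realised B (pull B F a' \<delta>') F E D e d \<and>
         push B A d \<delta>'' = \<delta> \<and> pull B E a \<delta>'' = push B M e \<delta>'"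

definition conflation ::
  "('o, 'm, 'e, 'x) extri_cat_scheme \<Rightarrow> 'o \<Rightarrow> 'o \<Rightarrow> 'o \<Rightarrow> 'm \<Rightarrow> 'm \<Rightarrow> bool" where
  "conflation B A M C a b \<longleftrightarrow> (\<exists>\<delta>. realised B \<delta> A M C a b)"

definition projective_object :: "('o, 'm, 'e, 'x) extri_cat_scheme \<Rightarrow> 'o \<Rightarrow> bool" where
  "projective_object B P \<longleftrightarrow> P \<in> Obj B \<and>
    (\<forall>A M C a b. conflation B A M C a b \<longrightarrow>
      (\<forall>c\<in>mor B P C. \<exists>d\<in>mor B P M. b \<cdot>\<^bsub>B\<^esub> d = c))"

definition injective_object :: "('o, 'm, 'e, 'x) extri_cat_scheme \<Rightarrow> 'o \<Rightarrow> bool" where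
  "injective_object B I \<longleftrightarrow> I \<in> Obj B \<and>
    (\<forall>A M C a b. conflation B A M C a b \<longrightarrow>
      (\<forall>c\<in>mor B A I. \<exists>d\<in>mor B M I. d \<cdot>\<^bsub>B\<^esub> a = c))"

definition enough_projectives :: "('o, 'm, 'e, 'x) extri_cat_scheme \<Rightarrow> bool" where
  "enough_projectives B \<longleftrightarrow>
    (\<forall>C\<in>Obj B. \<exists>A P a b. conflation B A P C a b \<and> projective_object B P)"

definition enough_injectives :: "('o, 'm, 'e, 'x) extri_cat_scheme \<Rightarrow> bool" where
  "enough_injectives B \<longleftrightarrow>
    (\<forall>A\<in>Obj B. \<exists>I C a b. conflation B A I C a b \<and> injective_object B I)"


section \<open>Twin cotorsion pairs and their hearts\<close>

text \<open>Full subcategories are represented by their sets of objects.\<close>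

definition iso_closed :: "('o, 'm, 'x) preadd_cat_scheme \<Rightarrow> 'o set \<Rightarrow> bool" where
  "iso_closed B \<X> \<longleftrightarrow> (\<forall>X\<in>\<X>. \<forall>Y f. iso_mor B X Y f \<longrightarrow> Y \<in> \<X>)"

definition additive_subcategory :: "('o, 'm, 'x) preadd_cat_scheme \<Rightarrow> 'o set \<Rightarrow> bool" where
  "additive_subcategory B \<X> \<longleftrightarrow> \<X> \<subseteq> Obj B \<and> iso_closed B \<X> \<and>
    (\<exists>Z\<in>\<X>. zero_object B Z) \<and>
    (\<forall>X Y P i\<^sub>X i\<^sub>Y p\<^sub>X p\<^sub>Y. X \<in> \<X> \<and> Y \<in> \<X> \<and> biproduct B X Y P i\<^sub>X i\<^sub>Y p\<^sub>X p\<^sub>Y \<longrightarrow> P \<in> \<X>)"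

definition summand_closed :: "('o, 'm, 'x) preadd_cat_scheme \<Rightarrow> 'o set \<Rightarrow> bool" where
  "summand_closed B \<X> \<longleftrightarrow>
    (\<forall>X Y P i\<^sub>X i\<^sub>Y p\<^sub>X p\<^sub>Y. P \<in> \<X> \<and> biproduct B X Y P i\<^sub>X i\<^sub>Y p\<^sub>X p\<^sub>Y \<longrightarrow> X \<in> \<X> \<and> Y \<in> \<X>)"

definition Cone :: "('o, 'm, 'e, 'x) extri_cat_scheme \<Rightarrow> 'o set \<Rightarrow> 'o set \<Rightarrow> 'o set" where
  "Cone B \<Y> \<X> = {Z \<in> Obj B. \<exists>Y\<in>\<Y>. \<exists>X\<in>\<X>. \<exists>a b. conflation B Y X Z a b}"

definition CoCone :: "('o, 'm, 'e, 'x) extri_cat_scheme \<Rightarrow> 'o set \<Rightarrow> 'o set \<Rightarrow> 'o set" where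
  "CoCone B \<Y> \<X> = {Z \<in> Obj B. \<exists>Y\<in>\<Y>. \<exists>X\<in>\<X>. \<exists>a b. conflation B Z Y X a b}"

definition Ext_vanishes :: "('o, 'm, 'e, 'x) extri_cat_scheme \<Rightarrow> 'o set \<Rightarrow> 'o set \<Rightarrow> bool" where
  "Ext_vanishes B \<X> \<Y> \<longleftrightarrow> (\<forall>X\<in>\<X>. \<forall>Y\<in>\<Y>. carrier (Ext B X Y) = {\<one>\<^bsub>Ext B X Y\<^esub>})"

definition cotorsion_pair :: "('o, 'm, 'e, 'x) extri_cat_scheme \<Rightarrow> 'o set \<Rightarrow> 'o set \<Rightarrow> bool" where
  "cotorsion_pair B \<U> \<V> \<longleftrightarrow>
    additive_subcategory B \<U> \<and> summand_closed B \<U> \<and>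
    additive_subcategory B \<V> \<and> summand_closed B \<V> \<and>
    Ext_vanishes B \<U> \<V> \<and> Obj B = Cone B \<V> \<U> \<and> Obj B = CoCone B \<V> \<U>"

definition twin_cotorsion_pair ::
  "('o, 'm, 'e, 'x) extri_cat_scheme \<Rightarrow> 'o set \<Rightarrow> 'o set \<Rightarrow> 'o set \<Rightarrow> 'o set \<Rightarrow> bool" where
  "twin_cotorsion_pair B \<S> \<T> \<U> \<V> \<longleftrightarrow>
    cotorsion_pair B \<S> \<T> \<and> cotorsion_pair B \<U> \<V> \<and> Ext_vanishes B \<S> \<V>"

definition factor_ideal ::
  "('o, 'm, 'x) preadd_cat_scheme \<Rightarrow> 'o set \<Rightarrow> 'o \<Rightarrow> 'o \<Rightarrow> 'm set" where
  "factor_ideal B \<W> X Y = {v \<cdot>\<^bsub>B\<^esub> u | u v W. W \<in> \<W> \<and> u \<in> mor B X W \<and> v \<in> mor B W Y}"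

text \<open>
  The quotient \<open>\<H>/[\<W>]\<close>: morphisms are cosets of \<open>[\<W>](X, Y)\<close>. The union in the composition
  ranges over all representatives of the two cosets; these all contribute the same coset.
\<close>

definition ideal_quotient ::
  "('o, 'm, 'x) preadd_cat_scheme \<Rightarrow> 'o set \<Rightarrow> 'o set \<Rightarrow> ('o, 'm set) preadd_cat" where
  "ideal_quotient B \<H> \<W> =
    \<lparr> Obj = \<H>,
      Hom = (\<lambda>X Y. Hom B X Y Mod factor_ideal B \<W> X Y),
      Ident = (\<lambda>X. factor_ideal B \<W> X X #>\<^bsub>Hom B X X\<^esub> Ident B X),
      Comp = (\<lambda>G F. \<Union>{factor_ideal B \<W> X Z #>\<^bsub>Hom B X Z\<^esub> (g \<cdot>\<^bsub>B\<^esub> f) | X Y Z f g.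
                f \<in> F \<and> f \<in> mor B X Y \<and> g \<in> G \<and> g \<in> mor B Y Z}) \<rparr>"

definition twin_core :: "'o set \<Rightarrow> 'o set \<Rightarrow> 'o set" where
  "twin_core \<T> \<U> = \<T> \<inter> \<U>"

definition B_minus ::
  "('o, 'm, 'e, 'x) extri_cat_scheme \<Rightarrow> 'o set \<Rightarrow> 'o set \<Rightarrow> 'o set \<Rightarrow> 'o set" where
  "B_minus B \<S> \<T> \<U> = CoCone B (twin_core \<T> \<U>) \<S>"

definition B_plus ::
  "('o, 'm, 'e, 'x) extri_cat_scheme \<Rightarrow> 'o set \<Rightarrow> 'o set \<Rightarrow> 'o set \<Rightarrow> 'o set" where
  "B_plus B \<T> \<U> \<V> = Cone B \<V> (twin_core \<T> \<U>)"

definition heart ::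
  "('o, 'm, 'e, 'x) extri_cat_scheme \<Rightarrow> 'o set \<Rightarrow> 'o set \<Rightarrow> 'o set \<Rightarrow> 'o set \<Rightarrow>
    ('o, 'm set) preadd_cat" where
  "heart B \<S> \<T> \<U> \<V> = ideal_quotient B (B_minus B \<S> \<T> \<U> \<inter> B_plus B \<T> \<U> \<V>) (twin_core \<T> \<U>)"

end

(*
  Passing to the opposite category exchanges the two cases, so let \<T> \<subseteq> \<U>. Then \<W> = \<T> and the
  heart consists of the objects Y with a presentation \<delta>: V \<rightarrow> T \<rightarrow> Y, V in \<V> and T in \<T>; it also equals
  the class of objects that receive only morphisms of [\<T>] from \<U>. A morphism f with target Y is in [\<T>]
  iff f^*\<delta> = 0, and dually via X \<rightarrow> T \<rightarrow> S for its source X, so [\<T>] is controlled by \<E>(-, \<V>) and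
  \<E>(\<S>, -). Kernels come from f^*\<delta>, cokernels from pushing X \<rightarrow> T \<rightarrow> S out along f and reflecting into
  the heart. Every cokernel in the heart is represented by an inflation with cone in \<S>, and f is an
  epimorphism iff f^* is injective on \<E>(-, \<V>); both kinds of morphisms therefore lift along arbitrary
  morphisms. In a preabelian category in which moreover every morphism is an epimorphism followed by a
  kernel, these lifting properties already imply the stability of monomorphisms and kernels under
  pushout.
*)
theory Submission
  imports Defs
begin

section \<open>Morphisms of preadditive categories\<close>

text \<open>Epimorphisms and cokernels serve as covers, so the pushout statements become element
  chases: a morphism into the target of a cokernel is lifted to its source after passing to a cover.
  That is why commutative squares suffice. Cokernels have to be kept apart from mere epimorphisms
  because morphisms descend only along the former. The obstacle in the heart is that
  \<open>B\<close> need not have pullbacks or kernels, and that the quotient carries no conflations.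
  Extension classes replace both: vanishing in the quotient becomes an additive condition on a
  class, and (ET4) builds objects with prescribed classes. What is left is always one of the
  vanishing groups \<open>\<E>(\<S>, \<V>)\<close>, \<open>\<E>(\<S>, \<T>)\<close>,
  \<open>\<E>(\<U>, \<V>)\<close>. Objects so built need not come with a presentation; testing
  morphisms from \<open>\<U>\<close> shows them to be in the heart. Enough injectives serve to see
  that an epimorphism acts injectively on \<open>\<E>(-, V)\<close>: embedding \<open>V\<close> into
  an injective makes every such class the pullback of one fixed class along a morphism into the
  heart. Enough projectives do the same in the opposite category.\<close>

context preadditive_category
begin

abbreviation zmor where
  "zmor X Y \<equiv> \<one>\<^bsub>Hom C X Y\<^esub>"

abbreviation madd where
  "madd X Y f g \<equiv> f \<otimes>\<^bsub>Hom C X Y\<^esub> g"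

abbreviation mdiff where
  "mdiff X Y f g \<equiv> f \<otimes>\<^bsub>Hom C X Y\<^esub> inv\<^bsub>Hom C X Y\<^esub> g"

lemma mor_source: "f \<in> mor C X Y \<Longrightarrow> X \<in> Obj C"
  and mor_target: "f \<in> mor C X Y \<Longrightarrow> Y \<in> Obj C"
  and mor_carrier: "f \<in> mor C X Y \<Longrightarrow> f \<in> carrier (Hom C X Y)"
  by (auto simp: mor_def)

lemma Hom_group: "X \<in> Obj C \<Longrightarrow> Y \<in> Obj C \<Longrightarrow> group (Hom C X Y)"
  using Hom_comm_group comm_group.axioms(2) by blast

lemma Hom_group': "f \<in> mor C X Y \<Longrightarrow> group (Hom C X Y)"
  using Hom_group mor_source mor_target by blast

lemma zmor_mor [intro]: "X \<in> Obj C \<Longrightarrow> Y \<in> Obj C \<Longrightarrow> zmor X Y \<in> mor C X Y"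
  using Hom_group[of X Y] by (auto simp: mor_def group.is_monoid monoid.one_closed)

lemma madd_mor [intro]:
  assumes "f \<in> mor C X Y" "g \<in> mor C X Y" shows "madd X Y f g \<in> mor C X Y"
  using Hom_group'[OF assms(1)] assms by (auto simp: mor_def group.is_monoid monoid.m_closed)

lemma minv_mor:
  assumes "f \<in> mor C X Y" shows "inv\<^bsub>Hom C X Y\<^esub> f \<in> mor C X Y"
  using Hom_group'[OF assms(1)] assms by (auto simp: mor_def group.inv_closed)

lemma mdiff_mor [intro]: "f \<in> mor C X Y \<Longrightarrow> g \<in> mor C X Y \<Longrightarrow> mdiff X Y f g \<in> mor C X Y"
  using minv_mor madd_mor by blast

lemma mdiff_eq_zmor_iff:
  assumes "f \<in> mor C X Y" "g \<in> mor C X Y"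
  shows "mdiff X Y f g = zmor X Y \<longleftrightarrow> f = g"
proof -
  interpret group "Hom C X Y" using Hom_group'[OF assms(1)] .
  show ?thesis using assms[THEN mor_carrier] by (metis inv_equality inv_inv inv_closed r_inv)
qed

lemma mdiff_madd:
  assumes "f \<in> mor C X Y" "g \<in> mor C X Y"
  shows "madd X Y (mdiff X Y f g) g = f"
proof -
  interpret group "Hom C X Y" using Hom_group'[OF assms(1)] .
  show ?thesis using assms[THEN mor_carrier] by (simp add: m_assoc)
qed

lemma mdiff_mdiff:
  assumes "f \<in> mor C X Y" "g \<in> mor C X Y"
  shows "mdiff X Y f (mdiff X Y f g) = g"
proof -
  interpret comm_group "Hom C X Y"
    using Hom_comm_group[OF mor_source[OF assms(1)] mor_target[OF assms(1)]] .
  have c: "f \<in> carrier (Hom C X Y)" "g \<in> carrier (Hom C X Y)" using assms mor_carrier by auto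
  then show ?thesis by (simp add: inv_mult_group m_comm[of "g"] flip: m_assoc)
qed

lemma madd_zmor:
  assumes "f \<in> mor C X Y"
  shows "madd X Y (zmor X Y) f = f" "madd X Y f (zmor X Y) = f" "mdiff X Y f (zmor X Y) = f"
proof -
  interpret group "Hom C X Y" using Hom_group'[OF assms(1)] .
  show "madd X Y (zmor X Y) f = f" "madd X Y f (zmor X Y) = f" "mdiff X Y f (zmor X Y) = f"
    using assms[THEN mor_carrier] by simp_all
qed

lemma Comp_zmor [simp]:
  assumes "g \<in> mor C Y Z" "X \<in> Obj C"
  shows "g \<cdot> zmor X Y = zmor X Z"
proof -
  have Y: "Y \<in> Obj C" using assms mor_source by blast
  have z: "zmor X Y \<in> mor C X Y" using assms Y by blast
  interpret XY: group "Hom C X Y" using Hom_group assms(2) Y by blast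
  have m: "g \<cdot> zmor X Y \<in> mor C X Z" using Comp_mor z assms(1) by blast
  interpret XZ: group "Hom C X Z" using Hom_group'[OF m] .
  have "(g \<cdot> zmor X Y) \<otimes>\<^bsub>Hom C X Z\<^esub> (g \<cdot> zmor X Y) = g \<cdot> zmor X Y"
    using Comp_add_right[OF z z assms(1)] by simp
  then show ?thesis using mor_carrier[OF m] by (simp add: XZ.l_cancel_one)
qed

lemma zmor_Comp [simp]:
  assumes "f \<in> mor C X Y" "Z \<in> Obj C"
  shows "zmor Y Z \<cdot> f = zmor X Z"
proof -
  have Y: "Y \<in> Obj C" using assms mor_target by blast
  have z: "zmor Y Z \<in> mor C Y Z" using assms Y by blast
  interpret YZ: group "Hom C Y Z" using Hom_group assms(2) Y by blast
  have m: "zmor Y Z \<cdot> f \<in> mor C X Z" using Comp_mor z assms(1) by blast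
  interpret XZ: group "Hom C X Z" using Hom_group'[OF m] .
  have "(zmor Y Z \<cdot> f) \<otimes>\<^bsub>Hom C X Z\<^esub> (zmor Y Z \<cdot> f) = zmor Y Z \<cdot> f"
    using Comp_add_left[OF assms(1) z z] by simp
  then show ?thesis using mor_carrier[OF m] by (simp add: XZ.l_cancel_one)
qed

lemma Comp_mdiff:
  assumes f: "f \<in> mor C X Y" "f' \<in> mor C X Y" and g: "g \<in> mor C Y Z"
  shows "g \<cdot> mdiff X Y f f' = mdiff X Z (g \<cdot> f) (g \<cdot> f')"
proof -
  have m: "g \<cdot> mdiff X Y f f' \<in> mor C X Z" "g \<cdot> f' \<in> mor C X Z" "g \<cdot> f \<in> mor C X Z"
    using Comp_mor mdiff_mor assms by blast+
  interpret XZ: group "Hom C X Z" using Hom_group'[OF m(1)] .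
  have "(g \<cdot> mdiff X Y f f') \<otimes>\<^bsub>Hom C X Z\<^esub> (g \<cdot> f') = g \<cdot> f"
    using Comp_add_right[OF mdiff_mor[OF f] f(2) g] mdiff_madd[OF f] by simp
  then show ?thesis using m[THEN mor_carrier] by (metis XZ.inv_solve_right)
qed

lemma mdiff_Comp:
  assumes f: "f \<in> mor C X Y" and g: "g \<in> mor C Y Z" "g' \<in> mor C Y Z"
  shows "mdiff Y Z g g' \<cdot> f = mdiff X Z (g \<cdot> f) (g' \<cdot> f)"
proof -
  have m: "mdiff Y Z g g' \<cdot> f \<in> mor C X Z" "g' \<cdot> f \<in> mor C X Z" "g \<cdot> f \<in> mor C X Z"
    using Comp_mor mdiff_mor assms by blast+
  interpret XZ: group "Hom C X Z" using Hom_group'[OF m(1)] .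
  have "(mdiff Y Z g g' \<cdot> f) \<otimes>\<^bsub>Hom C X Z\<^esub> (g' \<cdot> f) = g \<cdot> f"
    using Comp_add_left[OF f mdiff_mor[OF g] g(2)] mdiff_madd[OF g] by simp
  then show ?thesis using m[THEN mor_carrier] by (metis XZ.inv_solve_right)
qed

section \<open>Monomorphisms, epimorphisms, kernels and cokernels\<close>

lemma monomorphism_iff:
  "monomorphism C X Y f \<longleftrightarrow> f \<in> mor C X Y \<and>
    (\<forall>W. \<forall>g\<in>mor C W X. f \<cdot> g = zmor W Y \<longrightarrow> g = zmor W X)"
proof
  assume m: "monomorphism C X Y f"
  then have f: "f \<in> mor C X Y" by (simp add: monomorphism_def)
  have "g = zmor W X" if g: "g \<in> mor C W X" "f \<cdot> g = zmor W Y" for W g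
  proof -
    have "f \<cdot> g = f \<cdot> zmor W X" using that f mor_source by simp
    moreover have "zmor W X \<in> mor C W X" using that f mor_source by blast
    ultimately show ?thesis using m g unfolding monomorphism_def by blast
  qed
  with f show "f \<in> mor C X Y \<and> (\<forall>W. \<forall>g\<in>mor C W X. f \<cdot> g = zmor W Y \<longrightarrow> g = zmor W X)" by blast
next
  assume *: "f \<in> mor C X Y \<and> (\<forall>W. \<forall>g\<in>mor C W X. f \<cdot> g = zmor W Y \<longrightarrow> g = zmor W X)"
  have "g = h" if g: "g \<in> mor C W X" "h \<in> mor C W X" and e: "f \<cdot> g = f \<cdot> h" for W g h
  proof -
    have "f \<cdot> g \<in> mor C W Y" "f \<cdot> h \<in> mor C W Y" using Comp_mor * g by blast+
    then have "f \<cdot> mdiff W X g h = zmor W Y"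
      using Comp_mdiff[OF g, of f Y] * e mdiff_eq_zmor_iff by simp
    then have "mdiff W X g h = zmor W X" using * mdiff_mor[OF g] by blast
    then show ?thesis using mdiff_eq_zmor_iff[OF g] by simp
  qed
  then show "monomorphism C X Y f" using * by (auto simp: monomorphism_def)
qed

lemma epimorphism_iff:
  "epimorphism C X Y f \<longleftrightarrow> f \<in> mor C X Y \<and>
    (\<forall>Z. \<forall>g\<in>mor C Y Z. g \<cdot> f = zmor X Z \<longrightarrow> g = zmor Y Z)"
proof
  assume m: "epimorphism C X Y f"
  then have f: "f \<in> mor C X Y" by (simp add: epimorphism_def)
  have "g = zmor Y Z" if g: "g \<in> mor C Y Z" "g \<cdot> f = zmor X Z" for Z g
  proof -
    have "g \<cdot> f = zmor Y Z \<cdot> f" using that f mor_target by simp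
    moreover have "zmor Y Z \<in> mor C Y Z" using that f mor_target by blast
    ultimately show ?thesis using m g unfolding epimorphism_def by blast
  qed
  with f show "f \<in> mor C X Y \<and> (\<forall>Z. \<forall>g\<in>mor C Y Z. g \<cdot> f = zmor X Z \<longrightarrow> g = zmor Y Z)" by blast
next
  assume *: "f \<in> mor C X Y \<and> (\<forall>Z. \<forall>g\<in>mor C Y Z. g \<cdot> f = zmor X Z \<longrightarrow> g = zmor Y Z)"
  have "g = h" if g: "g \<in> mor C Y Z" "h \<in> mor C Y Z" and e: "g \<cdot> f = h \<cdot> f" for Z g h
  proof -
    have "g \<cdot> f \<in> mor C X Z" "h \<cdot> f \<in> mor C X Z" using Comp_mor * g by blast+
    then have "mdiff Y Z g h \<cdot> f = zmor X Z"
      using mdiff_Comp[OF _ g, of f X] * e mdiff_eq_zmor_iff by simp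
    then have "mdiff Y Z g h = zmor Y Z" using * mdiff_mor[OF g] by blast
    then show ?thesis using mdiff_eq_zmor_iff[OF g] by simp
  qed
  then show "epimorphism C X Y f" using * by (auto simp: epimorphism_def)
qed

lemma epimorphism_mor: "epimorphism C X Y f \<Longrightarrow> f \<in> mor C X Y"
  by (simp add: epimorphism_def)

lemma epimorphism_cancel:
  "epimorphism C X Y f \<Longrightarrow> g \<in> mor C Y Z \<Longrightarrow> h \<in> mor C Y Z \<Longrightarrow> g \<cdot> f = h \<cdot> f \<Longrightarrow> g = h"
  unfolding epimorphism_def by blast

lemma monomorphism_cancel:
  "monomorphism C X Y f \<Longrightarrow> g \<in> mor C W X \<Longrightarrow> h \<in> mor C W X \<Longrightarrow> f \<cdot> g = f \<cdot> h \<Longrightarrow> g = h"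
  unfolding monomorphism_def by blast

lemma epimorphism_factor:
  assumes e: "epimorphism C W Y (f \<cdot> u)" and u: "u \<in> mor C W X" and f: "f \<in> mor C X Y"
  shows "epimorphism C X Y f"
  unfolding epimorphism_def
proof (intro conjI allI ballI impI)
  show "f \<in> mor C X Y" by fact
  fix Z g h assume g: "g \<in> mor C Y Z" "h \<in> mor C Y Z" "g \<cdot> f = h \<cdot> f"
  then have "g \<cdot> (f \<cdot> u) = h \<cdot> (f \<cdot> u)" using Comp_assoc[OF u f] by metis
  then show "g = h" using epimorphism_cancel[OF e g(1,2)] by blast
qed

lemma cokernel_epimorphism:
  assumes "cokernel_of C X Y f Q q" shows "epimorphism C Y Q q"
  unfolding epimorphism_def
proof (intro conjI allI ballI impI)
  have f: "f \<in> mor C X Y" and q: "q \<in> mor C Y Q" and qf: "q \<cdot> f = zmor X Q"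
    using assms by (auto simp: cokernel_of_def)
  show "q \<in> mor C Y Q" by fact
  fix Z g h assume g: "g \<in> mor C Q Z" "h \<in> mor C Q Z" "g \<cdot> q = h \<cdot> q"
  have "(g \<cdot> q) \<cdot> f = zmor X Z" using Comp_assoc[OF f q g(1)] qf g f mor_source by simp
  moreover have "g \<cdot> q \<in> mor C Y Z" using Comp_mor q g by blast
  ultimately have "\<exists>!u. u \<in> mor C Q Z \<and> u \<cdot> q = g \<cdot> q" using assms by (auto simp: cokernel_of_def)
  then show "g = h" using g by metis
qed

lemma kernel_monomorphism:
  assumes "kernel_of C X Y f K k" shows "monomorphism C K X k"
  unfolding monomorphism_def
proof (intro conjI allI ballI impI)
  have f: "f \<in> mor C X Y" and k: "k \<in> mor C K X" and fk: "f \<cdot> k = zmor K Y"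
    using assms by (auto simp: kernel_of_def)
  show "k \<in> mor C K X" by fact
  fix W g h assume g: "g \<in> mor C W K" "h \<in> mor C W K" "k \<cdot> g = k \<cdot> h"
  have "f \<cdot> (k \<cdot> g) = zmor W Y" using Comp_assoc[OF g(1) k f] fk g f mor_target by simp
  moreover have "k \<cdot> g \<in> mor C W X" using Comp_mor k g by blast
  ultimately have "\<exists>!u. u \<in> mor C W K \<and> k \<cdot> u = k \<cdot> g" using assms by (auto simp: kernel_of_def)
  then show "g = h" using g by metis
qed

lemma cokernel_factor:
  assumes "cokernel_of C X Y f Q q" "g \<in> mor C Y Z" "g \<cdot> f = zmor X Z"
  obtains u where "u \<in> mor C Q Z" "u \<cdot> q = g"
  using assms unfolding cokernel_of_def by blast

lemma kernel_factor:
  assumes "kernel_of C X Y f K k" "g \<in> mor C W X" "f \<cdot> g = zmor W Y"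
  obtains u where "u \<in> mor C W K" "k \<cdot> u = g"
  using assms unfolding kernel_of_def by blast

text \<open>An epimorphism \<open>q\<close> makes factorisations unique, so only their existence has
  to be supplied.\<close>

lemma cokernelI:
  assumes "f \<in> mor C X Y" "epimorphism C Y Q q" "q \<cdot> f = zmor X Q"
    and "\<And>Z g. g \<in> mor C Y Z \<Longrightarrow> g \<cdot> f = zmor X Z \<Longrightarrow> \<exists>u\<in>mor C Q Z. u \<cdot> q = g"
  shows "cokernel_of C X Y f Q q"
  unfolding cokernel_of_def
proof (intro conjI allI ballI impI)
  fix Z g assume "g \<in> mor C Y Z" "g \<cdot> f = zmor X Z"
  then show "\<exists>!u. u \<in> mor C Q Z \<and> u \<cdot> q = g"
    using assms(4) epimorphism_cancel[OF assms(2)] by metis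
qed (use assms epimorphism_mor in auto)

lemma kernelI:
  assumes "f \<in> mor C X Y" "monomorphism C K X k" "f \<cdot> k = zmor K Y"
    and "\<And>W g. g \<in> mor C W X \<Longrightarrow> f \<cdot> g = zmor W Y \<Longrightarrow> \<exists>u\<in>mor C W K. k \<cdot> u = g"
  shows "kernel_of C X Y f K k"
  unfolding kernel_of_def
proof (intro conjI allI ballI impI)
  fix W g assume "g \<in> mor C W X" "f \<cdot> g = zmor W Y"
  then show "\<exists>!u. u \<in> mor C W K \<and> k \<cdot> u = g"
    using assms(4) monomorphism_cancel[OF assms(2)] by metis
qed (use assms in \<open>auto simp: monomorphism_def\<close>)

text \<open>Serves to carry lifts from one chosen cokernel of a morphism over to an arbitrary
  one.\<close>

lemma cokernel_unique:
  assumes Q: "cokernel_of C X Y f Q q" and R: "cokernel_of C X Y f R r"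
  obtains i i' where "i \<in> mor C Q R" "i' \<in> mor C R Q" "i \<cdot> q = r" "i' \<cdot> r = q"
    "i \<cdot> i' = Ident C R"
proof -
  have q: "q \<in> mor C Y Q" "q \<cdot> f = zmor X Q" and r: "r \<in> mor C Y R" "r \<cdot> f = zmor X R"
    using Q R by (auto simp: cokernel_of_def)
  obtain i where i: "i \<in> mor C Q R" "i \<cdot> q = r" using cokernel_factor[OF Q r] .
  obtain i' where i': "i' \<in> mor C R Q" "i' \<cdot> r = q" using cokernel_factor[OF R q] .
  have "(i \<cdot> i') \<cdot> r = Ident C R \<cdot> r"
    using Comp_assoc[OF r(1) i'(1) i(1)] i i' Ident_Comp[OF r(1)] by simp
  then have "i \<cdot> i' = Ident C R"
    using epimorphism_cancel[OF cokernel_epimorphism[OF R] Comp_mor[OF i'(1) i(1)]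
        Ident_mor[OF mor_target[OF r(1)]]] by simp
  then show ?thesis using that i i' by blast
qed

section \<open>Biproducts\<close>

lemma biproduct_mor:
  assumes "biproduct C X Y P i j p q"
  shows "i \<in> mor C X P" "j \<in> mor C Y P" "p \<in> mor C P X" "q \<in> mor C P Y"
    "p \<cdot> i = Ident C X" "q \<cdot> j = Ident C Y" "q \<cdot> i = zmor X Y" "p \<cdot> j = zmor Y X"
    "madd P P (i \<cdot> p) (j \<cdot> q) = Ident C P"
  using assms by (simp_all add: biproduct_def)

text \<open>The product of a row and a column: the identity of \<open>D\<close>, written as the sum
  of \<open>i \<cdot> p\<close> and \<open>j \<cdot> q\<close>, is inserted between \<open>c\<close>
  and \<open>b\<close>.\<close>

lemma biproduct_decompose:
  assumes D: "biproduct C X Y D i j p q" and c: "c \<in> mor C D P" and b: "b \<in> mor C W D"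
  shows "c \<cdot> b = madd W P ((c \<cdot> i) \<cdot> (p \<cdot> b)) ((c \<cdot> j) \<cdot> (q \<cdot> b))"
proof -
  note d = biproduct_mor[OF D]
  have "b = Ident C D \<cdot> b" using Ident_Comp[OF b] by simp
  also have "\<dots> = madd W D ((i \<cdot> p) \<cdot> b) ((j \<cdot> q) \<cdot> b)"
    using Comp_add_left[OF b Comp_mor[OF d(3,1)] Comp_mor[OF d(4,2)]] d(9) by simp
  also have "\<dots> = madd W D (i \<cdot> (p \<cdot> b)) (j \<cdot> (q \<cdot> b))"
    using Comp_assoc[OF b d(3,1)] Comp_assoc[OF b d(4,2)] by simp
  finally have "c \<cdot> b = c \<cdot> madd W D (i \<cdot> (p \<cdot> b)) (j \<cdot> (q \<cdot> b))" by simp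
  moreover have pb: "p \<cdot> b \<in> mor C W X" "q \<cdot> b \<in> mor C W Y" using Comp_mor b d(3,4) by blast+
  ultimately show ?thesis
    using Comp_add_right[OF Comp_mor[OF pb(1) d(1)] Comp_mor[OF pb(2) d(2)] c]
      Comp_assoc[OF pb(1) d(1) c] Comp_assoc[OF pb(2) d(2) c] by simp
qed

lemma biproduct_eq_from:
  assumes D: "biproduct C X Y D i j p q" and c: "c \<in> mor C D P" "c' \<in> mor C D P"
    and "c \<cdot> i = c' \<cdot> i" "c \<cdot> j = c' \<cdot> j"
  shows "c = c'"
  using biproduct_decompose[OF D c(1)] biproduct_decompose[OF D c(2)] assms
    Comp_Ident[OF c(1)] Comp_Ident[OF c(2)] Ident_mor mor_source by metis

lemma biproduct_copair:
  assumes D: "biproduct C X Y D i j p q" and x: "x \<in> mor C X P" and y: "y \<in> mor C Y P"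
  obtains c where "c \<in> mor C D P" "c \<cdot> i = x" "c \<cdot> j = y"
proof -
  note d = biproduct_mor[OF D]
  let ?c = "madd D P (x \<cdot> p) (y \<cdot> q)"
  have m: "x \<cdot> p \<in> mor C D P" "y \<cdot> q \<in> mor C D P" using Comp_mor d x y by blast+
  have "(x \<cdot> p) \<cdot> i = x" "(y \<cdot> q) \<cdot> j = y"
    using Comp_assoc[OF d(1,3) x] Comp_assoc[OF d(2,4) y] d(5,6) Comp_Ident x y by simp_all
  moreover have "(x \<cdot> p) \<cdot> j = zmor Y P" "(y \<cdot> q) \<cdot> i = zmor X P"
    using Comp_assoc[OF d(2,3) x] Comp_assoc[OF d(1,4) y] d(7,8) x y mor_source by simp_all
  ultimately have "?c \<cdot> i = x" "?c \<cdot> j = y"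
    using Comp_add_left[OF d(1) m] Comp_add_left[OF d(2) m] madd_zmor x y by simp_all
  then show ?thesis using that madd_mor[OF m] by blast
qed

end

section \<open>A criterion for integral and quasi-abelian categories\<close>

text \<open>
  The lifting conditions are one-sided and ask for commutative squares only, not for pullbacks. With the
  factorisation condition they force the dual stability properties, as in Rump's theorem that left and
  right integral (quasi-abelian) semi-abelian categories coincide.
\<close>

locale lifting_preabelian = preabelian_category +
  assumes epi_lift: "epimorphism C X Z f \<Longrightarrow> g \<in> mor C Y Z \<Longrightarrow>
      \<exists>P p q. p \<in> mor C P X \<and> f \<cdot> p = g \<cdot> q \<and> epimorphism C P Y q"
    and cokernel_lift: "is_cokernel C X Z f \<Longrightarrow> g \<in> mor C Y Z \<Longrightarrow>
      \<exists>P p q. p \<in> mor C P X \<and> f \<cdot> p = g \<cdot> q \<and> is_cokernel C P Y q"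
    and epi_kernel_factorisation: "f \<in> mor C X Y \<Longrightarrow>
      \<exists>K j k. epimorphism C X K j \<and> is_kernel C K Y k \<and> f = k \<cdot> j"
begin

lemma is_cokernel_epimorphism: "is_cokernel C X Y q \<Longrightarrow> epimorphism C X Y q"
  unfolding is_cokernel_def using cokernel_epimorphism by blast

text \<open>The lifted square induces \<open>u\<close> into the pullback with
  \<open>q \<cdot> u = q1\<close>, so an epimorphism factors through \<open>q\<close>.\<close>

lemma pullback_epimorphism:
  assumes P: "pullback_square C P X Y Z p q f g" and f: "epimorphism C X Z f"
  shows "epimorphism C P Y q"
proof -
  have g: "g \<in> mor C Y Z" and q: "q \<in> mor C P Y" using P by (auto simp: pullback_square_def)
  obtain P1 p1 q1 where 1: "p1 \<in> mor C P1 X" "f \<cdot> p1 = g \<cdot> q1" "epimorphism C P1 Y q1"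
    using epi_lift[OF f g] by blast
  then have "q1 \<in> mor C P1 Y" using epimorphism_mor by blast
  then obtain u where u: "u \<in> mor C P1 P" "q \<cdot> u = q1"
    using P 1 unfolding pullback_square_def by blast
  then show ?thesis using epimorphism_factor[of P1 Y q u P] 1 q by simp
qed

text \<open>The candidate is the kernel \<open>k\<close> of \<open>q\<close>. If \<open>h\<close>
  kills \<open>k\<close>, then \<open>h \<cdot> u\<close> kills \<open>l\<close>, because
  \<open>u \<cdot> l\<close> factors through \<open>k\<close>; so
  \<open>h \<cdot> u = t \<cdot> (q \<cdot> u)\<close>. It remains to see that
  \<open>h = t \<cdot> q\<close> on all of \<open>P\<close>, not only after
  \<open>u\<close>.\<close>

lemma cokernel_left_factor:
  assumes c: "is_cokernel C W Y (q \<cdot> u)" and u: "u \<in> mor C W P" and q: "q \<in> mor C P Y"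
  shows "is_cokernel C P Y q"
proof -
  have qe: "epimorphism C P Y q"
    using epimorphism_factor[OF is_cokernel_epimorphism[OF c] u q] .
  obtain K k where k: "kernel_of C P Y q K k" using ex_kernel[OF q] by blast
  then have km: "k \<in> mor C K P" and qk: "q \<cdot> k = zmor K Y" by (auto simp: kernel_of_def)
  obtain L l where l: "cokernel_of C L W l Y (q \<cdot> u)" using c by (auto simp: is_cokernel_def)
  then have lm: "l \<in> mor C L W" and qul: "(q \<cdot> u) \<cdot> l = zmor L Y" by (auto simp: cokernel_of_def)
  have "cokernel_of C K P k Y q"
  proof (rule cokernelI[OF km qe qk])
    fix Z h assume h: "h \<in> mor C P Z" "h \<cdot> k = zmor K Z"
    have ul: "u \<cdot> l \<in> mor C L P" "q \<cdot> (u \<cdot> l) = zmor L Y"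
      using Comp_mor lm u qul Comp_assoc[OF lm u q] by auto
    obtain v where v: "v \<in> mor C L K" "k \<cdot> v = u \<cdot> l" using kernel_factor[OF k ul] .
    have hu: "h \<cdot> u \<in> mor C W Z" using Comp_mor h u by blast
    have "(h \<cdot> u) \<cdot> l = (h \<cdot> k) \<cdot> v"
      using Comp_assoc[OF lm u h(1)] Comp_assoc[OF v(1) km h(1)] v by simp
    then have "(h \<cdot> u) \<cdot> l = zmor L Z" using h v mor_target[OF h(1)] by simp
    then obtain t where t: "t \<in> mor C Y Z" "t \<cdot> (q \<cdot> u) = h \<cdot> u" using cokernel_factor[OF l hu] by blast
    have tq: "t \<cdot> q \<in> mor C P Z" using Comp_mor t q by blast
    \<comment> \<open>\<open>a\<close> covers \<open>P\<close>, and it differs from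
      \<open>u \<cdot> b\<close> by something in the kernel of \<open>q\<close>, where
      \<open>h\<close> vanishes; so \<open>h\<close> and \<open>t \<cdot> q\<close> agree after
      \<open>a\<close>.\<close>
    obtain W1 b a where 1: "b \<in> mor C W1 W" "(q \<cdot> u) \<cdot> b = q \<cdot> a" "is_cokernel C W1 P a"
      using cokernel_lift[OF c q] by blast
    have ae: "epimorphism C W1 P a" using is_cokernel_epimorphism 1 by blast
    then have a: "a \<in> mor C W1 P" by (rule epimorphism_mor)
    have ub: "u \<cdot> b \<in> mor C W1 P" using Comp_mor u 1 by blast
    have qa: "q \<cdot> a \<in> mor C W1 Y" "q \<cdot> (u \<cdot> b) = q \<cdot> a"
      using Comp_mor a q 1 Comp_assoc[OF 1(1) u q] by auto
    have "q \<cdot> mdiff W1 P a (u \<cdot> b) = zmor W1 Y"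
      using Comp_mdiff[OF a ub q] qa mdiff_eq_zmor_iff by simp
    then obtain s where s: "s \<in> mor C W1 K" "k \<cdot> s = mdiff W1 P a (u \<cdot> b)"
      using kernel_factor[OF k mdiff_mor[OF a ub]] by blast
    have "h \<cdot> mdiff W1 P a (u \<cdot> b) = zmor W1 Z"
      using Comp_assoc[OF s(1) km h(1)] s h mor_target by simp
    then have "h \<cdot> a = h \<cdot> (u \<cdot> b)"
      using Comp_mdiff[OF a ub h(1)] mdiff_eq_zmor_iff Comp_mor[OF a h(1)] Comp_mor[OF ub h(1)] by simp
    also have "\<dots> = (t \<cdot> q) \<cdot> a"
      using Comp_assoc[OF 1(1) u h(1)] t Comp_assoc[OF 1(1) Comp_mor[OF u q] t(1)] 1(2)
        Comp_assoc[OF a q t(1)] by simp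
    finally have "h = t \<cdot> q" using epimorphism_cancel[OF ae h(1) tq] by blast
    then show "\<exists>t\<in>mor C Y Z. t \<cdot> q = h" using t by blast
  qed
  then show ?thesis by (auto simp: is_cokernel_def)
qed

lemma pullback_cokernel:
  assumes P: "pullback_square C P X Y Z p q f g" and f: "is_cokernel C X Z f"
  shows "is_cokernel C P Y q"
proof -
  have g: "g \<in> mor C Y Z" and q: "q \<in> mor C P Y" using P by (auto simp: pullback_square_def)
  obtain P1 p1 q1 where 1: "p1 \<in> mor C P1 X" "f \<cdot> p1 = g \<cdot> q1" "is_cokernel C P1 Y q1"
    using cokernel_lift[OF f g] by blast
  then have "q1 \<in> mor C P1 Y" using epimorphism_mor is_cokernel_epimorphism by blast
  then obtain u where u: "u \<in> mor C P1 P" "q \<cdot> u = q1"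
    using P 1 unfolding pullback_square_def by blast
  then show ?thesis using cokernel_left_factor[of P1 Y q u P] 1 q by simp
qed

text \<open>Factor \<open>(f, -g)\<close> into an epimorphism \<open>e\<close> and a kernel
  \<open>k\<close>. If \<open>q \<cdot> w = 0\<close>, then \<open>(0, w)\<close> factors through
  \<open>k\<close>, and over a cover it lifts along \<open>e\<close> to some \<open>b\<close> into
  \<open>Z\<close>. The first component reads \<open>f \<cdot> b = 0\<close>, so
  \<open>b = 0\<close>, and then the second gives \<open>w = 0\<close>.\<close>

lemma pushout_monomorphism:
  assumes P: "pushout_square C Z X Y P f g p q" and f: "monomorphism C Z X f"
  shows "monomorphism C Y P q"
  unfolding monomorphism_iff
proof (intro conjI allI ballI impI)
  have fm: "f \<in> mor C Z X" and g: "g \<in> mor C Z Y" and p: "p \<in> mor C X P" and q: "q \<in> mor C Y P"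
    and pf: "p \<cdot> f = q \<cdot> g"
    using P by (auto simp: pushout_square_def)
  show "q \<in> mor C Y P" by fact
  fix W w assume w: "w \<in> mor C W Y" "q \<cdot> w = zmor W P"
  obtain D i j pX pY where D: "biproduct C X Y D i j pX pY"
    using ex_biproduct[OF mor_target[OF fm] mor_target[OF g]] by blast
  note d = biproduct_mor[OF D]
  have ifm: "i \<cdot> f \<in> mor C Z D" and jg: "j \<cdot> g \<in> mor C Z D" using Comp_mor d fm g by blast+
  let ?m = "mdiff Z D (i \<cdot> f) (j \<cdot> g)"
  have m: "?m \<in> mor C Z D" using mdiff_mor ifm jg by blast
  have pXm: "pX \<cdot> ?m = f"
    using Comp_mdiff[OF ifm jg d(3)] Comp_assoc[OF fm d(1,3)] Comp_assoc[OF g d(2,3)] d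
      Ident_Comp[OF fm] madd_zmor(3)[OF fm] g mor_target[OF fm] by simp
  obtain K e k where e: "epimorphism C Z K e" and "is_kernel C K D k" and mk: "?m = k \<cdot> e"
    using epi_kernel_factorisation[OF m] by blast
  then obtain R r where k: "kernel_of C D R r K k" by (auto simp: is_kernel_def)
  then have r: "r \<in> mor C D R" and km: "k \<in> mor C K D" and rk: "r \<cdot> k = zmor K R"
    by (auto simp: kernel_of_def)
  have em: "e \<in> mor C Z K" using e epimorphism_mor by blast
  have "r \<cdot> ?m = zmor Z R" using mk Comp_assoc[OF em km r] rk em mor_target[OF r] by simp
  \<comment> \<open>As \<open>r\<close> kills \<open>(f, -g)\<close>, its two components form a
    cocone of \<open>f\<close> and \<open>g\<close>. The induced \<open>u\<close> on
    \<open>P\<close> turns \<open>q \<cdot> w = 0\<close> into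
    \<open>r \<cdot> (j \<cdot> w) = 0\<close>.\<close>
  then have "r \<cdot> (i \<cdot> f) = r \<cdot> (j \<cdot> g)"
    using Comp_mdiff[OF ifm jg r] mdiff_eq_zmor_iff Comp_mor ifm jg r by metis
  then have "(r \<cdot> i) \<cdot> f = (r \<cdot> j) \<cdot> g"
    using Comp_assoc[OF fm d(1) r] Comp_assoc[OF g d(2) r] by simp
  moreover have "r \<cdot> i \<in> mor C X R" "r \<cdot> j \<in> mor C Y R" using Comp_mor d r by blast+
  ultimately obtain u where u: "u \<in> mor C P R" "u \<cdot> q = r \<cdot> j"
    using P unfolding pushout_square_def by blast
  have jw: "j \<cdot> w \<in> mor C W D" using Comp_mor w d by blast
  have "r \<cdot> (j \<cdot> w) = u \<cdot> (q \<cdot> w)"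
    using Comp_assoc[OF w(1) d(2) r] Comp_assoc[OF w(1) q u(1)] u by simp
  then have "r \<cdot> (j \<cdot> w) = zmor W R" using w u mor_source by simp
  then obtain l where l: "l \<in> mor C W K" "k \<cdot> l = j \<cdot> w" using kernel_factor[OF k jw] by blast
  obtain V b a where b: "b \<in> mor C V Z" "e \<cdot> b = l \<cdot> a" and a: "epimorphism C V W a"
    using epi_lift[OF e l(1)] by blast
  have am: "a \<in> mor C V W" using a epimorphism_mor by blast
  have wa: "w \<cdot> a \<in> mor C V Y" using Comp_mor w am by blast
  have V: "V \<in> Obj C" using am mor_source by blast
  have mb: "?m \<cdot> b = j \<cdot> (w \<cdot> a)"
    using mk Comp_assoc[OF b(1) em km] b(2) Comp_assoc[OF am l(1) km] l(2)
      Comp_assoc[OF am w(1) d(2)] by simp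
  have "f \<cdot> b = pX \<cdot> (j \<cdot> (w \<cdot> a))" using pXm mb Comp_assoc[OF b(1) m d(3)] by simp
  also have "\<dots> = zmor V X" using Comp_assoc[OF wa d(2,3)] d wa mor_target[OF fm] by simp
  finally have "b = zmor V Z" using f b unfolding monomorphism_iff by blast
  then have "j \<cdot> (w \<cdot> a) = zmor V D" using mb m V by simp
  then have "pY \<cdot> (j \<cdot> (w \<cdot> a)) = zmor V Y" using d V by simp
  then have "w \<cdot> a = zmor V Y" using Comp_assoc[OF wa d(2,4)] d Ident_Comp[OF wa] by simp
  then show "w = zmor W Y" using a w unfolding epimorphism_iff by blast
qed

text \<open>A pushout is the cokernel of \<open>(f, -g)\<close>; this makes cokernel lifting
  available for \<open>c\<close>.\<close>

lemma pushout_cokernel: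
  assumes P: "pushout_square C Z X Y P f g p q" and D: "biproduct C X Y D i j pX pY"
    and c: "c \<in> mor C D P" "c \<cdot> i = p" "c \<cdot> j = q"
  shows "is_cokernel C D P c"
proof -
  have f: "f \<in> mor C Z X" and g: "g \<in> mor C Z Y" and p: "p \<in> mor C X P" and q: "q \<in> mor C Y P"
    and pf: "p \<cdot> f = q \<cdot> g"
    using P by (auto simp: pushout_square_def)
  note d = biproduct_mor[OF D]
  have ifm: "i \<cdot> f \<in> mor C Z D" and jg: "j \<cdot> g \<in> mor C Z D" using Comp_mor d f g by blast+
  let ?m = "mdiff Z D (i \<cdot> f) (j \<cdot> g)"
  have m: "?m \<in> mor C Z D" using mdiff_mor ifm jg by blast
  have *: "h \<cdot> ?m = zmor Z R \<longleftrightarrow> (h \<cdot> i) \<cdot> f = (h \<cdot> j) \<cdot> g" if h: "h \<in> mor C D R" for h R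
    using Comp_mdiff[OF ifm jg h] mdiff_eq_zmor_iff[OF Comp_mor[OF ifm h] Comp_mor[OF jg h]]
      Comp_assoc[OF f d(1) h] Comp_assoc[OF g d(2) h] by simp
  have "epimorphism C D P c"
    unfolding epimorphism_def
  proof (intro conjI allI ballI impI)
    fix R u v assume u: "u \<in> mor C P R" "v \<in> mor C P R" "u \<cdot> c = v \<cdot> c"
    then have e: "u \<cdot> p = v \<cdot> p" "u \<cdot> q = v \<cdot> q" using Comp_assoc d(1,2) c by metis+
    have "(u \<cdot> p) \<cdot> f = (u \<cdot> q) \<cdot> g" using Comp_assoc[OF f p u(1)] Comp_assoc[OF g q u(1)] pf by simp
    moreover have "u \<cdot> p \<in> mor C X R" "u \<cdot> q \<in> mor C Y R" using Comp_mor p q u by blast+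
    ultimately have "\<exists>!w. w \<in> mor C P R \<and> w \<cdot> p = u \<cdot> p \<and> w \<cdot> q = u \<cdot> q"
      using P by (auto simp: pushout_square_def)
    then show "u = v" using u e by metis
  qed fact
  then have "cokernel_of C Z D ?m P c"
  proof (rule cokernelI[OF m])
    show "c \<cdot> ?m = zmor Z P" using * c pf by blast
    fix R h assume h: "h \<in> mor C D R" "h \<cdot> ?m = zmor Z R"
    then have "(h \<cdot> i) \<cdot> f = (h \<cdot> j) \<cdot> g" "h \<cdot> i \<in> mor C X R" "h \<cdot> j \<in> mor C Y R"
      using * Comp_mor[OF d(1) h(1)] Comp_mor[OF d(2) h(1)] by simp_all
    then obtain u where u: "u \<in> mor C P R" "u \<cdot> p = h \<cdot> i" "u \<cdot> q = h \<cdot> j"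
      using P unfolding pushout_square_def by blast
    have "u \<cdot> c = h"
      by (rule biproduct_eq_from[OF D])
        (use Comp_mor[OF c(1) u(1)] h Comp_assoc[OF d(1) c(1) u(1)] Comp_assoc[OF d(2) c(1) u(1)] c u in auto)
    then show "\<exists>u\<in>mor C P R. u \<cdot> c = h" using u by blast
  qed
  then show ?thesis by (auto simp: is_cokernel_def)
qed

text \<open>If \<open>f\<close> is the kernel of \<open>r\<close>, extending \<open>r\<close> by
  zero on \<open>Y\<close> yields an \<open>r'\<close> whose kernel is \<open>q\<close>: over a
  cover \<open>a\<close>, a morphism \<open>w\<close> killed by \<open>r'\<close> becomes
  \<open>q \<cdot> ?y\<close>, and \<open>?y\<close> descends along \<open>a\<close> since
  \<open>q\<close> is monic.\<close>

lemma pushout_kernel: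
  assumes P: "pushout_square C Z X Y P f g p q" and f: "is_kernel C Z X f"
  shows "is_kernel C Y P q"
proof -
  obtain R r where r: "kernel_of C X R r Z f" using f by (auto simp: is_kernel_def)
  have fm: "f \<in> mor C Z X" and g: "g \<in> mor C Z Y" and p: "p \<in> mor C X P" and q: "q \<in> mor C Y P"
    and pf: "p \<cdot> f = q \<cdot> g"
    using P by (auto simp: pushout_square_def)
  have rm: "r \<in> mor C X R" and rf: "r \<cdot> f = zmor Z R" using r by (auto simp: kernel_of_def)
  have "r \<cdot> f = zmor Y R \<cdot> g" "zmor Y R \<in> mor C Y R"
    using rf g rm mor_target by auto
  then obtain r' where r': "r' \<in> mor C P R" "r' \<cdot> p = r" "r' \<cdot> q = zmor Y R"
    using P rm unfolding pushout_square_def by blast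
  have "kernel_of C P R r' Y q"
  proof (rule kernelI[OF r'(1) pushout_monomorphism[OF P kernel_monomorphism[OF r]] r'(3)])
    fix W w assume w: "w \<in> mor C W P" "r' \<cdot> w = zmor W R"
    obtain D i j pX pY where D: "biproduct C X Y D i j pX pY"
      using ex_biproduct[OF mor_target[OF fm] mor_target[OF g]] by blast
    note d = biproduct_mor[OF D]
    obtain c where c: "c \<in> mor C D P" "c \<cdot> i = p" "c \<cdot> j = q" using biproduct_copair[OF D p q] .
    \<comment> \<open>The cover must be a cokernel, not only an epimorphism, for \<open>?y\<close>
      to descend to \<open>W\<close>.\<close>
    obtain V b a where b: "b \<in> mor C V D" "c \<cdot> b = w \<cdot> a" and a: "is_cokernel C V W a"
      using cokernel_lift[OF pushout_cokernel[OF P D c] w(1)] by blast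
    have ae: "epimorphism C V W a" using a is_cokernel_epimorphism by blast
    then have am: "a \<in> mor C V W" by (rule epimorphism_mor)
    have pb: "pX \<cdot> b \<in> mor C V X" "pY \<cdot> b \<in> mor C V Y" using Comp_mor d b by blast+
    have cb: "c \<cdot> b = madd V P (p \<cdot> (pX \<cdot> b)) (q \<cdot> (pY \<cdot> b))"
      using biproduct_decompose[OF D c(1) b(1)] c by simp
    have "r' \<cdot> (c \<cdot> b) = madd V R (r \<cdot> (pX \<cdot> b)) (zmor V R)"
      using Comp_add_right[OF Comp_mor[OF pb(1) p] Comp_mor[OF pb(2) q] r'(1)] cb
        Comp_assoc[OF pb(1) p r'(1)] Comp_assoc[OF pb(2) q r'(1)] r' pb mor_target[OF rm] by simp
    also have "\<dots> = r \<cdot> (pX \<cdot> b)" using madd_zmor Comp_mor[OF pb(1) rm] by blast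
    finally have "r \<cdot> (pX \<cdot> b) = zmor V R"
      using b(2) Comp_assoc[OF am w(1) r'(1)] w am mor_target[OF rm] by simp
    then obtain s where s: "s \<in> mor C V Z" "f \<cdot> s = pX \<cdot> b" using kernel_factor[OF r pb(1)] by blast
    \<comment> \<open>The \<open>X\<close>-component of \<open>b\<close> equals
      \<open>f \<cdot> s\<close>; as \<open>p \<cdot> f = q \<cdot> g\<close>, it can be moved into
      \<open>Y\<close> as \<open>g \<cdot> s\<close>.\<close>
    let ?y = "madd V Y (g \<cdot> s) (pY \<cdot> b)"
    have gs: "g \<cdot> s \<in> mor C V Y" using Comp_mor g s by blast
    have y: "?y \<in> mor C V Y" using madd_mor gs pb by blast
    have "q \<cdot> ?y = madd V P (q \<cdot> (g \<cdot> s)) (q \<cdot> (pY \<cdot> b))" using Comp_add_right[OF gs pb(2) q] .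
    also have "q \<cdot> (g \<cdot> s) = p \<cdot> (pX \<cdot> b)"
      using Comp_assoc[OF s(1) g q] Comp_assoc[OF s(1) fm p] pf s by simp
    finally have qy: "q \<cdot> ?y = w \<cdot> a" using cb b by simp
    obtain N n where n: "cokernel_of C N V n W a" using a by (auto simp: is_cokernel_def)
    then have nm: "n \<in> mor C N V" "a \<cdot> n = zmor N W" by (auto simp: cokernel_of_def)
    have "q \<cdot> (?y \<cdot> n) = w \<cdot> (a \<cdot> n)"
      using Comp_assoc[OF nm(1) y q] Comp_assoc[OF nm(1) am w(1)] qy by simp
    then have "q \<cdot> (?y \<cdot> n) = zmor N P" using nm w mor_source by simp
    moreover have "monomorphism C Y P q" using pushout_monomorphism[OF P kernel_monomorphism[OF r]] .
    ultimately have "?y \<cdot> n = zmor N Y" using Comp_mor[OF nm(1) y] unfolding monomorphism_iff by blast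
    then obtain v where v: "v \<in> mor C W Y" "v \<cdot> a = ?y" using cokernel_factor[OF n y] by blast
    have "(q \<cdot> v) \<cdot> a = w \<cdot> a" using Comp_assoc[OF am v(1) q] v qy by simp
    then have "q \<cdot> v = w" using epimorphism_cancel[OF ae Comp_mor[OF v(1) q] w(1)] by blast
    then show "\<exists>v\<in>mor C W Y. q \<cdot> v = w" using v by blast
  qed
  then show ?thesis by (auto simp: is_kernel_def)
qed

sublocale integral_category C
  by unfold_locales (fact pullback_epimorphism, fact pushout_monomorphism)

sublocale quasi_abelian_category C
  by unfold_locales (fact pullback_cokernel, fact pushout_kernel)

end

section \<open>Opposite categories\<close>

text \<open>Reverses the category structure alone, which is all that the heart carries;
  \<open>op_extri\<close> reverses the extension data as well.\<close>

definition op_cat :: "('o, 'm, 'x) preadd_cat_scheme \<Rightarrow> ('o, 'm, 'x) preadd_cat_scheme" where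
  "op_cat C = C\<lparr>Hom := \<lambda>X Y. Hom C Y X, Comp := \<lambda>g f. Comp C f g\<rparr>"

lemma op_cat_simps [simp]:
  "Obj (op_cat C) = Obj C" "Hom (op_cat C) X Y = Hom C Y X"
  "Ident (op_cat C) = Ident C" "Comp (op_cat C) g f = Comp C f g"
  by (simp_all add: op_cat_def)

lemma op_cat_op_cat [simp]: "op_cat (op_cat C) = C"
  by (simp add: op_cat_def)

lemma mor_op_cat [simp]: "mor (op_cat C) X Y = mor C Y X"
  by (auto simp: mor_def)

lemma preadditive_op_cat:
  assumes "preadditive_category C" shows "preadditive_category (op_cat C)"
proof -
  interpret preadditive_category C by fact
  show ?thesis
    by (rule preadditive_category.intro)
      (auto simp: Ident_mor Comp_mor Comp_Ident Ident_Comp Comp_assoc Hom_comm_group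
        Comp_add_left Comp_add_right dest: Hom_disjoint)
qed

lemma zero_object_op_cat [simp]: "zero_object (op_cat C) Z = zero_object C Z"
  by (auto simp: zero_object_def)

lemma biproduct_op_cat:
  assumes "preadditive_category C"
  shows "biproduct (op_cat C) X Y P i j p q = biproduct C X Y P p q i j"
  unfolding biproduct_def by auto

lemma epimorphism_op_cat [simp]: "epimorphism (op_cat C) X Y f = monomorphism C Y X f"
  and monomorphism_op_cat [simp]: "monomorphism (op_cat C) X Y f = epimorphism C Y X f"
  unfolding epimorphism_def monomorphism_def by auto

lemma kernel_of_op_cat [simp]: "kernel_of (op_cat C) X Y f K k = cokernel_of C Y X f K k"
  and cokernel_of_op_cat [simp]: "cokernel_of (op_cat C) X Y f K k = kernel_of C Y X f K k"
  unfolding kernel_of_def cokernel_of_def by auto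

lemma is_kernel_op_cat [simp]: "is_kernel (op_cat C) X Y f = is_cokernel C Y X f"
  and is_cokernel_op_cat [simp]: "is_cokernel (op_cat C) X Y f = is_kernel C Y X f"
  unfolding is_kernel_def is_cokernel_def by auto

lemma pullback_square_op_cat [simp]:
    "pullback_square (op_cat C) P X Y Z p q f g = pushout_square C Z X Y P f g p q"
  and pushout_square_op_cat [simp]:
    "pushout_square (op_cat C) Z X Y P f g p q = pullback_square C P X Y Z p q f g"
  unfolding pullback_square_def pushout_square_def by auto

lemma additive_op_cat:
  assumes "additive_category C" shows "additive_category (op_cat C)"
proof -
  interpret additive_category C by fact
  interpret op: preadditive_category "op_cat C" by (rule preadditive_op_cat) unfold_locales
  show ?thesis
    by unfold_locales
      (use ex_zero_object ex_biproduct in \<open>auto simp: biproduct_op_cat[OF preadditive_category_axioms], blast\<close>)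
qed

lemma preabelian_op_cat:
  assumes "preabelian_category C" shows "preabelian_category (op_cat C)"
proof -
  interpret preabelian_category C by fact
  interpret op: additive_category "op_cat C" by (rule additive_op_cat) unfold_locales
  show ?thesis by unfold_locales (simp_all add: ex_kernel ex_cokernel)
qed

lemma integral_op_cat:
  assumes "integral_category C" shows "integral_category (op_cat C)"
proof -
  interpret integral_category C by fact
  interpret op: preabelian_category "op_cat C" by (rule preabelian_op_cat) unfold_locales
  show ?thesis by unfold_locales (auto intro: epi_stable mono_stable)
qed

lemma quasi_abelian_op_cat:
  assumes "quasi_abelian_category C" shows "quasi_abelian_category (op_cat C)"
proof -
  interpret quasi_abelian_category C by fact
  interpret op: preabelian_category "op_cat C" by (rule preabelian_op_cat) unfold_locales
  show ?thesis by unfold_locales (auto intro: cokernel_stable kernel_stable)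
qed

text \<open>A sequence is a pair of morphisms, so reversal exchanges its entries: hence the image
  under \<open>prod.swap\<close>.\<close>

definition op_extri :: "('o, 'm, 'e, 'x) extri_cat_scheme \<Rightarrow> ('o, 'm, 'e, 'x) extri_cat_scheme" where
  "op_extri B = (op_cat B)\<lparr>Ext := \<lambda>C A. Ext B A C, ExtMap := \<lambda>g f. ExtMap B f g,
    RealClass := \<lambda>C A \<delta>. prod.swap ` RealClass B A C \<delta>\<rparr>"

lemma op_extri_simps [simp]:
  "Obj (op_extri B) = Obj B" "Hom (op_extri B) X Y = Hom B Y X"
  "Ident (op_extri B) = Ident B" "Comp (op_extri B) g f = Comp B f g"
  "Ext (op_extri B) C A = Ext B A C" "ExtMap (op_extri B) g f = ExtMap B f g"
  "RealClass (op_extri B) C A \<delta> = prod.swap ` RealClass B A C \<delta>"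
  by (simp_all add: op_extri_def op_cat_def)

lemma mor_op_extri [simp]: "mor (op_extri B) X Y = mor B Y X"
  by (auto simp: mor_def)

lemma push_op_extri [simp]: "push (op_extri B) C f \<delta> = pull B C f \<delta>"
  and pull_op_extri [simp]: "pull (op_extri B) C f \<delta> = push B C f \<delta>"
  by (simp_all add: push_def pull_def)

lemma zero_object_op_extri [simp]: "zero_object (op_extri B) Z = zero_object B Z"
  by (auto simp: zero_object_def)

lemma biproduct_op_extri [simp]:
  "biproduct (op_extri B) X Y P i j p q = biproduct B X Y P p q i j"
  unfolding biproduct_def by auto

lemma iso_mor_op_extri [simp]: "iso_mor (op_extri B) X Y f = iso_mor B Y X f"
  unfolding iso_mor_def by auto

lemma additive_op_extri:
  assumes "additive_category B" shows "additive_category (op_extri B)"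
proof -
  interpret additive_category B by fact
  interpret op: preadditive_category "op_extri B"
    by (rule preadditive_category.intro)
      (auto simp: Ident_mor Comp_mor Comp_Ident Ident_Comp Comp_assoc Hom_comm_group
        Comp_add_left Comp_add_right dest: Hom_disjoint)
  show ?thesis
    by unfold_locales (use ex_zero_object ex_biproduct in \<open>auto, blast\<close>)
qed

context preadditive_category
begin

lemma biproduct_swap:
  assumes "biproduct C X Y P i j p q" shows "biproduct C Y X P j i q p"
proof -
  note d = biproduct_mor[OF assms]
  have P: "P \<in> Obj C" using d mor_target by blast
  interpret comm_group "Hom C P P" using Hom_comm_group P by blast
  have "i \<cdot> p \<in> mor C P P" "j \<cdot> q \<in> mor C P P" using Comp_mor d by blast+
  then have "madd P P (j \<cdot> q) (i \<cdot> p) = madd P P (i \<cdot> p) (j \<cdot> q)" using m_comm mor_carrier by blast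
  then show ?thesis using d by (simp add: biproduct_def)
qed

lemma iso_mor_Ident: "X \<in> Obj C \<Longrightarrow> iso_mor C X X (Ident C X)"
  using Ident_mor Ident_Comp unfolding iso_mor_def by blast

lemma seq_equiv_refl: "(a, b) \<in> sequences C A D \<Longrightarrow> ((a, b), (a, b)) \<in> seq_equiv C A D"
proof -
  assume "(a, b) \<in> sequences C A D"
  then obtain M where m: "a \<in> mor C A M" "b \<in> mor C M D" by (auto simp: sequences_def)
  then show ?thesis
    using iso_mor_Ident[OF mor_target[OF m(1)]] Ident_Comp[OF m(1)] Comp_Ident[OF m(2)]
    unfolding seq_equiv_def by blast
qed

lemma seq_equiv_sym:
  assumes "((a, b), (a', b')) \<in> seq_equiv C A D" shows "((a', b'), (a, b)) \<in> seq_equiv C A D"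
proof -
  obtain M M' g where *: "a \<in> mor C A M" "b \<in> mor C M D" "a' \<in> mor C A M'" "b' \<in> mor C M' D"
    "iso_mor C M M' g" "g \<cdot> a = a'" "b' \<cdot> g = b"
    using assms by (auto simp: seq_equiv_def)
  then obtain h where g: "g \<in> mor C M M'" and h: "h \<in> mor C M' M" "h \<cdot> g = Ident C M" "g \<cdot> h = Ident C M'"
    by (auto simp: iso_mor_def)
  have "h \<cdot> a' = a" "b \<cdot> h = b'"
    using Comp_assoc[OF *(1) g h(1)] Comp_assoc[OF h(1) g *(4)] * h Ident_Comp Comp_Ident by auto
  moreover have "iso_mor C M' M h" using g h by (auto simp: iso_mor_def)
  ultimately show ?thesis using * unfolding seq_equiv_def by blast
qed

end

text \<open>In the opposite category the isomorphism of the middle terms points backwards, which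
  exchanges the two sequences; symmetry of the relation restores their order.\<close>

lemma seq_equiv_op_extri:
  assumes "preadditive_category B"
  shows "((a, b), (a', b')) \<in> seq_equiv (op_extri B) A C \<longleftrightarrow> ((b, a), (b', a')) \<in> seq_equiv B C A"
proof -
  interpret preadditive_category B by fact
  have "((a, b), (a', b')) \<in> seq_equiv (op_extri B) A C \<longleftrightarrow> ((b', a'), (b, a)) \<in> seq_equiv B C A"
    unfolding seq_equiv_def by auto
  then show ?thesis using seq_equiv_sym by metis
qed

lemma seq_class_op_extri:
  assumes "preadditive_category B"
  shows "seq_equiv (op_extri B) A C `` {(a, b)} = prod.swap ` (seq_equiv B C A `` {(b, a)})"
  using seq_equiv_op_extri[OF assms] by force

lemma realised_op_extri:
  assumes "preadditive_category B"
  shows "realised (op_extri B) \<delta> A M C a b = realised B \<delta> C M A b a"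
  unfolding realised_def seq_class_op_extri[OF assms]
  by (auto simp: inj_image_eq_iff)

section \<open>Formal consequences of biadditivity\<close>

context biadditive_extension
begin

abbreviation ezero where
  "ezero C A \<equiv> \<one>\<^bsub>Ext B C A\<^esub>"

lemma Ext_group: "C \<in> Obj B \<Longrightarrow> A \<in> Obj B \<Longrightarrow> group (Ext B C A)"
  using Ext_comm_group comm_group.axioms(2) by blast

lemma ezero_closed: "C \<in> Obj B \<Longrightarrow> A \<in> Obj B \<Longrightarrow> ezero C A \<in> carrier (Ext B C A)"
  using Ext_group group.is_monoid monoid.one_closed by blast

lemma push_hom: "C \<in> Obj B \<Longrightarrow> f \<in> mor B A A' \<Longrightarrow> push B C f \<in> hom (Ext B C A) (Ext B C A')"
  using ExtMap_hom[OF Ident_mor] by (simp add: push_def[abs_def])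

lemma pull_hom: "A \<in> Obj B \<Longrightarrow> g \<in> mor B C' C \<Longrightarrow> pull B A g \<in> hom (Ext B C A) (Ext B C' A)"
  using ExtMap_hom[OF _ Ident_mor] by (simp add: pull_def[abs_def])

lemma push_closed:
  "f \<in> mor B A A' \<Longrightarrow> \<delta> \<in> carrier (Ext B C A) \<Longrightarrow> C \<in> Obj B \<Longrightarrow> push B C f \<delta> \<in> carrier (Ext B C A')"
  by (rule hom_in_carrier[OF push_hom])

lemma pull_closed:
  "g \<in> mor B C' C \<Longrightarrow> \<delta> \<in> carrier (Ext B C A) \<Longrightarrow> A \<in> Obj B \<Longrightarrow> pull B A g \<delta> \<in> carrier (Ext B C' A)"
  by (rule hom_in_carrier[OF pull_hom])

lemma push_ezero: "f \<in> mor B A A' \<Longrightarrow> C \<in> Obj B \<Longrightarrow> push B C f (ezero C A) = ezero C A'"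
  by (rule hom_one[OF push_hom]) (auto intro: Ext_group dest: mor_source mor_target)

lemma pull_ezero: "g \<in> mor B C' C \<Longrightarrow> A \<in> Obj B \<Longrightarrow> pull B A g (ezero C A) = ezero C' A"
  by (rule hom_one[OF pull_hom]) (auto intro: Ext_group dest: mor_source mor_target)

lemma push_Ident: "C \<in> Obj B \<Longrightarrow> A \<in> Obj B \<Longrightarrow> \<delta> \<in> carrier (Ext B C A) \<Longrightarrow> push B C (Ident B A) \<delta> = \<delta>"
  and pull_Ident: "C \<in> Obj B \<Longrightarrow> A \<in> Obj B \<Longrightarrow> \<delta> \<in> carrier (Ext B C A) \<Longrightarrow> pull B A (Ident B C) \<delta> = \<delta>"
  using ExtMap_Ident by (simp_all add: push_def pull_def)

lemma push_Comp:
  assumes "f \<in> mor B A A'" "f' \<in> mor B A' A''" "\<delta> \<in> carrier (Ext B C A)" "C \<in> Obj B"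
  shows "push B C (f' \<cdot> f) \<delta> = push B C f' (push B C f \<delta>)"
  using ExtMap_Comp[OF Ident_mor Ident_mor assms(1-3)] assms(4) Ident_Comp[OF Ident_mor]
  by (simp add: push_def)

lemma pull_Comp:
  assumes "g \<in> mor B C' C" "g' \<in> mor B C'' C'" "\<delta> \<in> carrier (Ext B C A)" "A \<in> Obj B"
  shows "pull B A (g \<cdot> g') \<delta> = pull B A g' (pull B A g \<delta>)"
  using ExtMap_Comp[OF assms(1,2) Ident_mor Ident_mor assms(3)] assms(4) Ident_Comp[OF Ident_mor]
  by (simp add: pull_def)

lemma push_pull:
  assumes "f \<in> mor B A A'" "g \<in> mor B C' C" "\<delta> \<in> carrier (Ext B C A)"
  shows "push B C' f (pull B A g \<delta>) = pull B A' g (push B C f \<delta>)"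
  using ExtMap_Comp[OF assms(2) Ident_mor Ident_mor assms(1,3)]
    ExtMap_Comp[OF Ident_mor assms(2,1) Ident_mor assms(3)] assms mor_source mor_target
    Comp_Ident[OF assms(2)] Ident_Comp[OF assms(2)] Comp_Ident[OF assms(1)] Ident_Comp[OF assms(1)]
  unfolding push_def pull_def by metis

lemma push_zmor:
  assumes d: "\<delta> \<in> carrier (Ext B C A)" and "A \<in> Obj B" "A' \<in> Obj B" and C: "C \<in> Obj B"
  shows "push B C (zmor A A') \<delta> = ezero C A'"
proof -
  have z: "zmor A A' \<in> mor B A A'" using assms by blast
  interpret group "Ext B C A'" using Ext_group assms by blast
  have c: "push B C (zmor A A') \<delta> \<in> carrier (Ext B C A')" using push_closed z d C by blast
  have "push B C (zmor A A') \<delta> \<otimes>\<^bsub>Ext B C A'\<^esub> push B C (zmor A A') \<delta> = push B C (zmor A A') \<delta>"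
    using push_add[OF C z z d] madd_zmor(1)[OF z] by simp
  then show ?thesis using l_cancel_one[OF c c] by simp
qed

lemma pull_zmor:
  assumes d: "\<delta> \<in> carrier (Ext B C A)" and "C \<in> Obj B" "C' \<in> Obj B" and A: "A \<in> Obj B"
  shows "pull B A (zmor C' C) \<delta> = ezero C' A"
proof -
  have z: "zmor C' C \<in> mor B C' C" using assms by blast
  interpret group "Ext B C' A" using Ext_group assms by blast
  have c: "pull B A (zmor C' C) \<delta> \<in> carrier (Ext B C' A)" using pull_closed z d A by blast
  have "pull B A (zmor C' C) \<delta> \<otimes>\<^bsub>Ext B C' A\<^esub> pull B A (zmor C' C) \<delta> = pull B A (zmor C' C) \<delta>"
    using pull_add[OF A z z d] madd_zmor(1)[OF z] by simp
  then show ?thesis using l_cancel_one[OF c c] by simp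
qed

lemma push_kernel_injective:
  assumes f: "f \<in> mor B A A'" and C: "C \<in> Obj B"
    and inj: "\<And>\<delta>. \<delta> \<in> carrier (Ext B C A) \<Longrightarrow> push B C f \<delta> = ezero C A' \<Longrightarrow> \<delta> = ezero C A"
    and d: "\<delta> \<in> carrier (Ext B C A)" "\<epsilon> \<in> carrier (Ext B C A)" "push B C f \<delta> = push B C f \<epsilon>"
  shows "\<delta> = \<epsilon>"
proof -
  interpret group_hom "Ext B C A" "Ext B C A'" "push B C f"
    using Ext_group push_hom[OF C f] C mor_source[OF f] mor_target[OF f]
    by (auto intro!: group_hom.intro group_hom_axioms.intro)
  have "inj_on (push B C f) (carrier (Ext B C A))"
    using inj_iff_trivial_ker inj by (auto simp: kernel_def)
  then show ?thesis using d by (auto dest: inj_onD)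
qed

lemma biadditive_op_extri: "biadditive_extension (op_extri B)"
proof -
  interpret op: additive_category "op_extri B" by (rule additive_op_extri) unfold_locales
  show ?thesis
    by (intro biadditive_extension.intro biadditive_extension_axioms.intro op.additive_category_axioms)
      (use Ext_comm_group ExtMap_hom ExtMap_Ident ExtMap_Comp push_add pull_add in \<open>simp_all\<close>)
qed

end

context extriangulated_category
begin

lemma realised_mor:
  assumes "realised B \<delta> A M C a b"
  shows "\<delta> \<in> carrier (Ext B C A)" "a \<in> mor B A M" "b \<in> mor B M C" "A \<in> Obj B" "M \<in> Obj B" "C \<in> Obj B"
  using assms mor_source mor_target by (auto simp: realised_def)

lemma ex_realised:
  assumes "C \<in> Obj B" "A \<in> Obj B" "\<delta> \<in> carrier (Ext B C A)"
  obtains M a b where "realised B \<delta> A M C a b"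
proof -
  obtain a b where "(a, b) \<in> sequences B A C" "RealClass B C A \<delta> = seq_equiv B A C `` {(a, b)}"
    using RealClass_quotient[OF assms] by (auto elim!: quotientE)
  then show ?thesis using that assms by (auto simp: sequences_def realised_def)
qed

lemma realised_unique:
  assumes "realised B \<delta> A M C a b" "realised B \<delta> A M' C a' b'"
  obtains g where "iso_mor B M M' g" "g \<cdot> a = a'" "b' \<cdot> g = b"
proof -
  have "((a', b'), (a', b')) \<in> seq_equiv B A C"
    by (rule seq_equiv_refl) (use assms in \<open>auto simp: realised_def sequences_def\<close>)
  then have "((a, b), (a', b')) \<in> seq_equiv B A C" using assms by (auto simp: realised_def)
  then obtain N N' g where *: "a \<in> mor B A N" "a' \<in> mor B A N'" "iso_mor B N N' g" "g \<cdot> a = a'" "b' \<cdot> g = b"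
    unfolding seq_equiv_def by blast
  then have "N = M" "N' = M'"
    using Hom_disjoint realised_mor(2)[OF assms(1)] realised_mor(2)[OF assms(2)] by blast+
  then show ?thesis using that * by blast
qed

text \<open>The axioms are self-dual: (ET3) and (ET4) trade places with their duals, and
  \<open>realisation\<close> becomes itself with \<open>f\<close> and \<open>h\<close> interchanged.
  Sums need \<open>push_pull\<close> and associativity, since reversal changes the order of pushing
  and pulling and the bracketing of composites. Thanks to this, the exactness statements below need
  a proof in one variance only.\<close>

lemma extriangulated_op_extri: "extriangulated_category (op_extri B)"
proof -
  interpret op: biadditive_extension "op_extri B" by (rule biadditive_op_extri)
  note r = realised_op_extri[OF preadditive_category_axioms]
  show ?thesis
  proof unfold_locales
    fix C A \<delta> assume "C \<in> Obj (op_extri B)" "A \<in> Obj (op_extri B)" "\<delta> \<in> carrier (Ext (op_extri B) C A)"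
    then obtain M b a where "realised B \<delta> C M A b a" using ex_realised[of A C \<delta>] by auto
    then have *: "realised (op_extri B) \<delta> A M C a b" using r by simp
    then have "(a, b) \<in> sequences (op_extri B) A C" by (auto simp: realised_def sequences_def)
    then show "RealClass (op_extri B) C A \<delta> \<in> sequences (op_extri B) A C // seq_equiv (op_extri B) A C"
      using * unfolding realised_def by (metis quotientI)
  next
    fix \<delta> A M C a b \<delta>' A' M' C' a' b' f h
    assume "realised (op_extri B) \<delta> A M C a b" "realised (op_extri B) \<delta>' A' M' C' a' b'"
      "f \<in> mor (op_extri B) A A'" "h \<in> mor (op_extri B) C C'"
      "push (op_extri B) C f \<delta> = pull (op_extri B) A' h \<delta>'"
    then show "\<exists>g\<in>mor (op_extri B) M M'.
      g \<cdot>\<^bsub>op_extri B\<^esub> a = a' \<cdot>\<^bsub>op_extri B\<^esub> f \<and> b' \<cdot>\<^bsub>op_extri B\<^esub> g = h \<cdot>\<^bsub>op_extri B\<^esub> b"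
      using realisation[of \<delta>' C' M' A' b' a' \<delta> C M A b a h f] unfolding r by auto
  next
    fix A C P i\<^sub>A i\<^sub>C p\<^sub>A p\<^sub>C assume "biproduct (op_extri B) A C P i\<^sub>A i\<^sub>C p\<^sub>A p\<^sub>C"
    then have b: "biproduct B A C P p\<^sub>A p\<^sub>C i\<^sub>A i\<^sub>C" by simp
    have "biproduct B C A P p\<^sub>C p\<^sub>A i\<^sub>C i\<^sub>A" using biproduct_swap[OF b] .
    then show "realised (op_extri B) \<one>\<^bsub>Ext (op_extri B) C A\<^esub> A P C i\<^sub>A p\<^sub>C"
      using realisation_split r by simp
  next
    fix \<delta> A M C a b \<delta>' A' M' C' a' b' SA i\<^sub>A i\<^sub>A' p\<^sub>A p\<^sub>A' SM i\<^sub>M i\<^sub>M' p\<^sub>M p\<^sub>M' SC i\<^sub>C i\<^sub>C' p\<^sub>C p\<^sub>C'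
    assume "realised (op_extri B) \<delta> A M C a b" "realised (op_extri B) \<delta>' A' M' C' a' b'"
      "biproduct (op_extri B) A A' SA i\<^sub>A i\<^sub>A' p\<^sub>A p\<^sub>A'" "biproduct (op_extri B) M M' SM i\<^sub>M i\<^sub>M' p\<^sub>M p\<^sub>M'"
      "biproduct (op_extri B) C C' SC i\<^sub>C i\<^sub>C' p\<^sub>C p\<^sub>C'"
    then have 1: "realised B \<delta> C M A b a" "realised B \<delta>' C' M' A' b' a'"
      and 2: "biproduct B A A' SA p\<^sub>A p\<^sub>A' i\<^sub>A i\<^sub>A'" "biproduct B M M' SM p\<^sub>M p\<^sub>M' i\<^sub>M i\<^sub>M'"
      "biproduct B C C' SC p\<^sub>C p\<^sub>C' i\<^sub>C i\<^sub>C'" unfolding r by simp_all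
    note A = biproduct_mor[OF 2(1)] and M = biproduct_mor[OF 2(2)] and C = biproduct_mor[OF 2(3)]
      and x = realised_mor[OF 1(1)] and y = realised_mor[OF 1(2)]
    show "realised (op_extri B)
         (push (op_extri B) SC i\<^sub>A (pull (op_extri B) A p\<^sub>C \<delta>) \<otimes>\<^bsub>Ext (op_extri B) SC SA\<^esub>
           push (op_extri B) SC i\<^sub>A' (pull (op_extri B) A' p\<^sub>C' \<delta>'))
         SA SM SC
         ((i\<^sub>M \<cdot>\<^bsub>op_extri B\<^esub> a \<cdot>\<^bsub>op_extri B\<^esub> p\<^sub>A) \<otimes>\<^bsub>Hom (op_extri B) SA SM\<^esub> (i\<^sub>M' \<cdot>\<^bsub>op_extri B\<^esub> a' \<cdot>\<^bsub>op_extri B\<^esub> p\<^sub>A'))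
         ((i\<^sub>C \<cdot>\<^bsub>op_extri B\<^esub> b \<cdot>\<^bsub>op_extri B\<^esub> p\<^sub>M) \<otimes>\<^bsub>Hom (op_extri B) SM SC\<^esub> (i\<^sub>C' \<cdot>\<^bsub>op_extri B\<^esub> b' \<cdot>\<^bsub>op_extri B\<^esub> p\<^sub>M'))"
      using realisation_sum[OF 1 2(3,2,1)]
        push_pull[OF C(1) A(3) x(1)] push_pull[OF C(2) A(4) y(1)]
        Comp_assoc[OF M(3) x(3) A(1)] Comp_assoc[OF M(4) y(3) A(2)]
        Comp_assoc[OF C(3) x(2) M(1)] Comp_assoc[OF C(4) y(2) M(2)]
      unfolding r by simp
  next
    fix \<delta> A M C a b \<delta>' A' M' C' a' b' f g
    assume "realised (op_extri B) \<delta> A M C a b" "realised (op_extri B) \<delta>' A' M' C' a' b'"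
      "f \<in> mor (op_extri B) A A'" "g \<in> mor (op_extri B) M M'" "g \<cdot>\<^bsub>op_extri B\<^esub> a = a' \<cdot>\<^bsub>op_extri B\<^esub> f"
    then show "\<exists>h\<in>mor (op_extri B) C C'. push (op_extri B) C f \<delta> = pull (op_extri B) A' h \<delta>' \<and>
        h \<cdot>\<^bsub>op_extri B\<^esub> b = b' \<cdot>\<^bsub>op_extri B\<^esub> g"
      using ET3_op[of \<delta>' C' M' A' b' a' \<delta> C M A b a g f] unfolding r by simp metis
  next
    fix \<delta> A M C a b \<delta>' A' M' C' a' b' g h
    assume "realised (op_extri B) \<delta> A M C a b" "realised (op_extri B) \<delta>' A' M' C' a' b'"
      "g \<in> mor (op_extri B) M M'" "h \<in> mor (op_extri B) C C'" "h \<cdot>\<^bsub>op_extri B\<^esub> b = b' \<cdot>\<^bsub>op_extri B\<^esub> g"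
    then show "\<exists>f\<in>mor (op_extri B) A A'. push (op_extri B) C f \<delta> = pull (op_extri B) A' h \<delta>' \<and>
        g \<cdot>\<^bsub>op_extri B\<^esub> a = a' \<cdot>\<^bsub>op_extri B\<^esub> f"
      using ET3[of \<delta>' C' M' A' b' a' \<delta> C M A b a h g] unfolding r by simp metis
  next
    fix \<delta> A M D a a' \<delta>' N F b b'
    assume "realised (op_extri B) \<delta> A M D a a'" "realised (op_extri B) \<delta>' M N F b b'"
    then show "\<exists>E \<delta>'' c c'. \<exists>d\<in>mor (op_extri B) D E. \<exists>e\<in>mor (op_extri B) E F.
         realised (op_extri B) \<delta>'' A N E c c' \<and>
         c = b \<cdot>\<^bsub>op_extri B\<^esub> a \<and> c' \<cdot>\<^bsub>op_extri B\<^esub> b = d \<cdot>\<^bsub>op_extri B\<^esub> a' \<and> e \<cdot>\<^bsub>op_extri B\<^esub> c' = b' \<and>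
         realised (op_extri B) (push (op_extri B) F a' \<delta>') D E F d e \<and>
         pull (op_extri B) A d \<delta>'' = \<delta> \<and> push (op_extri B) E a \<delta>'' = pull (op_extri B) M e \<delta>'"
      using ET4_op[of \<delta> D M A a' a \<delta>' F N b' b] unfolding r by simp
  next
    fix \<delta> D M A a' a \<delta>' F N b' b
    assume "realised (op_extri B) \<delta> D M A a' a" "realised (op_extri B) \<delta>' F N M b' b"
    then show "\<exists>E \<delta>'' c c'. \<exists>d\<in>mor (op_extri B) E D. \<exists>e\<in>mor (op_extri B) F E.
         realised (op_extri B) \<delta>'' E N A c' c \<and>
         c = a \<cdot>\<^bsub>op_extri B\<^esub> b \<and> b \<cdot>\<^bsub>op_extri B\<^esub> c' = a' \<cdot>\<^bsub>op_extri B\<^esub> d \<and> c' \<cdot>\<^bsub>op_extri B\<^esub> e = b' \<and>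
         realised (op_extri B) (pull (op_extri B) F a' \<delta>') F E D e d \<and>
         push (op_extri B) A d \<delta>'' = \<delta> \<and> pull (op_extri B) E a \<delta>'' = push (op_extri B) M e \<delta>'"
      using ET4[of \<delta> A M D a a' \<delta>' N F b b'] unfolding r by simp
  qed
qed

end

section \<open>Exact sequences of an extriangulated category\<close>

context additive_category
begin

lemma zero_object_zmor:
  assumes Z: "zero_object C Z"
  shows "f \<in> mor C X Z \<Longrightarrow> f = zmor X Z" "f \<in> mor C Z X \<Longrightarrow> f = zmor Z X"
proof -
  have ZO: "Z \<in> Obj C" using Z by (simp add: zero_object_def)
  show "f \<in> mor C X Z \<Longrightarrow> f = zmor X Z"
    using Z zmor_mor[OF _ ZO, of X] mor_source[of f X Z] unfolding zero_object_def by blast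
  show "f \<in> mor C Z X \<Longrightarrow> f = zmor Z X"
    using Z zmor_mor[OF ZO, of X] mor_target[of f Z X] unfolding zero_object_def by blast
qed

lemma biproduct_zero_object:
  assumes Z: "zero_object C Z" and X: "X \<in> Obj C"
  shows "biproduct C X Z X (Ident C X) (zmor Z X) (Ident C X) (zmor X Z)"
proof -
  have ZO: "Z \<in> Obj C" using Z by (simp add: zero_object_def)
  note z = zmor_mor[OF ZO X] zmor_mor[OF X ZO] Ident_mor[OF X]
  have "Ident C Z = zmor Z Z" using zero_object_zmor(1)[OF Z Ident_mor[OF ZO]] .
  then show ?thesis
    using z Comp_Ident[OF z(3)] Comp_Ident[OF z(2)] Ident_Comp[OF z(1)] Comp_zmor[OF z(1) X]
      Comp_zmor[OF z(2) ZO] madd_zmor[OF z(3)]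
    by (simp add: biproduct_def)
qed

end

context extriangulated_category
begin

lemma ex_zero: obtains Z where "zero_object B Z" "Z \<in> Obj B"
  using ex_zero_object by (auto simp: zero_object_def)

text \<open>Together with \<open>realised_from_zero\<close>, these are the trivial conflations;
  comparing a conflation with them by (ET3) or its dual gives the first exactness
  statements.\<close>

lemma realised_to_zero:
  assumes "zero_object B Z" "X \<in> Obj B"
  shows "realised B (ezero Z X) X X Z (Ident B X) (zmor X Z)"
  using realisation_split[OF biproduct_zero_object[OF assms]] .

lemma realised_from_zero:
  assumes "zero_object B Z" "X \<in> Obj B"
  shows "realised B (ezero X Z) Z X X (zmor Z X) (Ident B X)"
  using realisation_split[OF biproduct_swap[OF biproduct_zero_object[OF assms]]] .

lemma realised_op: "realised (op_extri B) \<delta> A M C a b = realised B \<delta> C M A b a"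
  by (rule realised_op_extri[OF preadditive_category_axioms])

text \<open>(ET3) for the identity of \<open>A\<close> and \<open>a\<close>, starting from
  \<open>A \<rightarrow> A \<rightarrow> 0\<close>, makes \<open>b \<cdot> a\<close> factor through
  a zero object.\<close>

lemma realised_composite:
  assumes r: "realised B \<delta> A M C a b"
  shows "b \<cdot> a = zmor A C"
proof -
  note m = realised_mor[OF r]
  obtain Z where Z: "zero_object B Z" using ex_zero .
  obtain h where h: "h \<in> mor B Z C" "h \<cdot> zmor A Z = b \<cdot> a"
    using ET3[OF realised_to_zero[OF Z m(4)] r Ident_mor[OF m(4)] m(2)] by auto
  then show ?thesis using m(4) by simp
qed

text \<open>The dual of (ET3), starting from \<open>0 \<rightarrow> M \<rightarrow> M\<close>,
  exhibits the pulled back class as a pushout of a zero class.\<close>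

lemma pull_deflation:
  assumes r: "realised B \<delta> A M C a b"
  shows "pull B A b \<delta> = ezero M A"
proof -
  note m = realised_mor[OF r]
  obtain Z where Z: "zero_object B Z" using ex_zero .
  obtain f where "f \<in> mor B Z A" "push B M f (ezero M Z) = pull B A b \<delta>"
    using ET3_op[OF realised_from_zero[OF Z m(5)] r Ident_mor[OF m(5)] m(3)] by auto
  then show ?thesis using push_ezero m(5) by metis
qed

text \<open>Vanishing of the pulled back class makes \<open>(Ident B A, h)\<close> a morphism from
  the split extension; a morphism \<open>g\<close> realising it, restricted to the summand
  \<open>X\<close>, is the lift.\<close>

lemma deflation_lift:
  assumes r: "realised B \<delta> A M C a b" and h: "h \<in> mor B X C" and z: "pull B A h \<delta> = ezero X A"
  obtains g where "g \<in> mor B X M" "b \<cdot> g = h"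
proof -
  note m = realised_mor[OF r]
  have X: "X \<in> Obj B" using h mor_source by blast
  obtain P i j p q where P: "biproduct B A X P i j p q" using ex_biproduct[OF m(4) X] by blast
  note d = biproduct_mor[OF P]
  have "push B X (Ident B A) (ezero X A) = pull B A h \<delta>"
    using z push_Ident[OF X m(4) ezero_closed[OF X m(4)]] by simp
  then obtain g where g: "g \<in> mor B P M" "b \<cdot> g = h \<cdot> q"
    using realisation[OF realisation_split[OF P] r Ident_mor[OF m(4)] h] by blast
  have "b \<cdot> (g \<cdot> j) = h"
    using Comp_assoc[OF d(2) g(1) m(3)] Comp_assoc[OF d(2,4) h] g d Comp_Ident[OF h] by simp
  then show ?thesis using that Comp_mor[OF d(2) g(1)] by blast
qed

text \<open>The dual of (ET3), starting from \<open>X \<rightarrow> X \<rightarrow> 0\<close>; its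
  component on the fibres is \<open>u\<close>.\<close>

lemma inflation_factor:
  assumes r: "realised B \<delta> A M C a b" and g: "g \<in> mor B X M" and z: "b \<cdot> g = zmor X C"
  obtains u where "u \<in> mor B X A" "a \<cdot> u = g"
proof -
  note m = realised_mor[OF r]
  have X: "X \<in> Obj B" using g mor_source by blast
  obtain Z where Z: "zero_object B Z" "Z \<in> Obj B" using ex_zero .
  have "zmor Z C \<cdot> zmor X Z = b \<cdot> g" using z zmor_Comp[OF zmor_mor[OF X Z(2)] m(6)] by simp
  then obtain f where "f \<in> mor B X A" "g \<cdot> Ident B X = a \<cdot> f"
    using ET3_op[OF realised_to_zero[OF Z(1) X] r g zmor_mor[OF Z(2) m(6)]] by blast
  then show ?thesis using that Comp_Ident[OF g] by simp
qed

lemma inflation_extend: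
  assumes r: "realised B \<delta> A M C a b" and f: "f \<in> mor B A X" and z: "push B C f \<delta> = ezero C X"
  obtains g where "g \<in> mor B M X" "g \<cdot> a = f"
proof -
  interpret op: extriangulated_category "op_extri B" by (rule extriangulated_op_extri)
  show ?thesis using op.deflation_lift[of \<delta> C M A b a f X] r f z that realised_op by auto
qed

lemma push_inflation:
  assumes r: "realised B \<delta> A M C a b"
  shows "push B C a \<delta> = ezero C M"
proof -
  interpret op: extriangulated_category "op_extri B" by (rule extriangulated_op_extri)
  show ?thesis using op.pull_deflation[of \<delta> C M A b a] r realised_op by simp
qed

lemma deflation_factor:
  assumes r: "realised B \<delta> A M C a b" and g: "g \<in> mor B M X" and z: "g \<cdot> a = zmor A X"
  obtains u where "u \<in> mor B C X" "u \<cdot> b = g"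
proof -
  interpret op: extriangulated_category "op_extri B" by (rule extriangulated_op_extri)
  show ?thesis using op.inflation_factor[of \<delta> C M A b a g X] r g z that realised_op by auto
qed

text \<open>The condition extends \<open>a\<close> over the inflation of a realisation of
  \<open>\<theta>\<close>; (ET3) for the identity of \<open>A\<close> and this extension then
  compares the cones.\<close>

lemma ext_eq_pull:
  assumes r: "realised B \<delta> A M C a b" and t: "\<theta> \<in> carrier (Ext B X A)" and X: "X \<in> Obj B"
    and z: "push B X a \<theta> = ezero X M"
  obtains h where "h \<in> mor B X C" "\<theta> = pull B A h \<delta>"
proof -
  note m = realised_mor[OF r]
  obtain N k n where N: "realised B \<theta> A N X k n" using ex_realised[OF X m(4) t] .
  obtain g where g: "g \<in> mor B N M" "g \<cdot> k = a" using inflation_extend[OF N m(2) z] .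
  have "g \<cdot> k = a \<cdot> Ident B A" using g Comp_Ident[OF m(2)] by simp
  then obtain h where "h \<in> mor B X C" "push B X (Ident B A) \<theta> = pull B A h \<delta>"
    using ET3[OF N r Ident_mor[OF m(4)] g(1)] by blast
  then show ?thesis using that push_Ident[OF X m(4) t] by simp
qed

lemma ext_eq_push:
  assumes r: "realised B \<delta> A M C a b" and t: "\<theta> \<in> carrier (Ext B C X)" and X: "X \<in> Obj B"
    and z: "pull B X b \<theta> = ezero M X"
  obtains f where "f \<in> mor B A X" "\<theta> = push B C f \<delta>"
proof -
  interpret op: extriangulated_category "op_extri B" by (rule extriangulated_op_extri)
  show ?thesis using op.ext_eq_pull[of \<delta> C M A b a \<theta> X] r t X z that realised_op by auto
qed

text \<open>
  By (ET4), the composite of \<open>a\<close> with an inflation realising \<open>\<theta>\<close> splits off the cone of \<open>\<theta>\<close>; pulling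
  back along the section yields the preimage of \<open>\<theta>\<close>.
\<close>

lemma ext_exact_push:
  assumes r: "realised B \<delta> A M C a b" and t: "\<theta> \<in> carrier (Ext B X M)" and X: "X \<in> Obj B"
    and z: "push B X b \<theta> = ezero X C"
  obtains \<phi> where "\<phi> \<in> carrier (Ext B X A)" "\<theta> = push B X a \<phi>"
proof -
  note m = realised_mor[OF r]
  obtain N k n where N: "realised B \<theta> M N X k n" using ex_realised[OF X m(5) t] .
  obtain E \<epsilon> c c' d e where E: "d \<in> mor B C E" "e \<in> mor B E X" "realised B \<epsilon> A N E c c'"
    "realised B (push B X b \<theta>) C E X d e" "push B E a \<epsilon> = pull B M e \<theta>"
    using ET4[OF r N] by blast
  have e: "\<epsilon> \<in> carrier (Ext B E A)" using realised_mor[OF E(3)] by blast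
  have "pull B C (Ident B X) (push B X b \<theta>) = ezero X C"
    using z pull_Ident[OF X m(6) ezero_closed[OF X m(6)]] by simp
  then obtain s where s: "s \<in> mor B X E" "e \<cdot> s = Ident B X"
    using deflation_lift[OF E(4) Ident_mor[OF X]] by blast
  have "\<theta> = pull B M (e \<cdot> s) \<theta>" using s pull_Ident[OF X m(5) t] by simp
  also have "\<dots> = pull B M s (push B E a \<epsilon>)" using pull_Comp[OF E(2) s(1) t m(5)] E(5) by simp
  also have "\<dots> = push B X a (pull B A s \<epsilon>)" using push_pull[OF m(2) s(1) e] by simp
  finally show ?thesis using that pull_closed[OF s(1) e m(4)] by blast
qed

lemma ext_exact_pull:
  assumes r: "realised B \<delta> A M C a b" and t: "\<theta> \<in> carrier (Ext B M X)" and X: "X \<in> Obj B"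
    and z: "pull B X a \<theta> = ezero A X"
  obtains \<phi> where "\<phi> \<in> carrier (Ext B C X)" "\<theta> = pull B X b \<phi>"
proof -
  interpret op: extriangulated_category "op_extri B" by (rule extriangulated_op_extri)
  show ?thesis using op.ext_exact_push[of \<delta> C M A b a \<theta> X] r t X z that realised_op by auto
qed

end

section \<open>Quotients by the ideal of morphisms factoring through a subcategory\<close>

text \<open>\<open>\<H>\<close> is a parameter because the locale is used for all objects as well as
  for those of the heart. A member of \<open>factor_ideal\<close> passes through a single object of
  \<open>\<W>\<close>, so closure under sums depends on \<open>\<W>\<close> and is assumed.\<close>

locale quotient_ideal = preadditive_category B
  for B :: "('o, 'm, 'x) preadd_cat_scheme" (structure) +
  fixes \<H> \<W> :: "'o set"
  assumes H_Obj: "\<H> \<subseteq> Obj B"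
    and ideal_subgroup:
      "X \<in> \<H> \<Longrightarrow> Y \<in> \<H> \<Longrightarrow> subgroup (factor_ideal B \<W> X Y) (Hom B X Y)"
begin

abbreviation J where "J \<equiv> factor_ideal B \<W>"
abbreviation Q where "Q \<equiv> ideal_quotient B \<H> \<W>"

definition cls where "cls X Y f = J X Y #>\<^bsub>Hom B X Y\<^esub> f"

lemma J_mor: "f \<in> J X Y \<Longrightarrow> f \<in> mor B X Y"
  using Comp_mor by (auto simp: factor_ideal_def)

lemma J_Comp_left: assumes "f \<in> J X Y" "g \<in> mor B Y Z" shows "g \<cdot> f \<in> J X Z"
proof -
  obtain u v W where *: "f = v \<cdot> u" "W \<in> \<W>" "u \<in> mor B X W" "v \<in> mor B W Y"
    using assms by (auto simp: factor_ideal_def)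
  then have "g \<cdot> f = (g \<cdot> v) \<cdot> u" "g \<cdot> v \<in> mor B W Z" using Comp_assoc Comp_mor assms by simp_all
  then show ?thesis using * unfolding factor_ideal_def by blast
qed

lemma J_Comp_right: assumes "g \<in> J Y Z" "f \<in> mor B X Y" shows "g \<cdot> f \<in> J X Z"
proof -
  obtain u v W where *: "g = v \<cdot> u" "W \<in> \<W>" "u \<in> mor B Y W" "v \<in> mor B W Z"
    using assms by (auto simp: factor_ideal_def)
  then have "g \<cdot> f = v \<cdot> (u \<cdot> f)" "u \<cdot> f \<in> mor B X W" using Comp_assoc Comp_mor assms by simp_all
  then show ?thesis using * unfolding factor_ideal_def by blast
qed

lemma J_zmor: "X \<in> \<H> \<Longrightarrow> Y \<in> \<H> \<Longrightarrow> zmor X Y \<in> J X Y"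
  using ideal_subgroup subgroup.one_closed by blast

lemma J_madd: "X \<in> \<H> \<Longrightarrow> Y \<in> \<H> \<Longrightarrow> f \<in> J X Y \<Longrightarrow> g \<in> J X Y \<Longrightarrow> madd X Y f g \<in> J X Y"
  using ideal_subgroup subgroup.m_closed by metis

lemma J_normal:
  assumes "X \<in> \<H>" "Y \<in> \<H>" shows "normal (J X Y) (Hom B X Y)"
  using comm_group.subgroup_imp_normal[OF Hom_comm_group ideal_subgroup] assms H_Obj by blast

lemma cls_eq_iff:
  assumes H: "X \<in> \<H>" "Y \<in> \<H>" and f: "f \<in> mor B X Y" "g \<in> mor B X Y"
  shows "cls X Y f = cls X Y g \<longleftrightarrow> mdiff X Y f g \<in> J X Y"
proof -
  interpret normal "J X Y" "Hom B X Y" using J_normal[OF H] .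
  have c: "f \<in> carrier (Hom B X Y)" "g \<in> carrier (Hom B X Y)" using f mor_carrier by auto
  show ?thesis
  proof
    assume "cls X Y f = cls X Y g"
    then have "f \<in> J X Y #>\<^bsub>Hom B X Y\<^esub> g" using rcos_self[OF c(1) subgroup_axioms] by (simp add: cls_def)
    then show "mdiff X Y f g \<in> J X Y" using rcos_module_imp[OF Hom_group'[OF f(1)] c(2)] by simp
  next
    assume "mdiff X Y f g \<in> J X Y"
    then have "f \<in> J X Y #>\<^bsub>Hom B X Y\<^esub> g"
      using c by (auto simp: r_coset_def intro!: bexI[of _ "mdiff X Y f g"] simp: m_assoc)
    then show "cls X Y f = cls X Y g" using repr_independence[OF _ c(2) subgroup_axioms] by (simp add: cls_def)
  qed
qed

lemma cls_zmor: assumes "X \<in> \<H>" "Y \<in> \<H>" shows "cls X Y (zmor X Y) = \<one>\<^bsub>Hom Q X Y\<^esub>"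
proof -
  interpret normal "J X Y" "Hom B X Y" using J_normal assms .
  show ?thesis by (simp add: cls_def ideal_quotient_def FactGroup_def coset_mult_one[OF subset])
qed

lemma cls_eq_zero_iff:
  assumes H: "X \<in> \<H>" "Y \<in> \<H>" and f: "f \<in> mor B X Y"
  shows "cls X Y f = \<one>\<^bsub>Hom Q X Y\<^esub> \<longleftrightarrow> f \<in> J X Y"
proof -
  have "zmor X Y \<in> mor B X Y" using H H_Obj by blast
  then show ?thesis using cls_eq_iff[OF H f] cls_zmor[OF H] madd_zmor(3)[OF f] by metis
qed

lemma mor_Q: "mor Q X Y = {F. X \<in> \<H> \<and> Y \<in> \<H> \<and> (\<exists>f\<in>mor B X Y. F = cls X Y f)}"
  using H_Obj by (auto simp: mor_def ideal_quotient_def FactGroup_def RCOSETS_def cls_def)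

lemma cls_mor: "X \<in> \<H> \<Longrightarrow> Y \<in> \<H> \<Longrightarrow> f \<in> mor B X Y \<Longrightarrow> cls X Y f \<in> mor Q X Y"
  by (auto simp: mor_Q)

lemma mor_QE:
  assumes "F \<in> mor Q X Y"
  obtains f where "X \<in> \<H>" "Y \<in> \<H>" "f \<in> mor B X Y" "F = cls X Y f"
  using assms by (auto simp: mor_Q)

lemma cls_subset: "X \<in> \<H> \<Longrightarrow> Y \<in> \<H> \<Longrightarrow> f \<in> mor B X Y \<Longrightarrow> cls X Y f \<subseteq> mor B X Y"
  using J_mor madd_mor by (fastforce simp: cls_def r_coset_def)

lemma cls_self: "X \<in> \<H> \<Longrightarrow> Y \<in> \<H> \<Longrightarrow> f \<in> mor B X Y \<Longrightarrow> f \<in> cls X Y f"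
  unfolding cls_def
  using Hom_group' group.rcos_self ideal_subgroup mor_carrier by metis

lemma cls_memberD:
  assumes H: "X \<in> \<H>" "Y \<in> \<H>" and f: "f \<in> mor B X Y" and g: "g \<in> cls X Y f"
  shows "g \<in> mor B X Y" "cls X Y g = cls X Y f"
proof -
  show "g \<in> mor B X Y" using cls_subset assms by blast
  interpret normal "J X Y" "Hom B X Y" using J_normal[OF H] .
  show "cls X Y g = cls X Y f"
    using repr_independence[OF _ mor_carrier[OF f] subgroup_axioms] g by (simp add: cls_def)
qed

text \<open>Two steps, with differences \<open>g \<cdot> (f - f')\<close> and
  \<open>(g - g') \<cdot> f'\<close>, both in the ideal.\<close>

lemma cls_Comp_cong:
  assumes H: "X \<in> \<H>" "Y \<in> \<H>" "Z \<in> \<H>" and f: "f \<in> mor B X Y" "f' \<in> mor B X Y" "cls X Y f = cls X Y f'"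
    and g: "g \<in> mor B Y Z" "g' \<in> mor B Y Z" "cls Y Z g = cls Y Z g'"
  shows "cls X Z (g \<cdot> f) = cls X Z (g' \<cdot> f')"
proof -
  note m = Comp_mor[OF f(1) g(1)] Comp_mor[OF f(2) g(1)] Comp_mor[OF f(2) g(2)]
  have "g \<cdot> mdiff X Y f f' \<in> J X Z" "mdiff Y Z g g' \<cdot> f' \<in> J X Z"
    using cls_eq_iff[OF H(1,2) f(1,2)] cls_eq_iff[OF H(2,3) g(1,2)] f g J_Comp_left J_Comp_right by simp_all
  then have "cls X Z (g \<cdot> f) = cls X Z (g \<cdot> f')" "cls X Z (g \<cdot> f') = cls X Z (g' \<cdot> f')"
    using Comp_mdiff[OF f(1,2) g(1)] mdiff_Comp[OF f(2) g(1,2)] cls_eq_iff H m by simp_all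
  then show ?thesis by simp
qed

lemma cls_Comp:
  assumes H: "X \<in> \<H>" "Y \<in> \<H>" "Z \<in> \<H>" and f: "f \<in> mor B X Y" and g: "g \<in> mor B Y Z"
  shows "cls Y Z g \<cdot>\<^bsub>Q\<^esub> cls X Y f = cls X Z (g \<cdot> f)"
proof -
  have "{J X' Z' #>\<^bsub>Hom B X' Z'\<^esub> (g' \<cdot> f') | X' Y' Z' f' g'.
      f' \<in> cls X Y f \<and> f' \<in> mor B X' Y' \<and> g' \<in> cls Y Z g \<and> g' \<in> mor B Y' Z'} = {cls X Z (g \<cdot> f)}"
    (is "?L = _")
  proof (intro equalityI subsetI)
    fix F assume "F \<in> ?L"
    then obtain X' Y' Z' f' g' where F: "F = J X' Z' #>\<^bsub>Hom B X' Z'\<^esub> (g' \<cdot> f')"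
      and *: "f' \<in> cls X Y f" "f' \<in> mor B X' Y'" "g' \<in> cls Y Z g" "g' \<in> mor B Y' Z'" by blast
    note 1 = cls_memberD[OF H(1,2) f *(1)] and 2 = cls_memberD[OF H(2,3) g *(3)]
    \<comment> \<open>The union ranges over source and target objects too; disjointness of the
      morphism sets leaves only the expected ones.\<close>
    have "X' = X" "Z' = Z" using Hom_disjoint[OF *(2) 1(1)] Hom_disjoint[OF *(4) 2(1)] by auto
    then have "F = cls X Z (g' \<cdot> f')" using F by (simp add: cls_def)
    then show "F \<in> {cls X Z (g \<cdot> f)}" using cls_Comp_cong[OF H 1(1) f 1(2) 2(1) g 2(2)] by simp
  next
    fix F assume "F \<in> {cls X Z (g \<cdot> f)}"
    then show "F \<in> ?L" using cls_self H f g unfolding cls_def by blast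
  qed
  then show ?thesis by (simp add: ideal_quotient_def)
qed

lemma cls_madd:
  assumes H: "X \<in> \<H>" "Y \<in> \<H>" and f: "f \<in> mor B X Y" "g \<in> mor B X Y"
  shows "cls X Y f \<otimes>\<^bsub>Hom Q X Y\<^esub> cls X Y g = cls X Y (madd X Y f g)"
proof -
  interpret normal "J X Y" "Hom B X Y" using J_normal[OF H] .
  show ?thesis using rcos_sum[OF mor_carrier[OF f(1)] mor_carrier[OF f(2)]]
    by (simp add: ideal_quotient_def FactGroup_def cls_def)
qed

lemma Obj_Q [simp]: "Obj Q = \<H>"
  by (simp add: ideal_quotient_def)

lemma Ident_Q: "Ident Q X = cls X X (Ident B X)"
  by (simp add: ideal_quotient_def cls_def)

lemma Ident_mor_H: "X \<in> \<H> \<Longrightarrow> Ident B X \<in> mor B X X"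
  using Ident_mor H_Obj by blast

lemma preadditive_Q: "preadditive_category Q"
proof (rule preadditive_category.intro)
  show "X = X' \<and> Y = Y'" if F: "F \<in> mor Q X Y" "F \<in> mor Q X' Y'" for F X Y X' Y'
  proof -
    obtain f where f: "X \<in> \<H>" "Y \<in> \<H>" "f \<in> mor B X Y" "F = cls X Y f" using F(1) by (rule mor_QE)
    obtain f' where f': "X' \<in> \<H>" "Y' \<in> \<H>" "f' \<in> mor B X' Y'" "F = cls X' Y' f'"
      using F(2) by (rule mor_QE)
    \<comment> \<open>A coset is nonempty and lies in one morphism set, so it inherits a unique
      source and target.\<close>
    have "f \<in> mor B X' Y'" using cls_self[OF f(1-3)] cls_memberD(1)[OF f'(1-3)] f(4) f'(4) by simp
    then show ?thesis using Hom_disjoint[OF f(3)] by blast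
  qed
next
  show "Ident Q X \<in> mor Q X X" if "X \<in> Obj Q" for X
    using that by (auto simp: Ident_Q intro: cls_mor Ident_mor_H)
next
  show "G \<cdot>\<^bsub>Q\<^esub> F \<in> mor Q X Z" if "F \<in> mor Q X Y" "G \<in> mor Q Y Z" for F G X Y Z
    using that by (auto elim!: mor_QE simp: cls_Comp intro!: cls_mor Comp_mor)
next
  show "F \<cdot>\<^bsub>Q\<^esub> Ident Q X = F" if "F \<in> mor Q X Y" for F X Y
    using that by (auto elim!: mor_QE simp: cls_Comp Ident_Q Ident_mor_H Comp_Ident)
next
  show "Ident Q Y \<cdot>\<^bsub>Q\<^esub> F = F" if "F \<in> mor Q X Y" for F X Y
    using that by (auto elim!: mor_QE simp: cls_Comp Ident_Q Ident_mor_H Ident_Comp)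
next
  show "(H \<cdot>\<^bsub>Q\<^esub> G) \<cdot>\<^bsub>Q\<^esub> F = H \<cdot>\<^bsub>Q\<^esub> G \<cdot>\<^bsub>Q\<^esub> F"
    if F: "F \<in> mor Q W X" "G \<in> mor Q X Y" "H \<in> mor Q Y Z" for F G H W X Y Z
  proof -
    obtain f where f: "W \<in> \<H>" "X \<in> \<H>" "f \<in> mor B W X" "F = cls W X f"
      using F(1) by (rule mor_QE)
    obtain g where g: "X \<in> \<H>" "Y \<in> \<H>" "g \<in> mor B X Y" "G = cls X Y g"
      using F(2) by (rule mor_QE)
    obtain h where h: "Y \<in> \<H>" "Z \<in> \<H>" "h \<in> mor B Y Z" "H = cls Y Z h"
      using F(3) by (rule mor_QE)
    note m = f(3) g(3) h(3)
    show ?thesis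
      using f g h cls_Comp Comp_mor[OF m(1,2)] Comp_mor[OF m(2,3)] Comp_assoc[OF m] by simp
  qed
next
  show "comm_group (Hom Q X Y)" if "X \<in> Obj Q" "Y \<in> Obj Q" for X Y
    using that comm_group.abelian_FactGroup[OF Hom_comm_group ideal_subgroup] H_Obj
    by (auto simp: ideal_quotient_def)
next
  show "G \<cdot>\<^bsub>Q\<^esub> (F \<otimes>\<^bsub>Hom Q X Y\<^esub> F') = (G \<cdot>\<^bsub>Q\<^esub> F) \<otimes>\<^bsub>Hom Q X Z\<^esub> (G \<cdot>\<^bsub>Q\<^esub> F')"
    if F: "F \<in> mor Q X Y" "F' \<in> mor Q X Y" "G \<in> mor Q Y Z" for F F' G X Y Z
  proof -
    obtain f where f: "X \<in> \<H>" "Y \<in> \<H>" "f \<in> mor B X Y" "F = cls X Y f"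
      using F(1) by (rule mor_QE)
    obtain f' where f': "X \<in> \<H>" "Y \<in> \<H>" "f' \<in> mor B X Y" "F' = cls X Y f'"
      using F(2) by (rule mor_QE)
    obtain g where g: "Y \<in> \<H>" "Z \<in> \<H>" "g \<in> mor B Y Z" "G = cls Y Z g"
      using F(3) by (rule mor_QE)
    note m = f(3) f'(3) g(3)
    show ?thesis
      using f f' g cls_Comp cls_madd Comp_mor[OF m(1,3)] Comp_mor[OF m(2,3)] madd_mor[OF m(1,2)]
        Comp_add_right[OF m] by simp
  qed
next
  show "(G \<otimes>\<^bsub>Hom Q Y Z\<^esub> G') \<cdot>\<^bsub>Q\<^esub> F = (G \<cdot>\<^bsub>Q\<^esub> F) \<otimes>\<^bsub>Hom Q X Z\<^esub> (G' \<cdot>\<^bsub>Q\<^esub> F)"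
    if F: "F \<in> mor Q X Y" "G \<in> mor Q Y Z" "G' \<in> mor Q Y Z" for F G G' X Y Z
  proof -
    obtain f where f: "X \<in> \<H>" "Y \<in> \<H>" "f \<in> mor B X Y" "F = cls X Y f"
      using F(1) by (rule mor_QE)
    obtain g where g: "Y \<in> \<H>" "Z \<in> \<H>" "g \<in> mor B Y Z" "G = cls Y Z g"
      using F(2) by (rule mor_QE)
    obtain g' where g': "Y \<in> \<H>" "Z \<in> \<H>" "g' \<in> mor B Y Z" "G' = cls Y Z g'"
      using F(3) by (rule mor_QE)
    note m = f(3) g(3) g'(3)
    show ?thesis
      using f g g' cls_Comp cls_madd Comp_mor[OF m(1,2)] Comp_mor[OF m(1,3)] madd_mor[OF m(2,3)]
        Comp_add_left[OF m] by simp
  qed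
qed

sublocale Q: preadditive_category Q
  by (rule preadditive_Q)

text \<open>Turns cancellation of cosets into membership in the ideal, which extension classes can
  detect.\<close>

lemma epimorphism_cls_iff:
  assumes H: "X \<in> \<H>" "Y \<in> \<H>" and f: "f \<in> mor B X Y"
  shows "epimorphism Q X Y (cls X Y f) \<longleftrightarrow>
    (\<forall>Z\<in>\<H>. \<forall>g\<in>mor B Y Z. g \<cdot> f \<in> J X Z \<longrightarrow> g \<in> J Y Z)"
proof -
  have *: "cls Y Z g \<cdot>\<^bsub>Q\<^esub> cls X Y f = \<one>\<^bsub>Hom Q X Z\<^esub> \<longleftrightarrow> g \<cdot> f \<in> J X Z" if "Z \<in> \<H>" "g \<in> mor B Y Z" for Z g
    using that assms cls_Comp cls_eq_zero_iff Comp_mor[OF f that(2)] by simp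
  then show ?thesis
    unfolding Q.epimorphism_iff
  proof (intro iffI conjI ballI impI allI cls_mor[OF H f])
    fix Z g
    assume e: "cls X Y f \<in> mor Q X Y \<and> (\<forall>Z. \<forall>g\<in>mor Q Y Z.
        g \<cdot>\<^bsub>Q\<^esub> cls X Y f = \<one>\<^bsub>Hom Q X Z\<^esub> \<longrightarrow> g = \<one>\<^bsub>Hom Q Y Z\<^esub>)"
      and g: "Z \<in> \<H>" "g \<in> mor B Y Z" "g \<cdot> f \<in> J X Z"
    then show "g \<in> J Y Z" using * cls_mor[OF H(2) g(1,2)] cls_eq_zero_iff[OF H(2) g(1,2)] by simp
  next
    fix Z G
    assume e: "\<forall>Z\<in>\<H>. \<forall>g\<in>mor B Y Z. g \<cdot> f \<in> J X Z \<longrightarrow> g \<in> J Y Z"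
      and G: "G \<in> mor Q Y Z" "G \<cdot>\<^bsub>Q\<^esub> cls X Y f = \<one>\<^bsub>Hom Q X Z\<^esub>"
    obtain g where g: "Z \<in> \<H>" "g \<in> mor B Y Z" "G = cls Y Z g" using G(1) by (rule mor_QE)
    then show "G = \<one>\<^bsub>Hom Q Y Z\<^esub>" using e G(2) * cls_eq_zero_iff[OF H(2) g(1,2)] by simp
  qed
qed

lemma monomorphism_cls_iff:
  assumes H: "X \<in> \<H>" "Y \<in> \<H>" and f: "f \<in> mor B X Y"
  shows "monomorphism Q X Y (cls X Y f) \<longleftrightarrow>
    (\<forall>Z\<in>\<H>. \<forall>g\<in>mor B Z X. f \<cdot> g \<in> J Z Y \<longrightarrow> g \<in> J Z X)"
proof -
  have *: "cls X Y f \<cdot>\<^bsub>Q\<^esub> cls Z X g = \<one>\<^bsub>Hom Q Z Y\<^esub> \<longleftrightarrow> f \<cdot> g \<in> J Z Y" if "Z \<in> \<H>" "g \<in> mor B Z X" for Z g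
    using that assms cls_Comp cls_eq_zero_iff Comp_mor[OF that(2) f] by simp
  then show ?thesis
    unfolding Q.monomorphism_iff
  proof (intro iffI conjI ballI impI allI cls_mor[OF H f])
    fix Z g
    assume e: "cls X Y f \<in> mor Q X Y \<and> (\<forall>Z. \<forall>g\<in>mor Q Z X.
        cls X Y f \<cdot>\<^bsub>Q\<^esub> g = \<one>\<^bsub>Hom Q Z Y\<^esub> \<longrightarrow> g = \<one>\<^bsub>Hom Q Z X\<^esub>)"
      and g: "Z \<in> \<H>" "g \<in> mor B Z X" "f \<cdot> g \<in> J Z Y"
    then show "g \<in> J Z X" using * cls_mor[OF g(1) H(1) g(2)] cls_eq_zero_iff[OF g(1) H(1) g(2)] by simp
  next
    fix Z G
    assume e: "\<forall>Z\<in>\<H>. \<forall>g\<in>mor B Z X. f \<cdot> g \<in> J Z Y \<longrightarrow> g \<in> J Z X"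
      and G: "G \<in> mor Q Z X" "cls X Y f \<cdot>\<^bsub>Q\<^esub> G = \<one>\<^bsub>Hom Q Z Y\<^esub>"
    obtain g where g: "Z \<in> \<H>" "g \<in> mor B Z X" "G = cls Z X g" using G(1) by (rule mor_QE)
    then show "G = \<one>\<^bsub>Hom Q Z X\<^esub>" using e G(2) * cls_eq_zero_iff[OF g(1) H(1) g(2)] by simp
  qed
qed

lemma cokernel_clsI:
  assumes H: "X \<in> \<H>" "Y \<in> \<H>" "K \<in> \<H>" and f: "f \<in> mor B X Y" and q: "q \<in> mor B Y K"
    and qf: "q \<cdot> f \<in> J X K" and e: "epimorphism Q Y K (cls Y K q)"
    and u: "\<And>Z g. Z \<in> \<H> \<Longrightarrow> g \<in> mor B Y Z \<Longrightarrow> g \<cdot> f \<in> J X Z \<Longrightarrow>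
      \<exists>u\<in>mor B K Z. cls Y Z (u \<cdot> q) = cls Y Z g"
  shows "cokernel_of Q X Y (cls X Y f) K (cls Y K q)"
proof (rule Q.cokernelI[OF cls_mor[OF H(1,2) f] e])
  show "cls Y K q \<cdot>\<^bsub>Q\<^esub> cls X Y f = \<one>\<^bsub>Hom Q X K\<^esub>"
    using cls_Comp[OF H f q] cls_eq_zero_iff[OF H(1,3) Comp_mor[OF f q]] qf by simp
  fix Z G assume "G \<in> mor Q Y Z" and z: "G \<cdot>\<^bsub>Q\<^esub> cls X Y f = \<one>\<^bsub>Hom Q X Z\<^esub>"
  then obtain g where g: "Z \<in> \<H>" "g \<in> mor B Y Z" "G = cls Y Z g" by (auto elim: mor_QE)
  then have "g \<cdot> f \<in> J X Z"
    using z cls_Comp[OF H(1,2) g(1) f g(2)] cls_eq_zero_iff[OF H(1) g(1) Comp_mor[OF f g(2)]] by simp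
  then obtain u where u: "u \<in> mor B K Z" "cls Y Z (u \<cdot> q) = G" using u g by blast
  show "\<exists>u\<in>mor Q K Z. u \<cdot>\<^bsub>Q\<^esub> cls Y K q = G"
    using u(2) cls_Comp[OF H(2,3) g(1) q u(1)] cls_mor[OF H(3) g(1) u(1)] by auto
qed

lemma kernel_clsI:
  assumes H: "X \<in> \<H>" "Y \<in> \<H>" "K \<in> \<H>" and f: "f \<in> mor B X Y" and k: "k \<in> mor B K X"
    and fk: "f \<cdot> k \<in> J K Y" and e: "monomorphism Q K X (cls K X k)"
    and u: "\<And>Z g. Z \<in> \<H> \<Longrightarrow> g \<in> mor B Z X \<Longrightarrow> f \<cdot> g \<in> J Z Y \<Longrightarrow>
      \<exists>u\<in>mor B Z K. cls Z X (k \<cdot> u) = cls Z X g"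
  shows "kernel_of Q X Y (cls X Y f) K (cls K X k)"
proof (rule Q.kernelI[OF cls_mor[OF H(1,2) f] e])
  show "cls X Y f \<cdot>\<^bsub>Q\<^esub> cls K X k = \<one>\<^bsub>Hom Q K Y\<^esub>"
    using cls_Comp[OF H(3,1,2) k f] cls_eq_zero_iff[OF H(3,2) Comp_mor[OF k f]] fk by simp
  fix Z G assume "G \<in> mor Q Z X" and z: "cls X Y f \<cdot>\<^bsub>Q\<^esub> G = \<one>\<^bsub>Hom Q Z Y\<^esub>"
  then obtain g where g: "Z \<in> \<H>" "g \<in> mor B Z X" "G = cls Z X g" by (auto elim: mor_QE)
  then have "f \<cdot> g \<in> J Z Y"
    using z cls_Comp[OF g(1) H(1,2) g(2) f] cls_eq_zero_iff[OF g(1) H(2) Comp_mor[OF g(2) f]] by simp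
  then obtain u where u: "u \<in> mor B Z K" "cls Z X (k \<cdot> u) = G" using u g by blast
  show "\<exists>u\<in>mor Q Z K. cls K X k \<cdot>\<^bsub>Q\<^esub> u = G"
    using u(2) cls_Comp[OF g(1) H(3,1) u(1) k] cls_mor[OF g(1) H(3) u(1)] by auto
qed

lemma biproduct_cls:
  assumes H: "X \<in> \<H>" "Y \<in> \<H>" "P \<in> \<H>" and P: "biproduct B X Y P i j p q"
  shows "biproduct Q X Y P (cls X P i) (cls Y P j) (cls P X p) (cls P Y q)"
proof -
  note d = biproduct_mor[OF P]
  show ?thesis
    unfolding biproduct_def
    using H d by (simp add: cls_mor cls_Comp Ident_Q flip: cls_zmor)
      (use cls_madd[OF H(3,3) Comp_mor[OF d(3,1)] Comp_mor[OF d(4,2)]] in simp)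
qed

lemma zero_object_Q:
  assumes Z: "Z \<in> \<H>" "Ident B Z \<in> J Z Z" shows "zero_object Q Z"
proof -
  have "F = \<one>\<^bsub>Hom Q Z X\<^esub>" if F: "F \<in> mor Q Z X" for F X
  proof -
    obtain f where f: "X \<in> \<H>" "f \<in> mor B Z X" "F = cls Z X f" using F by (auto elim: mor_QE)
    then have "f \<in> J Z X" using J_Comp_left[OF Z(2) f(2)] Comp_Ident by simp
    then show ?thesis using cls_eq_zero_iff f Z by simp
  qed
  moreover have "F = \<one>\<^bsub>Hom Q X Z\<^esub>" if F: "F \<in> mor Q X Z" for F X
  proof -
    obtain f where f: "X \<in> \<H>" "f \<in> mor B X Z" "F = cls X Z f" using F by (auto elim: mor_QE)
    then have "f \<in> J X Z" using J_Comp_right[OF Z(2) f(2)] Ident_Comp by simp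
    then show ?thesis using cls_eq_zero_iff f Z by simp
  qed
  ultimately show ?thesis using Z Q.zmor_mor unfolding zero_object_def Obj_Q by metis
qed

end

section \<open>Cotorsion pairs\<close>

context extriangulated_category
begin

lemma cotorsion_pairD:
  assumes "cotorsion_pair B \<X> \<Y>"
  shows "additive_subcategory B \<X>" "additive_subcategory B \<Y>" "summand_closed B \<X>"
    "summand_closed B \<Y>" "Ext_vanishes B \<X> \<Y>" "Cone B \<Y> \<X> = Obj B" "CoCone B \<Y> \<X> = Obj B"
  using assms unfolding cotorsion_pair_def by blast+

lemma additive_subcategoryD:
  assumes "additive_subcategory B \<X>"
  shows "\<X> \<subseteq> Obj B" "iso_closed B \<X>" "\<exists>Z. Z \<in> \<X>"
  using assms unfolding additive_subcategory_def by blast+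

lemma cotorsion_pair_Obj:
  assumes "cotorsion_pair B \<X> \<Y>" shows "\<X> \<subseteq> Obj B" "\<Y> \<subseteq> Obj B"
  using cotorsion_pairD(1,2)[OF assms] additive_subcategoryD(1) by blast+

lemma cotorsion_pair_ext:
  assumes "cotorsion_pair B \<X> \<Y>" "X \<in> \<X>" "Y \<in> \<Y>" "\<theta> \<in> carrier (Ext B X Y)"
  shows "\<theta> = ezero X Y"
  using cotorsion_pairD(5)[OF assms(1)] assms(2-) unfolding Ext_vanishes_def by blast

lemma cotorsion_pair_right_approximation:
  assumes "cotorsion_pair B \<X> \<Y>" "A \<in> Obj B"
  obtains Y X \<delta> a b where "Y \<in> \<Y>" "X \<in> \<X>" "realised B \<delta> A Y X a b"
proof -
  have "A \<in> CoCone B \<Y> \<X>" using assms(2) cotorsion_pairD(7)[OF assms(1)] by simp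
  then show ?thesis using that by (auto simp: CoCone_def conflation_def)
qed

lemma cotorsion_pair_left_approximation:
  assumes "cotorsion_pair B \<X> \<Y>" "A \<in> Obj B"
  obtains Y X \<delta> a b where "Y \<in> \<Y>" "X \<in> \<X>" "realised B \<delta> Y X A a b"
proof -
  have "A \<in> Cone B \<Y> \<X>" using assms(2) cotorsion_pairD(6)[OF assms(1)] by simp
  then show ?thesis using that by (auto simp: Cone_def conflation_def)
qed

text \<open>By uniqueness of realisations \<open>M\<close> is isomorphic to the biproduct of
  \<open>A\<close> and \<open>C\<close>.\<close>

lemma split_realised_summand:
  assumes r: "realised B (ezero C A) A M C a b"
    and "iso_closed B \<X>" "summand_closed B \<X>" "M \<in> \<X>"
  shows "A \<in> \<X>" "C \<in> \<X>"
proof -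
  note m = realised_mor[OF r]
  obtain P i j p q where P: "biproduct B A C P i j p q" using ex_biproduct[OF m(4,6)] by blast
  obtain g where "iso_mor B M P g" using realised_unique[OF r realisation_split[OF P]] .
  then have "P \<in> \<X>" using assms by (auto simp: iso_closed_def)
  then show "A \<in> \<X>" "C \<in> \<X>" using assms(3) P unfolding summand_closed_def by blast+
qed

text \<open>The approximation \<open>A \<rightarrow> Y \<rightarrow> X\<close> realises a zero
  class, so it splits and \<open>A\<close> is a summand of \<open>Y\<close>. Thus each half of a
  cotorsion pair is the full orthogonal of the other; \<open>cotorsion_pair_leftI\<close> is the
  dual.\<close>

lemma cotorsion_pair_rightI:
  assumes c: "cotorsion_pair B \<X> \<Y>" and A: "A \<in> Obj B"
    and z: "\<And>X \<theta>. X \<in> \<X> \<Longrightarrow> \<theta> \<in> carrier (Ext B X A) \<Longrightarrow> \<theta> = ezero X A"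
  shows "A \<in> \<Y>"
proof -
  obtain Y X \<delta> a b where r: "Y \<in> \<Y>" "X \<in> \<X>" "realised B \<delta> A Y X a b"
    by (rule cotorsion_pair_right_approximation[OF c A])
  then have "realised B (ezero X A) A Y X a b" using z realised_mor(1) by metis
  then show ?thesis
    using split_realised_summand(1)[OF _ additive_subcategoryD(2)[OF cotorsion_pairD(2)[OF c]]
        cotorsion_pairD(4)[OF c]] r by blast
qed

lemma cotorsion_pair_leftI:
  assumes c: "cotorsion_pair B \<X> \<Y>" and A: "A \<in> Obj B"
    and z: "\<And>Y \<theta>. Y \<in> \<Y> \<Longrightarrow> \<theta> \<in> carrier (Ext B A Y) \<Longrightarrow> \<theta> = ezero A Y"
  shows "A \<in> \<X>"
proof -
  obtain Y X \<delta> a b where r: "Y \<in> \<Y>" "X \<in> \<X>" "realised B \<delta> Y X A a b"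
    by (rule cotorsion_pair_left_approximation[OF c A])
  then have "realised B (ezero A Y) Y X A a b" using z realised_mor(1) by metis
  then show ?thesis
    using split_realised_summand(2)[OF _ additive_subcategoryD(2)[OF cotorsion_pairD(1)[OF c]]
        cotorsion_pairD(3)[OF c]] r by blast
qed

text \<open>The identity of \<open>I\<close> extends over the inflation realising
  \<open>\<theta>\<close>, and an inflation pushes its own class to zero.\<close>

lemma injective_object_ext:
  assumes I: "injective_object B I" and t: "\<theta> \<in> carrier (Ext B X I)" and X: "X \<in> Obj B"
  shows "\<theta> = ezero X I"
proof -
  have IO: "I \<in> Obj B" using I by (simp add: injective_object_def)
  obtain M a b where r: "realised B \<theta> I M X a b" using ex_realised[OF X IO t] .
  then have "conflation B I M X a b" by (auto simp: conflation_def)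
  then obtain d where d: "d \<in> mor B M I" "d \<cdot> a = Ident B I"
    using I Ident_mor[OF IO] unfolding injective_object_def by blast
  have "\<theta> = push B X (d \<cdot> a) \<theta>" using d push_Ident[OF X IO t] by simp
  also have "\<dots> = push B X d (push B X a \<theta>)" using push_Comp[OF realised_mor(2)[OF r] d(1) t X] .
  finally show ?thesis using push_inflation[OF r] push_ezero[OF d(1) X] by simp
qed

end

section \<open>The heart of nested cotorsion pairs\<close>

text \<open>When the locale is interpreted in the opposite category, \<open>injectives\<close> comes
  from the enough projectives of the original one.\<close>

locale nested_twin_cotorsion_pair = extriangulated_category B
  for B :: "('o, 'm, 'e, 'x) extri_cat_scheme" (structure) +
  fixes \<S> \<T> \<U> \<V> :: "'o set"
  assumes twin: "twin_cotorsion_pair B \<S> \<T> \<U> \<V>"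
    and T_U: "\<T> \<subseteq> \<U>"
    and injectives: "enough_injectives B"
begin

abbreviation \<H> where "\<H> \<equiv> Cone B \<V> \<T>"

lemma ST: "cotorsion_pair B \<S> \<T>" and UV: "cotorsion_pair B \<U> \<V>"
  using twin by (auto simp: twin_cotorsion_pair_def)

lemma S_V_ext: "S \<in> \<S> \<Longrightarrow> V \<in> \<V> \<Longrightarrow> \<theta> \<in> carrier (Ext B S V) \<Longrightarrow> \<theta> = ezero S V"
  using twin by (auto simp: twin_cotorsion_pair_def Ext_vanishes_def)

lemmas S_T_ext = cotorsion_pair_ext[OF ST] and U_V_ext = cotorsion_pair_ext[OF UV]

lemma T_V_ext: "T \<in> \<T> \<Longrightarrow> V \<in> \<V> \<Longrightarrow> \<theta> \<in> carrier (Ext B T V) \<Longrightarrow> \<theta> = ezero T V"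
  using U_V_ext T_U by blast

lemma S_Obj: "S \<in> \<S> \<Longrightarrow> S \<in> Obj B" and T_Obj: "T \<in> \<T> \<Longrightarrow> T \<in> Obj B"
  and U_Obj: "U \<in> \<U> \<Longrightarrow> U \<in> Obj B" and V_Obj: "V \<in> \<V> \<Longrightarrow> V \<in> Obj B"
  using cotorsion_pair_Obj[OF ST] cotorsion_pair_Obj[OF UV] by blast+

lemma V_T: "V \<in> \<V> \<Longrightarrow> V \<in> \<T>"
  using cotorsion_pair_rightI[OF ST V_Obj S_V_ext] by blast

section \<open>The ideal of morphisms through \<open>\<T>\<close> and its detection by extension
  classes\<close>

abbreviation J where "J \<equiv> factor_ideal B \<T>"

lemma idealI: "T \<in> \<T> \<Longrightarrow> u \<in> mor B X T \<Longrightarrow> v \<in> mor B T Y \<Longrightarrow> v \<cdot> u \<in> J X Y"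
  by (auto simp: factor_ideal_def)

lemma idealE:
  assumes "f \<in> J X Y"
  obtains T u v where "T \<in> \<T>" "u \<in> mor B X T" "v \<in> mor B T Y" "f = v \<cdot> u"
  using assms by (auto simp: factor_ideal_def)

text \<open>The pushout passes through \<open>\<E>(S, T) = 0\<close>.\<close>

lemma ideal_push:
  assumes f: "f \<in> J X Y" and S: "S \<in> \<S>" and t: "\<theta> \<in> carrier (Ext B S X)"
  shows "push B S f \<theta> = ezero S Y"
proof -
  obtain T u v where *: "T \<in> \<T>" "u \<in> mor B X T" "v \<in> mor B T Y" "f = v \<cdot> u" using f by (rule idealE)
  have "push B S u \<theta> = ezero S T" using S_T_ext[OF S *(1)] push_closed[OF *(2) t S_Obj[OF S]] by blast
  then show ?thesis using push_Comp[OF *(2,3) t S_Obj[OF S]] push_ezero[OF *(3) S_Obj[OF S]] * by simp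
qed

text \<open>Here the nesting enters: \<open>\<T> \<subseteq> \<U>\<close> gives
  \<open>\<E>(T, V) = 0\<close>, through which the pullback passes.\<close>

lemma ideal_pull:
  assumes f: "f \<in> J X Y" and V: "V \<in> \<V>" and t: "\<theta> \<in> carrier (Ext B Y V)"
  shows "pull B V f \<theta> = ezero X V"
proof -
  obtain T u v where *: "T \<in> \<T>" "u \<in> mor B X T" "v \<in> mor B T Y" "f = v \<cdot> u" using f by (rule idealE)
  have "pull B V v \<theta> = ezero T V" using T_V_ext[OF *(1) V] pull_closed[OF *(3) t V_Obj[OF V]] by blast
  then show ?thesis using pull_Comp[OF *(3,2) t V_Obj[OF V]] pull_ezero[OF *(2) V_Obj[OF V]] * by simp
qed

text \<open>Conversely to \<open>ideal_push\<close>, the class of one approximation suffices: when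
  it is pushed to zero, \<open>f\<close> extends over \<open>X \<rightarrow> T\<close>.\<close>

lemma idealI_push:
  assumes r: "realised B \<delta> X T S x t" and T: "T \<in> \<T>" and f: "f \<in> mor B X Y"
    and z: "push B S f \<delta> = ezero S Y"
  shows "f \<in> J X Y"
proof -
  obtain g where "g \<in> mor B T Y" "g \<cdot> x = f" using inflation_extend[OF r f z] .
  then show ?thesis using idealI[OF T realised_mor(2)[OF r]] by blast
qed

lemma idealI_pull:
  assumes r: "realised B \<delta> V T Y v t" and T: "T \<in> \<T>" and f: "f \<in> mor B X Y"
    and z: "pull B V f \<delta> = ezero X V"
  shows "f \<in> J X Y"
proof -
  obtain g where "g \<in> mor B X T" "t \<cdot> g = f" using deflation_lift[OF r f z] .
  then show ?thesis using idealI[OF T _ realised_mor(3)[OF r]] by blast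
qed

text \<open>For an approximation \<open>X \<rightarrow> T \<rightarrow> S\<close> with class
  \<open>\<delta>\<close>, the ideal is the kernel of the additive map that sends \<open>f\<close>
  to \<open>push B S f \<delta>\<close>.\<close>

lemma subgroup_ideal:
  assumes X: "X \<in> Obj B" and Y: "Y \<in> Obj B"
  shows "subgroup (J X Y) (Hom B X Y)"
proof -
  interpret group "Hom B X Y" using Hom_group[OF X Y] .
  obtain T S \<delta> x t where T: "T \<in> \<T>" "S \<in> \<S>" and r: "realised B \<delta> X T S x t"
    by (rule cotorsion_pair_right_approximation[OF ST X])
  have S: "S \<in> Obj B" and d: "\<delta> \<in> carrier (Ext B S X)" using realised_mor[OF r] by auto
  interpret E: group "Ext B S Y" using Ext_group[OF S Y] .
  have m: "f \<in> mor B X Y" if "f \<in> J X Y" for f using that Comp_mor by (auto elim: idealE)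
  have z: "push B S f \<delta> = ezero S Y" if "f \<in> J X Y" for f using ideal_push[OF that T(2) d] .
  note mz = zmor_mor[OF X Y]
  show ?thesis
  proof (rule subgroupI)
    show "J X Y \<subseteq> carrier (Hom B X Y)" using m mor_carrier by blast
    have "zmor X Y \<in> J X Y" using idealI_push[OF r T(1) mz] push_zmor[OF d X Y S] .
    then show "J X Y \<noteq> {}" by blast
  next
    fix f assume f: "f \<in> J X Y"
    have i: "inv\<^bsub>Hom B X Y\<^esub> f \<in> mor B X Y" using minv_mor m f by blast
    have "push B S f \<delta> \<otimes>\<^bsub>Ext B S Y\<^esub> push B S (inv\<^bsub>Hom B X Y\<^esub> f) \<delta> = ezero S Y"
      using push_add[OF S m[OF f] i d] push_zmor[OF d X Y S] mor_carrier[OF m[OF f]] by simp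
    then have "push B S (inv\<^bsub>Hom B X Y\<^esub> f) \<delta> = ezero S Y"
      using z[OF f] push_closed[OF i d S] by simp
    then show "inv\<^bsub>Hom B X Y\<^esub> f \<in> J X Y" using idealI_push[OF r T(1) i] by blast
  next
    fix f g assume f: "f \<in> J X Y" "g \<in> J X Y"
    have "push B S (madd X Y f g) \<delta> = ezero S Y"
      using push_add[OF S m[OF f(1)] m[OF f(2)] d] z[OF f(1)] z[OF f(2)] by simp
    then show "madd X Y f g \<in> J X Y"
      using idealI_push[OF r T(1) madd_mor[OF m[OF f(1)] m[OF f(2)]]] by blast
  qed
qed

lemma H_Obj: "X \<in> \<H> \<Longrightarrow> X \<in> Obj B"
  by (simp add: Cone_def)

text \<open>Sums in the ideal are also formed for morphisms whose source or target is not, or not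
  yet known to be, in the heart.\<close>

sublocale all: quotient_ideal B "Obj B" \<T>
  by (intro quotient_ideal.intro quotient_ideal_axioms.intro preadditive_category_axioms)
    (auto intro: subgroup_ideal)

sublocale heart: quotient_ideal B \<H> \<T>
  by (intro quotient_ideal.intro quotient_ideal_axioms.intro preadditive_category_axioms)
    (auto intro: subgroup_ideal dest: H_Obj)

abbreviation "Q \<equiv> ideal_quotient B \<H> \<T>"

abbreviation "cls \<equiv> heart.cls"

lemma heart_presentation:
  assumes "Y \<in> \<H>"
  obtains \<delta> V T v t where "V \<in> \<V>" "T \<in> \<T>" "realised B \<delta> V T Y v t"
  using assms by (auto simp: Cone_def conflation_def)

lemma presentation_heart:
  "realised B \<delta> V T Y v t \<Longrightarrow> V \<in> \<V> \<Longrightarrow> T \<in> \<T> \<Longrightarrow> Y \<in> \<H>"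
  using realised_mor(6) unfolding Cone_def conflation_def by blast

text \<open>\<open>\<E>(U, V) = 0\<close> kills the pullback of a presentation of \<open>Y\<close>,
  so \<open>f\<close> lifts to \<open>T\<close>. \<open>heartI\<close> is the converse.\<close>

lemma U_to_heart:
  assumes U: "U \<in> \<U>" and Y: "Y \<in> \<H>" and f: "f \<in> mor B U Y"
  shows "f \<in> J U Y"
proof -
  obtain \<delta> V T v t where *: "V \<in> \<V>" "T \<in> \<T>" and r: "realised B \<delta> V T Y v t"
    using Y by (rule heart_presentation)
  have "pull B V f \<delta> = ezero U V"
    using U_V_ext[OF U *(1)] pull_closed[OF f realised_mor(1)[OF r] V_Obj[OF *(1)]] by blast
  then show ?thesis using idealI_pull[OF r *(2) f] by blast
qed

text \<open>If \<open>k \<cdot> u\<close> passes through \<open>t : T \<rightarrow> Y\<close>, a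
  lift of \<open>t\<close> to \<open>K\<close> corrects \<open>u\<close> by a morphism of the ideal;
  the difference is killed by \<open>k\<close>, so it comes from the fibre \<open>A\<close>, where
  \<open>fiber\<close> applies. The conditions are verified for fibres in \<open>\<V>\<close>, and
  in \<open>heart_cokernel_lift\<close> for a fibre in the heart and a source in
  \<open>\<U>\<close>.\<close>

lemma ideal_lift:
  assumes r: "realised B \<delta> A K Y a k" and u: "u \<in> mor B X K" and ku: "k \<cdot> u \<in> J X Y"
    and lift: "\<And>T t. T \<in> \<T> \<Longrightarrow> t \<in> mor B T Y \<Longrightarrow> pull B A t \<delta> = ezero T A"
    and fiber: "\<And>w. w \<in> mor B X A \<Longrightarrow> a \<cdot> w \<in> J X K"
  shows "u \<in> J X K"
proof -
  note m = realised_mor[OF r]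
  obtain T b t where T: "T \<in> \<T>" "b \<in> mor B X T" "t \<in> mor B T Y" "k \<cdot> u = t \<cdot> b"
    using ku by (rule idealE)
  obtain s where s: "s \<in> mor B T K" "k \<cdot> s = t" using deflation_lift[OF r T(3) lift[OF T(1,3)]] .
  have sb: "s \<cdot> b \<in> mor B X K" using Comp_mor T s by blast
  have "k \<cdot> (s \<cdot> b) = k \<cdot> u" using Comp_assoc[OF T(2) s(1) m(3)] s T by simp
  then have "k \<cdot> mdiff X K u (s \<cdot> b) = zmor X Y"
    using Comp_mdiff[OF u sb m(3)] mdiff_eq_zmor_iff[OF Comp_mor[OF u m(3)] Comp_mor[OF u m(3)]] by simp
  then obtain w where w: "w \<in> mor B X A" "a \<cdot> w = mdiff X K u (s \<cdot> b)"
    using inflation_factor[OF r mdiff_mor[OF u sb]] by blast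
  then have "mdiff X K u (s \<cdot> b) \<in> J X K" using fiber by metis
  moreover have "s \<cdot> b \<in> J X K" using idealI T s by blast
  ultimately show ?thesis
    using all.J_madd mdiff_madd[OF u sb] mor_source[OF u] mor_target[OF u] by metis
qed

text \<open>A deflation with fibre in \<open>\<V>\<close> is monic modulo the ideal:
  \<open>\<E>(T, V) = 0\<close> supplies the lifts, and morphisms from the fibre pass through
  \<open>V\<close>, which lies in \<open>\<T>\<close>.\<close>

lemma V_fiber_ideal:
  assumes r: "realised B \<delta> V K Y v k" and V: "V \<in> \<V>" and u: "u \<in> mor B X K" and ku: "k \<cdot> u \<in> J X Y"
  shows "u \<in> J X K"
proof (rule ideal_lift[OF r u ku])
  fix T t assume "T \<in> \<T>" "t \<in> mor B T Y"
  then show "pull B V t \<delta> = ezero T V"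
    using T_V_ext[OF _ V] pull_closed[OF _ realised_mor(1)[OF r] V_Obj[OF V]] by blast
next
  show "v \<cdot> w \<in> J X K" if "w \<in> mor B X V" for w
    using idealI[OF V_T[OF V] that realised_mor(2)[OF r]] .
qed

text \<open>The identity acts as zero on \<open>\<E>(S, X)\<close>, so \<open>X\<close> is
  orthogonal to \<open>\<S>\<close>.\<close>

lemma T_if_Ident_ideal:
  assumes X: "X \<in> Obj B" and "Ident B X \<in> J X X" shows "X \<in> \<T>"
proof (rule cotorsion_pair_rightI[OF ST X])
  fix S \<theta> assume "S \<in> \<S>" "\<theta> \<in> carrier (Ext B S X)"
  then show "\<theta> = ezero S X" using ideal_push[OF assms(2)] push_Ident[OF S_Obj X] by metis
qed

text \<open>
  In a conflation \<open>V \<rightarrow> U \<rightarrow> P\<close> the identity of \<open>U\<close> is in the ideal as soon as \<open>U \<rightarrow> P\<close> is, because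
  \<open>\<V> \<subseteq> \<T>\<close>.
\<close>

lemma heartI:
  assumes P: "P \<in> Obj B" and *: "\<And>U u. U \<in> \<U> \<Longrightarrow> u \<in> mor B U P \<Longrightarrow> u \<in> J U P"
  shows "P \<in> \<H>"
proof -
  obtain V U \<delta> v u where V: "V \<in> \<V>" and U: "U \<in> \<U>" and r: "realised B \<delta> V U P v u"
    by (rule cotorsion_pair_left_approximation[OF UV P])
  have u: "u \<in> mor B U P" using realised_mor[OF r] by blast
  have "Ident B U \<in> J U U"
    using V_fiber_ideal[OF r V Ident_mor[OF U_Obj[OF U]]] *[OF U u] Comp_Ident[OF u] by simp
  then have "U \<in> \<T>" using T_if_Ident_ideal U_Obj[OF U] by blast
  then show ?thesis using presentation_heart[OF r V] by blast
qed

section \<open>Kernels, cokernels and factorisations in the heart\<close>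

lemma V_fiber_heart:
  assumes r: "realised B \<delta> V K Y v k" and V: "V \<in> \<V>" and Y: "Y \<in> \<H>"
  shows "K \<in> \<H>"
proof (rule heartI)
  show "K \<in> Obj B" using realised_mor[OF r] by blast
  fix U u assume u: "U \<in> \<U>" "u \<in> mor B U K"
  show "u \<in> J U K"
    using V_fiber_ideal[OF r V u(2)] U_to_heart[OF u(1) Y Comp_mor[OF u(2) realised_mor(3)[OF r]]] .
qed

text \<open>\<open>f \<cdot> g\<close> lies in the ideal exactly if \<open>g\<close> pulls
  \<open>pull B V f \<delta>\<close> back to zero, that is, if \<open>g\<close> lifts along the
  deflation \<open>k\<close>. The lift exists already in \<open>B\<close> and is unique modulo the
  ideal because the fibre is in \<open>\<V>\<close>.\<close>

lemma heart_kernel: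
  assumes X: "X \<in> \<H>" and Y: "Y \<in> \<H>" and f: "f \<in> mor B X Y"
    and r: "realised B \<delta> V T Y v t" and V: "V \<in> \<V>" and T: "T \<in> \<T>"
    and k: "realised B (pull B V f \<delta>) V K X w k"
  shows "kernel_of Q X Y (cls X Y f) K (cls K X k)"
proof (rule heart.kernel_clsI[OF X Y V_fiber_heart[OF k V X] f])
  note VO = V_Obj[OF V] and d = realised_mor(1)[OF r]
  have K: "K \<in> \<H>" using V_fiber_heart[OF k V X] .
  show km: "k \<in> mor B K X" using realised_mor[OF k] by blast
  have "pull B V (f \<cdot> k) \<delta> = ezero K V" using pull_Comp[OF f km d VO] pull_deflation[OF k] by simp
  then show "f \<cdot> k \<in> J K Y" using idealI_pull[OF r T Comp_mor[OF km f]] by blast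
  show "monomorphism Q K X (cls K X k)"
    using heart.monomorphism_cls_iff[OF K X km] V_fiber_ideal[OF k V] by blast
  fix Z g assume g: "Z \<in> \<H>" "g \<in> mor B Z X" "f \<cdot> g \<in> J Z Y"
  have "pull B V g (pull B V f \<delta>) = ezero Z V"
    using pull_Comp[OF f g(2) d VO] ideal_pull[OF g(3) V d] by simp
  then obtain u where "u \<in> mor B Z K" "k \<cdot> u = g" using deflation_lift[OF k g(2)] by blast
  then show "\<exists>u\<in>mor B Z K. cls Z X (k \<cdot> u) = cls Z X g" by blast
qed

text \<open>If \<open>h \<cdot> q\<close> lies in the ideal, the class that detects \<open>h\<close>
  dies on \<open>Y\<close>, so it comes from \<open>\<E>(S, V) = 0\<close>.\<close>

lemma S_cone_epimorphism:
  assumes r: "realised B \<omega> Y M S q s" and S: "S \<in> \<S>" and Y: "Y \<in> \<H>" and M: "M \<in> \<H>"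
  shows "epimorphism Q Y M (cls Y M q)"
  unfolding heart.epimorphism_cls_iff[OF Y M realised_mor(2)[OF r]]
proof (intro ballI impI)
  note m = realised_mor[OF r]
  fix Z h assume Z: "Z \<in> \<H>" and h: "h \<in> mor B M Z" "h \<cdot> q \<in> J Y Z"
  obtain \<delta> V T v t where V: "V \<in> \<V>" "T \<in> \<T>" and d: "realised B \<delta> V T Z v t"
    using Z by (rule heart_presentation)
  note dc = realised_mor(1)[OF d] and VO = V_Obj[OF V(1)]
  have "pull B V q (pull B V h \<delta>) = ezero Y V"
    using pull_Comp[OF h(1) m(2) dc VO] ideal_pull[OF h(2) V(1) dc] by simp
  then obtain \<phi> where p: "\<phi> \<in> carrier (Ext B S V)" "pull B V h \<delta> = pull B V s \<phi>"
    using ext_exact_pull[OF r pull_closed[OF h(1) dc VO] VO] by blast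
  then have "pull B V h \<delta> = ezero M V" using S_V_ext[OF S V(1)] pull_ezero[OF m(3) VO] by metis
  then show "h \<in> J M Z" using idealI_pull[OF d V(2) h(1)] by blast
qed

text \<open>
  Nakaoka's reflection \<open>g : C \<rightarrow> C\<^sup>+\<close> of \<open>\<B>\<^sup>-\<close>, here all of \<open>\<B>\<close>, into the heart; the vanishing pushouts say
  that morphisms to the heart extend along \<open>g\<close>.
\<close>

lemma heart_reflection:
  assumes C: "C \<in> Obj B"
  obtains V U T S Cp \<epsilon> \<epsilon>' \<sigma> v u v' t g e where
    "V \<in> \<V>" "U \<in> \<U>" "T \<in> \<T>" "S \<in> \<S>" "Cp \<in> \<H>"
    "realised B \<epsilon> V U C v u" "realised B \<epsilon>' V T Cp v' t" "realised B \<sigma> C Cp S g e"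
    "pull B V g \<epsilon>' = \<epsilon>" "\<And>Z h. Z \<in> \<H> \<Longrightarrow> h \<in> mor B C Z \<Longrightarrow> push B S h \<sigma> = ezero S Z"
proof -
  obtain V U \<epsilon> v u where V: "V \<in> \<V>" and U: "U \<in> \<U>" and r: "realised B \<epsilon> V U C v u"
    by (rule cotorsion_pair_left_approximation[OF UV C])
  obtain T S \<zeta> m n where T: "T \<in> \<T>" and S: "S \<in> \<S>" and z: "realised B \<zeta> U T S m n"
    by (rule cotorsion_pair_right_approximation[OF ST U_Obj[OF U]])
  \<comment> \<open>Composing \<open>V \<rightarrow> U\<close> with
    \<open>U \<rightarrow> T\<close>, (ET4) turns the approximation of \<open>C\<close> by
    \<open>U\<close> into a presentation of \<open>Cp\<close>, with an inflation
    \<open>g : C \<rightarrow> Cp\<close> of cone \<open>S\<close>.\<close>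
  obtain Cp \<epsilon>' c c' g e where E: "g \<in> mor B C Cp" "e \<in> mor B Cp S" "realised B \<epsilon>' V T Cp c c'"
    "realised B (push B S u \<zeta>) C Cp S g e" "pull B V g \<epsilon>' = \<epsilon>"
    using ET4[OF r z] by blast
  \<comment> \<open>The class of \<open>g\<close> is itself pushed along \<open>u\<close>, and
    \<open>h \<cdot> u\<close>, going from \<open>\<U>\<close> to the heart, lies in the
    ideal.\<close>
  have push_h: "push B S h (push B S u \<zeta>) = ezero S Z" if "Z \<in> \<H>" "h \<in> mor B C Z" for Z h
  proof -
    have um: "u \<in> mor B U C" and zc: "\<zeta> \<in> carrier (Ext B S U)" using realised_mor[OF r] realised_mor[OF z] by auto
    show ?thesis
      using push_Comp[OF um that(2) zc S_Obj[OF S]]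
        ideal_push[OF U_to_heart[OF U that(1) Comp_mor[OF um that(2)]] S zc] by simp
  qed
  show ?thesis using that[OF V U T S presentation_heart[OF E(3) V T] r E(3-5) push_h] .
qed

text \<open>\<open>\<S>\<close> is the left orthogonal of \<open>\<T>\<close>; a class on
  \<open>E\<close> dies on \<open>S\<close>, so it comes from
  \<open>\<E>(S', T) = 0\<close>.\<close>

lemma S_extension_closed:
  assumes r: "realised B \<delta> S E S' a b" and S: "S \<in> \<S>" "S' \<in> \<S>"
  shows "E \<in> \<S>"
proof (rule cotorsion_pair_leftI[OF ST])
  note m = realised_mor[OF r]
  show "E \<in> Obj B" by fact
  fix T \<theta> assume T: "T \<in> \<T>" and t: "\<theta> \<in> carrier (Ext B E T)"
  note TO = T_Obj[OF T]
  have "pull B T a \<theta> = ezero S T" using S_T_ext[OF S(1) T] pull_closed[OF m(2) t TO] by blast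
  then obtain \<phi> where "\<phi> \<in> carrier (Ext B S' T)" "\<theta> = pull B T b \<phi>" using ext_exact_pull[OF r t TO] by blast
  then show "\<theta> = ezero E T" using S_T_ext[OF S(2) T] pull_ezero[OF m(3) TO] by metis
qed

text \<open>Both claims rest on one construction: the second factor of \<open>f\<close> is the
  kernel of its cokernel, and its properties are read off from the conflations that produced that
  cokernel.\<close>

lemma heart_cokernel_factorisation:
  assumes X: "X \<in> \<H>" and Y: "Y \<in> \<H>" and f: "f \<in> mor B X Y"
  shows "\<exists>M S \<omega> q s. M \<in> \<H> \<and> S \<in> \<S> \<and> realised B \<omega> Y M S q s \<and>
      cokernel_of Q X Y (cls X Y f) M (cls Y M q)"
    and "\<exists>K j k. epimorphism Q X K j \<and> is_kernel Q K Y k \<and> cls X Y f = k \<cdot>\<^bsub>Q\<^esub> j"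
proof -
  have XO: "X \<in> Obj B" using X H_Obj by blast
  obtain T0 S0 \<delta> x y where T0: "T0 \<in> \<T>" and S0: "S0 \<in> \<S>" and r: "realised B \<delta> X T0 S0 x y"
    by (rule cotorsion_pair_right_approximation[OF ST XO])
  note S0O = S_Obj[OF S0] and d = realised_mor(1)[OF r]
  obtain C c c' where C: "realised B (push B S0 f \<delta>) Y C S0 c c'"
    using ex_realised[OF S0O mor_target[OF f] push_closed[OF f d S0O]] .
  note Cm = realised_mor[OF C]
  obtain V U T S M \<epsilon> \<epsilon>' \<sigma> v u v' t g e where V: "V \<in> \<V>" and U: "U \<in> \<U>" and T: "T \<in> \<T>"
    and S: "S \<in> \<S>" and M: "M \<in> \<H>" and eps: "realised B \<epsilon> V U C v u"
    and eps': "realised B \<epsilon>' V T M v' t" and sig: "realised B \<sigma> C M S g e"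
    and pull_g: "pull B V g \<epsilon>' = \<epsilon>"
    and push_h: "\<And>Z h. Z \<in> \<H> \<Longrightarrow> h \<in> mor B C Z \<Longrightarrow> push B S h \<sigma> = ezero S Z"
    by (rule heart_reflection[OF Cm(5)]) blast
  note VO = V_Obj[OF V] and eps'c = realised_mor(1)[OF eps']
  have g: "g \<in> mor B C M" using realised_mor[OF sig] by blast
  let ?q = "g \<cdot> c"
  have q: "?q \<in> mor B Y M" using Comp_mor g Cm by blast
  \<comment> \<open>By (ET4) the cone of \<open>?q\<close> is an extension of \<open>S\<close> by
    \<open>S0\<close>, hence in \<open>\<S>\<close>.\<close>
  obtain E \<omega> s d2 e2 where om: "realised B \<omega> Y M E ?q s" "realised B (push B S c' \<sigma>) S0 E S d2 e2"
    using ET4[OF C sig] by blast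
  have E: "E \<in> \<S>" using S_extension_closed[OF om(2) S0 S] .
  have "push B S0 (c \<cdot> f) \<delta> = ezero S0 C" using push_Comp[OF f Cm(2) d S0O] push_inflation[OF C] by simp
  then have "c \<cdot> f \<in> J X C" using idealI_push[OF r T0 Comp_mor[OF f Cm(2)]] by blast
  then have qf: "?q \<cdot> f \<in> J X M" using heart.J_Comp_left[OF _ g] Comp_assoc[OF f Cm(2) g] by simp
  have "cokernel_of Q X Y (cls X Y f) M (cls Y M ?q)"
  proof (rule heart.cokernel_clsI[OF X Y M f q qf S_cone_epimorphism[OF om(1) E Y M]])
    fix Z h assume Z: "Z \<in> \<H>" and h: "h \<in> mor B Y Z" "h \<cdot> f \<in> J X Z"
    have "push B S0 h (push B S0 f \<delta>) = ezero S0 Z"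
      using push_Comp[OF f h(1) d S0O] ideal_push[OF h(2) S0 d] by simp
    then obtain h1 where h1: "h1 \<in> mor B C Z" "h1 \<cdot> c = h" using inflation_extend[OF C h(1)] by blast
    obtain h2 where h2: "h2 \<in> mor B M Z" "h2 \<cdot> g = h1"
      using inflation_extend[OF sig h1(1) push_h[OF Z h1(1)]] .
    have "h2 \<cdot> ?q = h" using Comp_assoc[OF Cm(2) g h2(1)] h1 h2 by simp
    then show "\<exists>u\<in>mor B M Z. cls Y Z (u \<cdot> ?q) = cls Y Z h" using h2 by blast
  qed
  then show "\<exists>M S \<omega> q s. M \<in> \<H> \<and> S \<in> \<S> \<and> realised B \<omega> Y M S q s \<and>
      cokernel_of Q X Y (cls X Y f) M (cls Y M q)" using M E om by blast
  \<comment> \<open>The dual of (ET4) gives \<open>K\<close> two roles: it maps to \<open>Y\<close>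
    with fibre \<open>V\<close>, which makes it the kernel of \<open>?q\<close>, and it is the fibre
    of \<open>U \<rightarrow> S0\<close>. The class \<open>\<kappa>\<close> of the latter, pushed
    along \<open>k\<close>, is \<open>\<delta>\<close> pushed along \<open>f\<close>.\<close>
  obtain K \<kappa> z z' k w where K: "k \<in> mor B K Y" "w \<in> mor B V K" "realised B \<kappa> K U S0 z z'"
    "realised B (pull B V c \<epsilon>) V K Y w k" "push B S0 k \<kappa> = push B S0 f \<delta>"
    using ET4_op[OF C eps] by blast
  have "pull B V ?q \<epsilon>' = pull B V c \<epsilon>" using pull_Comp[OF g Cm(2) eps'c VO] pull_g by simp
  then have k: "realised B (pull B V ?q \<epsilon>') V K Y w k" using K(4) by simp
  have KH: "K \<in> \<H>" using V_fiber_heart[OF k V Y] .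
  have kernel: "kernel_of Q Y M (cls Y M ?q) K (cls K Y k)" using heart_kernel[OF Y M q eps' V T k] .
  have "pull B V f (pull B V ?q \<epsilon>') = ezero X V"
    using pull_Comp[OF q f eps'c VO] ideal_pull[OF qf V eps'c] by simp
  then obtain j where j: "j \<in> mor B X K" "k \<cdot> j = f" using deflation_lift[OF k f] by blast
  have "push B S0 k (push B S0 j \<delta>) = push B S0 k \<kappa>" using push_Comp[OF j(1) K(1) d S0O] j K(5) by simp
  \<comment> \<open>A class killed by \<open>k\<close> comes from \<open>\<E>(S0, V) = 0\<close>, so
    pushing along \<open>k\<close> is injective; this forces \<open>j\<close> to push
    \<open>\<delta>\<close> to \<open>\<kappa>\<close>.\<close>
  moreover have "\<theta> = ezero S0 K" if th: "\<theta> \<in> carrier (Ext B S0 K)" "push B S0 k \<theta> = ezero S0 Y" for \<theta>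
  proof -
    obtain \<phi> where "\<phi> \<in> carrier (Ext B S0 V)" "\<theta> = push B S0 w \<phi>"
      using ext_exact_push[OF k th(1) S0O th(2)] .
    then show ?thesis using S_V_ext[OF S0 V] push_ezero[OF K(2) S0O] by metis
  qed
  ultimately have jk: "push B S0 j \<delta> = \<kappa>"
    using push_kernel_injective[OF K(1) S0O _ push_closed[OF j(1) d S0O] realised_mor(1)[OF K(3)]] by blast
  have "epimorphism Q X K (cls X K j)"
    unfolding heart.epimorphism_cls_iff[OF X KH j(1)]
  proof (intro ballI impI)
    fix Z h assume Z: "Z \<in> \<H>" and h: "h \<in> mor B K Z" "h \<cdot> j \<in> J X Z"
    have "push B S0 h \<kappa> = ezero S0 Z"
      using push_Comp[OF j(1) h(1) d S0O] ideal_push[OF h(2) S0 d] jk by simp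
    \<comment> \<open>\<open>h\<close> extends over \<open>K \<rightarrow> U\<close>, and every
      morphism from \<open>\<U>\<close> to the heart is in the ideal.\<close>
    then obtain l where l: "l \<in> mor B U Z" "l \<cdot> z = h" using inflation_extend[OF K(3) h(1)] by blast
    then show "h \<in> J K Z"
      using heart.J_Comp_right[OF U_to_heart[OF U Z l(1)] realised_mor(2)[OF K(3)]] by simp
  qed
  moreover have "is_kernel Q K Y (cls K Y k)" using kernel by (auto simp: is_kernel_def)
  moreover have "cls X Y f = cls K Y k \<cdot>\<^bsub>Q\<^esub> cls X K j" using heart.cls_Comp[OF X KH Y j(1) K(1)] j by simp
  ultimately show "\<exists>K j k. epimorphism Q X K j \<and> is_kernel Q K Y k \<and> cls X Y f = k \<cdot>\<^bsub>Q\<^esub> j" by blast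
qed

text \<open>Injectives lie in \<open>\<V>\<close>, so embedding \<open>V\<close> into an injective
  \<open>I\<close> gives a cone \<open>A\<close> in the heart. As \<open>\<phi>\<close> dies in
  \<open>\<E>(Z, I)\<close>, it is the pullback of \<open>\<rho>\<close> along some
  \<open>h : Z \<rightarrow> A\<close>; cancelling the epimorphism puts \<open>h\<close> into the
  ideal, whence \<open>\<phi>\<close> is zero.\<close>

lemma epimorphism_pull_injective:
  assumes X: "X \<in> \<H>" and Z: "Z \<in> \<H>" and f: "f \<in> mor B X Z" and epi: "epimorphism Q X Z (cls X Z f)"
    and V: "V \<in> \<V>" and p: "\<phi> \<in> carrier (Ext B Z V)" "pull B V f \<phi> = ezero X V"
  shows "\<phi> = ezero Z V"
proof -
  note VO = V_Obj[OF V] and ZO = H_Obj[OF Z]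
  obtain I A a b \<rho> where r: "realised B \<rho> V I A a b" and I: "injective_object B I"
    using injectives VO by (auto simp: enough_injectives_def conflation_def)
  note m = realised_mor[OF r]
  have "I \<in> \<V>" using cotorsion_pair_rightI[OF UV m(5) injective_object_ext[OF I _ U_Obj]] .
  then have IT: "I \<in> \<T>" using V_T by blast
  have A: "A \<in> \<H>" using presentation_heart[OF r V IT] .
  have "push B Z a \<phi> = ezero Z I" using injective_object_ext[OF I push_closed[OF m(2) p(1) ZO] ZO] .
  then obtain h where h: "h \<in> mor B Z A" "\<phi> = pull B V h \<rho>" using ext_eq_pull[OF r p(1) ZO] by blast
  have "pull B V (h \<cdot> f) \<rho> = ezero X V" using pull_Comp[OF h(1) f m(1) VO] h p by simp
  then have "h \<cdot> f \<in> J X A" using idealI_pull[OF r IT Comp_mor[OF f h(1)]] by blast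
  then have "h \<in> J Z A" using epi heart.epimorphism_cls_iff[OF X Z f] A h by blast
  then show ?thesis using ideal_pull[OF _ V m(1)] h by simp
qed

section \<open>Lifting along epimorphisms and cokernels of the heart\<close>

lemma biproduct_heart:
  assumes D: "biproduct B X Y D i j p q" and X: "X \<in> \<H>" and Y: "Y \<in> \<H>"
  shows "D \<in> \<H>"
proof (rule heartI)
  note d = biproduct_mor[OF D]
  show DO: "D \<in> Obj B" using mor_target[OF d(1)] .
  fix U u assume U: "U \<in> \<U>" and u: "u \<in> mor B U D"
  have "p \<cdot> u \<in> J U X" "q \<cdot> u \<in> J U Y"
    using U_to_heart[OF U X Comp_mor[OF u d(3)]] U_to_heart[OF U Y Comp_mor[OF u d(4)]] by auto
  then have "i \<cdot> (p \<cdot> u) \<in> J U D" "j \<cdot> (q \<cdot> u) \<in> J U D" using heart.J_Comp_left d by blast+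
  moreover have "u = madd U D (i \<cdot> (p \<cdot> u)) (j \<cdot> (q \<cdot> u))"
    using biproduct_decompose[OF D Ident_mor[OF DO] u] Ident_Comp d u by simp
  ultimately show "u \<in> J U D" using all.J_madd[OF U_Obj[OF U] DO] by metis
qed

text \<open>\<open>P\<close> is the kernel in the heart of \<open>(f, -g)\<close>. The class on
  \<open>Y\<close> that detects \<open>h\<close> dies on \<open>P\<close>, so by exactness its
  pullback to \<open>D\<close> is the pullback of a class \<open>?ph\<close> on \<open>Z\<close>;
  \<open>?ph\<close> restricts to zero on \<open>X\<close>, and
  \<open>epimorphism_pull_injective\<close> kills it.\<close>

lemma heart_epi_lift:
  assumes X: "X \<in> \<H>" and Y: "Y \<in> \<H>" and Z: "Z \<in> \<H>" and f: "f \<in> mor B X Z" and g: "g \<in> mor B Y Z"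
    and epi: "epimorphism Q X Z (cls X Z f)"
  shows "\<exists>P p q. P \<in> \<H> \<and> p \<in> mor B P X \<and> q \<in> mor B P Y \<and> cls P Z (f \<cdot> p) = cls P Z (g \<cdot> q) \<and>
    epimorphism Q P Y (cls P Y q)"
proof -
  obtain D i j p q where D: "biproduct B X Y D i j p q" using ex_biproduct H_Obj X Y by blast
  note d = biproduct_mor[OF D]
  have DH: "D \<in> \<H>" using biproduct_heart[OF D X Y] .
  have fp: "f \<cdot> p \<in> mor B D Z" and gq: "g \<cdot> q \<in> mor B D Z" using Comp_mor d f g by blast+
  let ?m = "mdiff D Z (f \<cdot> p) (g \<cdot> q)"
  have m: "?m \<in> mor B D Z" using mdiff_mor[OF fp gq] .
  have mi: "?m \<cdot> i = f"
    using mdiff_Comp[OF d(1) fp gq] Comp_assoc[OF d(1,3) f] Comp_assoc[OF d(1,4) g] d(5,7)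
      Comp_Ident[OF f] Comp_zmor[OF g H_Obj[OF X]] madd_zmor(3)[OF f] by simp
  obtain \<delta> V T v t where V: "V \<in> \<V>" and T: "T \<in> \<T>" and r: "realised B \<delta> V T Z v t"
    using Z by (rule heart_presentation)
  note dc = realised_mor(1)[OF r] and VO = V_Obj[OF V]
  obtain P w k where P: "realised B (pull B V ?m \<delta>) V P D w k"
    using ex_realised[OF H_Obj[OF DH] VO pull_closed[OF m dc VO]] .
  have k: "k \<in> mor B P D" using realised_mor[OF P] by blast
  have PH: "P \<in> \<H>" using V_fiber_heart[OF P V DH] .
  have pk: "p \<cdot> k \<in> mor B P X" and qk: "q \<cdot> k \<in> mor B P Y" using Comp_mor d k by blast+
  have "pull B V (?m \<cdot> k) \<delta> = ezero P V" using pull_Comp[OF m k dc VO] pull_deflation[OF P] by simp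
  then have "?m \<cdot> k \<in> J P Z" using idealI_pull[OF r T Comp_mor[OF k m]] by blast
  then have "mdiff P Z (f \<cdot> (p \<cdot> k)) (g \<cdot> (q \<cdot> k)) \<in> J P Z"
    using mdiff_Comp[OF k fp gq] Comp_assoc[OF k d(3) f] Comp_assoc[OF k d(4) g] by simp
  then have eq: "cls P Z (f \<cdot> (p \<cdot> k)) = cls P Z (g \<cdot> (q \<cdot> k))"
    using heart.cls_eq_iff[OF PH Z Comp_mor[OF pk f] Comp_mor[OF qk g]] by simp
  have "epimorphism Q P Y (cls P Y (q \<cdot> k))"
    unfolding heart.epimorphism_cls_iff[OF PH Y qk]
  proof (intro ballI impI)
    fix A h assume A: "A \<in> \<H>" and h: "h \<in> mor B Y A" "h \<cdot> (q \<cdot> k) \<in> J P A"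
    obtain \<alpha> VA TA a b where VA: "VA \<in> \<V>" and TA: "TA \<in> \<T>" and al: "realised B \<alpha> VA TA A a b"
      using A by (rule heart_presentation)
    note ac = realised_mor(1)[OF al] and VAO = V_Obj[OF VA]
    let ?th = "pull B VA h \<alpha>"
    have th: "?th \<in> carrier (Ext B Y VA)" using pull_closed[OF h(1) ac VAO] .
    note qth = pull_closed[OF d(4) th VAO]
    have "pull B VA k (pull B VA q ?th) = ezero P VA"
      using pull_Comp[OF d(4) k th VAO] pull_Comp[OF h(1) qk ac VAO] ideal_pull[OF h(2) VA ac] by simp
    then obtain \<gamma> where ga: "\<gamma> \<in> mor B V VA" "pull B VA q ?th = push B D \<gamma> (pull B V ?m \<delta>)"
      using ext_eq_push[OF P qth VAO] by blast
    let ?ph = "push B Z \<gamma> \<delta>"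
    have ph: "?ph \<in> carrier (Ext B Z VA)" using push_closed[OF ga(1) dc H_Obj[OF Z]] .
    have qm: "pull B VA q ?th = pull B VA ?m ?ph" using ga push_pull[OF ga(1) m dc] by simp
    \<comment> \<open>Restriction along \<open>i\<close> turns \<open>?m\<close> into
      \<open>f\<close> and \<open>q\<close> into zero.\<close>
    have "pull B VA f ?ph = pull B VA i (pull B VA q ?th)"
      using pull_Comp[OF m d(1) ph VAO] mi qm by simp
    also have "\<dots> = ezero X VA"
      using pull_Comp[OF d(4,1) th VAO] d(7) pull_zmor[OF th H_Obj[OF Y] H_Obj[OF X] VAO] by simp
    finally have "?ph = ezero Z VA" using epimorphism_pull_injective[OF X Z f epi VA ph] by blast
    then have "pull B VA q ?th = ezero D VA" using qm pull_ezero[OF m VAO] by simp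
    then have "pull B VA (q \<cdot> j) ?th = ezero Y VA"
      using pull_Comp[OF d(4,2) th VAO] pull_ezero[OF d(2) VAO] by simp
    then have "?th = ezero Y VA" using d(6) pull_Ident[OF H_Obj[OF Y] VAO th] by simp
    then show "h \<in> J Y A" using idealI_pull[OF al TA h(1)] by blast
  qed
  then show ?thesis using PH pk qk eq by blast
qed

text \<open>In terms of elements, \<open>P\<close> consists of pairs from \<open>Z\<close> and
  \<open>T\<close> with equal image in \<open>S\<close>; the difference of their images in
  \<open>M\<close> comes from \<open>Y\<close>, which defines \<open>p\<close>. The part from
  \<open>T\<close> lies in the ideal, so the square commutes in the heart. The fibre of
  \<open>n\<close> is \<open>K\<close>, the kernel of \<open>q\<close> in the heart, and
  \<open>n\<close> is the cokernel of \<open>a\<close>.\<close>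

lemma heart_cokernel_lift:
  assumes r: "realised B \<omega> Y M S q s" and S: "S \<in> \<S>" and Y: "Y \<in> \<H>" and M: "M \<in> \<H>"
    and Z: "Z \<in> \<H>" and g: "g \<in> mor B Z M"
  shows "\<exists>P p n. P \<in> \<H> \<and> p \<in> mor B P Y \<and> n \<in> mor B P Z \<and> cls P M (q \<cdot> p) = cls P M (g \<cdot> n) \<and>
    is_cokernel Q P Z (cls P Z n)"
proof -
  note rm = realised_mor[OF r]
  obtain \<delta> V T v t where V: "V \<in> \<V>" and T: "T \<in> \<T>" and de: "realised B \<delta> V T M v t"
    using M by (rule heart_presentation)
  note dm = realised_mor[OF de] and VO = V_Obj[OF V]
  obtain K \<kappa> c c' d e where K: "d \<in> mor B K Y" "realised B \<kappa> K T S c' c"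
    "c = s \<cdot> t" "realised B (pull B V q \<delta>) V K Y e d"
    using ET4_op[OF r de] by blast
  note km = realised_mor[OF K(2)]
  have KH: "K \<in> \<H>" using V_fiber_heart[OF K(4) V Y] .
  let ?eta = "s \<cdot> g"
  have eta: "?eta \<in> mor B Z S" using Comp_mor rm g by blast
  obtain P a n where P: "realised B (pull B K ?eta \<kappa>) K P Z a n"
    using ex_realised[OF H_Obj[OF Z] km(4) pull_closed[OF eta km(1,4)]] .
  note Pm = realised_mor[OF P]
  have PH: "P \<in> \<H>"
  proof (rule heartI[OF Pm(5)])
    fix U u assume U: "U \<in> \<U>" and u: "u \<in> mor B U P"
    show "u \<in> J U P"
    proof (rule ideal_lift[OF P u U_to_heart[OF U Z Comp_mor[OF u Pm(3)]]])
      fix T' x assume T': "T' \<in> \<T>" and x: "x \<in> mor B T' Z"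
      \<comment> \<open>The fibre \<open>K\<close> need not be in \<open>\<V>\<close>, so the
        lifting condition takes an argument: \<open>g \<cdot> x\<close> lifts to \<open>T\<close>,
        hence \<open>?eta \<cdot> x\<close> factors through the deflation \<open>c\<close>, which
        pulls \<open>\<kappa>\<close> back to zero.\<close>
      have gx: "g \<cdot> x \<in> mor B T' M" using Comp_mor x g by blast
      have "pull B V (g \<cdot> x) \<delta> = ezero T' V" using T_V_ext[OF T' V] pull_closed[OF gx dm(1) VO] by blast
      then obtain l where l: "l \<in> mor B T' T" "t \<cdot> l = g \<cdot> x" using deflation_lift[OF de gx] by blast
      have "?eta \<cdot> x = c \<cdot> l"
        using Comp_assoc[OF x g rm(3)] Comp_assoc[OF l(1) dm(3) rm(3)] l K(3) by simp
      then show "pull B K x (pull B K ?eta \<kappa>) = ezero T' K"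
        using pull_Comp[OF eta x km(1,4)] pull_Comp[OF km(3) l(1) km(1,4)] pull_deflation[OF K(2)]
          pull_ezero[OF l(1) km(4)] by simp
    next
      fix w assume w: "w \<in> mor B U K"
      show "a \<cdot> w \<in> J U P" using heart.J_Comp_left[OF U_to_heart[OF U KH w] Pm(2)] .
    qed
  qed
  have "push B Z (Ident B K) (pull B K ?eta \<kappa>) = pull B K ?eta \<kappa>" using push_Ident[OF Pm(6,4,1)] .
  then obtain \<tau> where tau: "\<tau> \<in> mor B P T" "\<tau> \<cdot> a = c' \<cdot> Ident B K" "c \<cdot> \<tau> = ?eta \<cdot> n"
    using realisation[OF P K(2) Ident_mor[OF km(4)] eta] by blast
  have tau_a: "\<tau> \<cdot> a = c'" using tau(2) Comp_Ident[OF km(2)] by simp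
  have gn: "g \<cdot> n \<in> mor B P M" and tt: "t \<cdot> \<tau> \<in> mor B P M" using Comp_mor g Pm tau dm by blast+
  have "s \<cdot> (g \<cdot> n) = s \<cdot> (t \<cdot> \<tau>)"
    using Comp_assoc[OF Pm(3) g rm(3)] Comp_assoc[OF tau(1) dm(3) rm(3)] tau(3) K(3) by simp
  then have "s \<cdot> mdiff P M (g \<cdot> n) (t \<cdot> \<tau>) = zmor P S"
    using Comp_mdiff[OF gn tt rm(3)] mdiff_eq_zmor_iff[OF Comp_mor[OF gn rm(3)] Comp_mor[OF tt rm(3)]] by simp
  then obtain p where p: "p \<in> mor B P Y" "q \<cdot> p = mdiff P M (g \<cdot> n) (t \<cdot> \<tau>)"
    using inflation_factor[OF r mdiff_mor[OF gn tt]] by blast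
  have "mdiff P M (g \<cdot> n) (q \<cdot> p) \<in> J P M" using p mdiff_mdiff[OF gn tt] idealI[OF T tau(1) dm(3)] by simp
  then have eq: "cls P M (q \<cdot> p) = cls P M (g \<cdot> n)"
    using heart.cls_eq_iff[OF PH M gn Comp_mor[OF p(1) rm(2)]] by simp
  have "cokernel_of Q K P (cls K P a) Z (cls P Z n)"
  proof (rule heart.cokernel_clsI[OF KH PH Z Pm(2,3)])
    show "n \<cdot> a \<in> J K Z" using realised_composite[OF P] heart.J_zmor[OF KH Z] by simp
    show "epimorphism Q P Z (cls P Z n)"
      unfolding heart.epimorphism_cls_iff[OF PH Z Pm(3)]
    proof (intro ballI impI)
      fix A h assume A: "A \<in> \<H>" and h: "h \<in> mor B Z A" "h \<cdot> n \<in> J P A"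
      obtain \<alpha> VA TA x y where VA: "VA \<in> \<V>" and TA: "TA \<in> \<T>" and al: "realised B \<alpha> VA TA A x y"
        using A by (rule heart_presentation)
      note ac = realised_mor(1)[OF al] and VAO = V_Obj[OF VA]
      have "pull B VA n (pull B VA h \<alpha>) = ezero P VA"
        using pull_Comp[OF h(1) Pm(3) ac VAO] ideal_pull[OF h(2) VA ac] by simp
      then obtain \<gamma> where ga: "\<gamma> \<in> mor B K VA" "pull B VA h \<alpha> = push B Z \<gamma> (pull B K ?eta \<kappa>)"
        using ext_eq_push[OF P pull_closed[OF h(1) ac VAO] VAO] by blast
      \<comment> \<open>The class is a pullback along \<open>?eta\<close> of \<open>\<kappa>\<close>
        pushed along \<open>\<gamma>\<close>, and the latter lives in
        \<open>\<E>(S, VA) = 0\<close>.\<close>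
      have "push B S \<gamma> \<kappa> = ezero S VA" using S_V_ext[OF S VA] push_closed[OF ga(1) km(1,6)] by blast
      then have "pull B VA h \<alpha> = ezero Z VA" using ga push_pull[OF ga(1) eta km(1)] pull_ezero[OF eta VAO] by simp
      then show "h \<in> J Z A" using idealI_pull[OF al TA h(1)] by blast
    qed
    fix A h assume A: "A \<in> \<H>" and h: "h \<in> mor B P A" "h \<cdot> a \<in> J K A"
    obtain T' x y where x: "T' \<in> \<T>" "x \<in> mor B K T'" "y \<in> mor B T' A" "h \<cdot> a = y \<cdot> x"
      using h(2) by (rule idealE)
    \<comment> \<open>\<open>\<E>(S, T') = 0\<close> extends \<open>x\<close> over
      \<open>K \<rightarrow> T\<close>. Through \<open>\<tau>\<close> this yields a morphism of the
      ideal that agrees with \<open>h\<close> after \<open>a\<close>, so the difference descends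
      along \<open>n\<close>.\<close>
    have "push B S x \<kappa> = ezero S T'" using S_T_ext[OF S x(1)] push_closed[OF x(2) km(1,6)] by blast
    then obtain x' where x': "x' \<in> mor B T T'" "x' \<cdot> c' = x" using inflation_extend[OF K(2) x(2)] by blast
    have xt: "x' \<cdot> \<tau> \<in> mor B P T'" using Comp_mor tau x' by blast
    have yxt: "y \<cdot> (x' \<cdot> \<tau>) \<in> mor B P A" using Comp_mor[OF xt x(3)] .
    have "(y \<cdot> (x' \<cdot> \<tau>)) \<cdot> a = h \<cdot> a"
      using Comp_assoc[OF Pm(2) xt x(3)] Comp_assoc[OF Pm(2) tau(1) x'(1)] tau_a x' x by simp
    then have "mdiff P A h (y \<cdot> (x' \<cdot> \<tau>)) \<cdot> a = zmor K A"
      using mdiff_Comp[OF Pm(2) h(1) yxt] mdiff_eq_zmor_iff[OF Comp_mor[OF Pm(2) h(1)] Comp_mor[OF Pm(2) h(1)]] by simp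
    then obtain u where u: "u \<in> mor B Z A" "u \<cdot> n = mdiff P A h (y \<cdot> (x' \<cdot> \<tau>))"
      using deflation_factor[OF P mdiff_mor[OF h(1) yxt]] by blast
    have "mdiff P A h (u \<cdot> n) \<in> J P A" using u mdiff_mdiff[OF h(1) yxt] idealI[OF x(1) xt x(3)] by simp
    then have "cls P A (u \<cdot> n) = cls P A h"
      using heart.cls_eq_iff[OF PH A h(1) Comp_mor[OF Pm(3) u(1)]] by simp
    then show "\<exists>u\<in>mor B Z A. cls P A (u \<cdot> n) = cls P A h" using u by blast
  qed
  then have "is_cokernel Q P Z (cls P Z n)" unfolding is_cokernel_def by blast
  then show ?thesis using PH p(1) Pm(3) eq by blast
qed

lemma T_heart: "T \<in> \<T> \<Longrightarrow> T \<in> \<H>"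
  using heartI[OF T_Obj] idealI[OF _ _ Ident_mor[OF T_Obj]] Ident_Comp by metis

lemma heart_lifting_preabelian: "lifting_preabelian Q"
proof -
  obtain N where N: "N \<in> \<T>" using additive_subcategoryD(3)[OF cotorsion_pairD(2)[OF ST]] by blast
  have "Ident B N \<in> J N N"
    using idealI[OF N Ident_mor Ident_mor] Comp_Ident[OF Ident_mor] T_Obj[OF N] by metis
  then have zero: "zero_object Q N" using heart.zero_object_Q[OF T_heart[OF N]] by blast
  show ?thesis
  proof unfold_locales
    show "\<exists>N. zero_object Q N" using zero by blast
  next
    fix X Y assume "X \<in> Obj Q" "Y \<in> Obj Q"
    then have X: "X \<in> \<H>" "Y \<in> \<H>" by simp_all
    obtain D i j p q where D: "biproduct B X Y D i j p q" using ex_biproduct H_Obj X by blast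
    show "\<exists>P i j p q. biproduct Q X Y P i j p q"
      using heart.biproduct_cls[OF X biproduct_heart[OF D X] D] by blast
  next
    fix F X Y assume "F \<in> mor Q X Y"
    then obtain f where X: "X \<in> \<H>" and Y: "Y \<in> \<H>" and f: "f \<in> mor B X Y" and F: "F = cls X Y f"
      by (rule heart.mor_QE)
    obtain \<delta> V T v t where V: "V \<in> \<V>" "T \<in> \<T>" and r: "realised B \<delta> V T Y v t"
      using Y by (rule heart_presentation)
    obtain K w k where "realised B (pull B V f \<delta>) V K X w k"
      using ex_realised[OF H_Obj[OF X] V_Obj[OF V(1)] pull_closed[OF f realised_mor(1)[OF r] V_Obj[OF V(1)]]] .
    then show "\<exists>K k. kernel_of Q X Y F K k" using heart_kernel[OF X Y f r V] F by blast
    show "\<exists>K k. cokernel_of Q X Y F K k"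
      using heart_cokernel_factorisation(1)[OF X Y f] F by blast
    show "\<exists>K j k. epimorphism Q X K j \<and> is_kernel Q K Y k \<and> F = k \<cdot>\<^bsub>Q\<^esub> j"
      using heart_cokernel_factorisation(2)[OF X Y f] F by blast
  next
    fix X Z F Y G assume e: "epimorphism Q X Z F" and "G \<in> mor Q Y Z"
    then obtain g where Y: "Y \<in> \<H>" and Z: "Z \<in> \<H>" and g: "g \<in> mor B Y Z" and G: "G = cls Y Z g"
      by (auto elim: heart.mor_QE)
    obtain f where X: "X \<in> \<H>" and f: "f \<in> mor B X Z" and F: "F = cls X Z f"
      using heart.Q.epimorphism_mor[OF e] by (auto elim: heart.mor_QE)
    obtain P p q where P: "P \<in> \<H>" "p \<in> mor B P X" "q \<in> mor B P Y"
      "cls P Z (f \<cdot> p) = cls P Z (g \<cdot> q)" "epimorphism Q P Y (cls P Y q)"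
      using heart_epi_lift[OF X Y Z f g] e F by blast
    then have "F \<cdot>\<^bsub>Q\<^esub> cls P X p = G \<cdot>\<^bsub>Q\<^esub> cls P Y q"
      using heart.cls_Comp[OF P(1) X Z P(2) f] heart.cls_Comp[OF P(1) Y Z P(3) g] F G by simp
    then show "\<exists>P p q. p \<in> mor Q P X \<and> F \<cdot>\<^bsub>Q\<^esub> p = G \<cdot>\<^bsub>Q\<^esub> q \<and> epimorphism Q P Y q"
      using P heart.cls_mor[OF P(1) X P(2)] by blast
  next
    fix X Z F Y G assume c: "is_cokernel Q X Z F" and G: "G \<in> mor Q Y Z"
    then obtain A F0 where F0: "cokernel_of Q A X F0 Z F" by (auto simp: is_cokernel_def)
    then have "F0 \<in> mor Q A X" by (simp add: cokernel_of_def)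
    then obtain f where A: "A \<in> \<H>" and X: "X \<in> \<H>" and f: "f \<in> mor B A X" and F0f: "F0 = cls A X f"
      by (rule heart.mor_QE)
    obtain M S \<omega> q s where M: "M \<in> \<H>" "S \<in> \<S>" "realised B \<omega> X M S q s"
      "cokernel_of Q A X F0 M (cls X M q)"
      using heart_cokernel_factorisation(1)[OF A X f] F0f by blast
    \<comment> \<open>The given cokernel \<open>F\<close> differs by an isomorphism from the one
      represented by an inflation with cone in \<open>\<S>\<close>: \<open>G\<close> is transported
      by \<open>i'\<close>, and the resulting square is brought back by \<open>i\<close>.\<close>
    obtain i i' where i: "i \<in> mor Q M Z" "i' \<in> mor Q Z M" "i \<cdot>\<^bsub>Q\<^esub> cls X M q = F"
      "i \<cdot>\<^bsub>Q\<^esub> i' = Ident Q Z"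
      using heart.Q.cokernel_unique[OF M(4) F0] by blast
    have "i' \<cdot>\<^bsub>Q\<^esub> G \<in> mor Q Y M" using heart.Q.Comp_mor[OF G i(2)] .
    then obtain g where Y: "Y \<in> \<H>" and g: "g \<in> mor B Y M" and iG: "i' \<cdot>\<^bsub>Q\<^esub> G = cls Y M g"
      by (auto elim: heart.mor_QE)
    obtain P p n where P: "P \<in> \<H>" "p \<in> mor B P X" "n \<in> mor B P Y"
      "cls P M (q \<cdot> p) = cls P M (g \<cdot> n)" "is_cokernel Q P Y (cls P Y n)"
      using heart_cokernel_lift[OF M(3,2) X M(1) Y g] by blast
    have q: "q \<in> mor B X M" using realised_mor[OF M(3)] by blast
    note pq = heart.cls_mor[OF P(1) X P(2)] heart.cls_mor[OF P(1) Y P(3)] heart.cls_mor[OF X M(1) q]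
    have "F \<cdot>\<^bsub>Q\<^esub> cls P X p = i \<cdot>\<^bsub>Q\<^esub> (cls X M q \<cdot>\<^bsub>Q\<^esub> cls P X p)"
      using heart.Q.Comp_assoc[OF pq(1,3) i(1)] i(3) by simp
    also have "cls X M q \<cdot>\<^bsub>Q\<^esub> cls P X p = (i' \<cdot>\<^bsub>Q\<^esub> G) \<cdot>\<^bsub>Q\<^esub> cls P Y n"
      using heart.cls_Comp[OF P(1) X M(1) P(2) q] heart.cls_Comp[OF P(1) Y M(1) P(3) g] P(4) iG by simp
    also have "i \<cdot>\<^bsub>Q\<^esub> (i' \<cdot>\<^bsub>Q\<^esub> G) \<cdot>\<^bsub>Q\<^esub> cls P Y n = (i \<cdot>\<^bsub>Q\<^esub> i') \<cdot>\<^bsub>Q\<^esub> (G \<cdot>\<^bsub>Q\<^esub> cls P Y n)"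
      using heart.Q.Comp_assoc[OF pq(2) G i(2)]
        heart.Q.Comp_assoc[OF heart.Q.Comp_mor[OF pq(2) G] i(2,1)] by simp
    also have "\<dots> = G \<cdot>\<^bsub>Q\<^esub> cls P Y n"
      using i(4) heart.Q.Ident_Comp[OF heart.Q.Comp_mor[OF pq(2) G]] by simp
    finally show "\<exists>P p q. p \<in> mor Q P X \<and> F \<cdot>\<^bsub>Q\<^esub> p = G \<cdot>\<^bsub>Q\<^esub> q \<and> is_cokernel Q P Y q"
      using P(5) pq(1) by blast
  qed
qed

text \<open>\<open>B_minus\<close> is everything, because each object has a conflation into
  \<open>\<T>\<close> with cone in \<open>\<S>\<close>.\<close>

lemma heart_eq: "heart B \<S> \<T> \<U> \<V> = Q"
proof -
  have "\<T> \<inter> \<U> = \<T>" using T_U by blast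
  moreover have "CoCone B \<T> \<S> = Obj B" using cotorsion_pairD(7)[OF ST] .
  moreover have "Obj B \<inter> \<H> = \<H>" by (auto simp: Cone_def)
  ultimately show ?thesis by (simp add: heart_def B_minus_def B_plus_def twin_core_def)
qed

lemma integral_quasi_abelian_heart:
  "integral_category (heart B \<S> \<T> \<U> \<V>)" "quasi_abelian_category (heart B \<S> \<T> \<U> \<V>)"
proof -
  interpret L: lifting_preabelian Q by (rule heart_lifting_preabelian)
  show "integral_category (heart B \<S> \<T> \<U> \<V>)" "quasi_abelian_category (heart B \<S> \<T> \<U> \<V>)"
    unfolding heart_eq by unfold_locales
qed

end

section \<open>Duality of twin cotorsion pairs\<close>

context extriangulated_category
begin

lemma conflation_op: "conflation (op_extri B) A M C a b = conflation B C M A b a"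
  by (simp add: conflation_def realised_op)

lemma injective_object_op: "injective_object (op_extri B) X = projective_object B X"
  unfolding injective_object_def projective_object_def conflation_op op_extri_simps mor_op_extri by blast

lemma enough_injectives_op: "enough_injectives (op_extri B) = enough_projectives B"
  unfolding enough_injectives_def enough_projectives_def conflation_op injective_object_op op_extri_simps
  by blast

lemma Cone_op: "Cone (op_extri B) \<Y> \<X> = CoCone B \<X> \<Y>"
  and CoCone_op: "CoCone (op_extri B) \<Y> \<X> = Cone B \<X> \<Y>"
  unfolding Cone_def CoCone_def conflation_op by auto

lemma iso_closed_op: "iso_closed (op_extri B) \<X> = iso_closed B \<X>"
proof -
  have "iso_mor B X Y f \<Longrightarrow> \<exists>g. iso_mor B Y X g" for X Y f unfolding iso_mor_def by blast
  then show ?thesis unfolding iso_closed_def iso_mor_op_extri by meson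
qed

lemma biproduct_op_iff: "biproduct (op_extri B) X Y P i j p q \<longleftrightarrow> biproduct B X Y P p q i j"
  by simp

lemma additive_subcategory_op: "additive_subcategory (op_extri B) \<X> = additive_subcategory B \<X>"
  unfolding additive_subcategory_def iso_closed_op biproduct_op_iff zero_object_op_extri op_extri_simps
  by metis

lemma summand_closed_op: "summand_closed (op_extri B) \<X> = summand_closed B \<X>"
  unfolding summand_closed_def biproduct_op_iff by metis

lemma Ext_vanishes_op: "Ext_vanishes (op_extri B) \<X> \<Y> = Ext_vanishes B \<Y> \<X>"
  unfolding Ext_vanishes_def by auto

lemma cotorsion_pair_op: "cotorsion_pair (op_extri B) \<V> \<U> = cotorsion_pair B \<U> \<V>"
  unfolding cotorsion_pair_def additive_subcategory_op summand_closed_op Ext_vanishes_op Cone_op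
    CoCone_op op_extri_simps by blast

lemma twin_cotorsion_pair_op:
  "twin_cotorsion_pair (op_extri B) \<V> \<U> \<T> \<S> = twin_cotorsion_pair B \<S> \<T> \<U> \<V>"
  unfolding twin_cotorsion_pair_def cotorsion_pair_op Ext_vanishes_op by blast

end

lemma factor_ideal_op: "factor_ideal (op_extri B) \<W> X Y = factor_ideal B \<W> Y X"
  unfolding factor_ideal_def by auto

lemma ideal_quotient_op: "ideal_quotient (op_extri B) \<H> \<W> = op_cat (ideal_quotient B \<H> \<W>)"
proof -
  have "{factor_ideal B \<W> Z X #>\<^bsub>Hom B Z X\<^esub> (f \<cdot>\<^bsub>B\<^esub> g) | X Y Z f g.
      f \<in> F \<and> f \<in> mor B Y X \<and> g \<in> G \<and> g \<in> mor B Z Y} =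
    {factor_ideal B \<W> X Z #>\<^bsub>Hom B X Z\<^esub> (g \<cdot>\<^bsub>B\<^esub> f) | X Y Z f g.
      f \<in> G \<and> f \<in> mor B X Y \<and> g \<in> F \<and> g \<in> mor B Y Z}" for F G
    by blast
  then show ?thesis by (simp add: ideal_quotient_def op_cat_def factor_ideal_op)
qed

text \<open>\<open>Cone\<close> and \<open>CoCone\<close> are exchanged, and with them the two
  classes whose intersection gives the objects of the heart.\<close>

lemma (in extriangulated_category) heart_op:
  "heart (op_extri B) \<V> \<U> \<T> \<S> = op_cat (heart B \<S> \<T> \<U> \<V>)"
  by (simp add: heart_def B_minus_def B_plus_def twin_core_def Cone_op CoCone_op ideal_quotient_op
      Int_commute)

theorem corollary4p3:
  fixes B :: "('o, 'm, 'e) extri_cat"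
    and \<S> \<T> \<U> \<V> :: "'o set"
  assumes "extriangulated_category B"
    and "enough_projectives B"
    and "enough_injectives B"
    and "twin_cotorsion_pair B \<S> \<T> \<U> \<V>"
    and "\<T> \<subseteq> \<U> \<or> \<U> \<subseteq> \<T>"
  shows "integral_category (heart B \<S> \<T> \<U> \<V>) \<and> quasi_abelian_category (heart B \<S> \<T> \<U> \<V>)"
  using assms(5)
proof
  assume "\<T> \<subseteq> \<U>"
  then interpret nested_twin_cotorsion_pair B \<S> \<T> \<U> \<V>
    using assms by (intro nested_twin_cotorsion_pair.intro nested_twin_cotorsion_pair_axioms.intro)
  show ?thesis using integral_quasi_abelian_heart by blast
next
  assume U: "\<U> \<subseteq> \<T>"
  interpret extriangulated_category B by fact
  \<comment> \<open>In the opposite category the pairs are \<open>(\<V>, \<U>)\<close> and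
    \<open>(\<T>, \<S>)\<close>, so \<open>\<U>\<close> takes the part of \<open>\<T>\<close> and
    the inclusion becomes the required nesting.\<close>
  interpret op: nested_twin_cotorsion_pair "op_extri B" \<V> \<U> \<T> \<S>
    using assms U
    by (intro nested_twin_cotorsion_pair.intro nested_twin_cotorsion_pair_axioms.intro
        extriangulated_op_extri) (simp_all add: twin_cotorsion_pair_op enough_injectives_op)
  show ?thesis
    using integral_op_cat[OF op.integral_quasi_abelian_heart(1)]
      quasi_abelian_op_cat[OF op.integral_quasi_abelian_heart(2)] by (simp add: heart_op)
qed

end
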